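(* Let $L:A\to\mathbb R$ be a pseudo-Finsler metric on $M$ with fundamental tensor $g$ and Cartan tensor $C$, and let $V\in\mathfrak X(\Omega)$ be an $A$-admissible vector field on an open subset $\Omega\subset M$. Let $\overline\nabla$ be the Levi-Civita connection of the pseudo-Riemannian metric $g_V$ on $\Omega$. Let $\mathcal Q$ be a symmetric $A$-anisotropic tensor of type $(0,3)$ with $\mathcal Q_v(v,u,w)=0$ for all $v\in A$, $u,w\in T_{\pi(v)}M$, and let $\hat\nabla$ be the torsion-free $A$-anisotropic connection satisfying $\hat\nabla g=\mathcal Q$. Then for all $X,Y,Z\in\mathfrak X(\Omega)$, $$g_V(\hat\nabla^V_XY-\overline\nabla_XY,Z)=-C_V(Y,Z,\hat\nabla^V_XV)-C_V(Z,X,\hat\nabla^V_YV)+C_V(X,Y,\hat\nabla^V_ZV)-\tfrac12\mathcal Q_V(X,Y,Z).$$ In particular, $$\begin{aligned}g_V(\hat\nabla^V_XV-\overline\nabla_XV,Z)&=-C_V(Z,X,\hat\nabla^V_VV),\\ g_V(\hat\nabla^V_VX-\overline\nabla_VX,Z)&=-C_V(X,Z,\hat\nabla^V_VV),\\ g_V(\hat\nabla^V_XY-\overline\nabla_XY,V)&=C_V(X,Y,\hat\nabla^V_VV).\end{aligned}$$ When $V$ is a geodesic vector field, then $\hat\nabla^V_XV=\overline\nabla_XV$, $\hat\nabla^V_VX=\overline\nabla_VX$ and $$\hat R_V(V,X)V=\overline R(V,X)V,$$ where $\hat R$ and $\overline R$ are the curvature tensors of $\hat\nabla$ and $\overline\nabla$,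 respectively.
   Context: $M$ is a smooth manifold, $\pi:TM\to M$, and $A\subset TM\setminus\mathbf 0$ is an open conic subset ($\lambda v\in A$ for $v\in A$, $\lambda>0$) with $\pi(A)=M$. A pseudo-Finsler metric on $A$ is a smooth function $L:A\to\mathbb R$ with $L(\lambda v)=\lambda^2L(v)$ for $\lambda>0$, whose fundamental tensor $g_v(u,w)=\frac12\frac{\partial^2}{\partial t\partial s}L(v+tu+sw)|_{t=s=0}$ is non-degenerate for each $v\in A$. The Cartan tensor is $C_v(w_1,w_2,w_3)=\frac14\frac{\partial^3}{\partial s_3\partial s_2\partial s_1}L(v+\sum_{i=1}^3s_iw_i)|_{s_1=s_2=s_3=0}$. $\mathcal F(\cdot)$ denotes smooth functions, $\mathfrak X(\cdot)$ smooth vector fields. $\mathfrak T^1_0(M,A)$ is the set of smooth maps $v\in A\mapsto\mathcal X_v\in T_{\pi(v)}M$; vector fields $X$ on $M$ are regarded as such maps via $v\mapsto X_{\pi(v)}$. An $A$-anisotropic tensor of type $(0,s)$ (resp. $(1,s)$) amounts to multilinear maps $T_v:(T_{\pi(v)}M)^s\to\mathbb R$ (resp. $\to T_{\pi(v)}M$) depending smoothly on $v\in A$; vertical derivative $(\partial^\nu T)_v(x_1,\ldots,x_s,z)=\frac{d}{dt}T_{v+tz}(x_1,\ldots,x_s)|_{t=0}$. A vector field $V$ on an open $\Omega\subset M$ is $A$-admissible if $V_p\in A$ for all $p\in\Omega$; it extends $v$ if $V_{\pi(v)}=v$; $T_V$ is the classical tensor field with $(T_V)_p=T_{V_p}$ (e.g.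 $g_V$, $C_V$, $\mathcal Q_V$, $\hat R_V$). An $A$-anisotropic connection is a map $\nabla:A\times\mathfrak X(M)\times\mathfrak X(M)\to TM$, $(v,X,Y)\mapsto\nabla^v_XY\in T_{\pi(v)}M$, additive in $Y$, with $\nabla^v_X(fY)=X_{\pi(v)}(f)Y_{\pi(v)}+f(\pi(v))\nabla^v_XY$, $\nabla^v_{fX+hY}Z=f(\pi(v))\nabla^v_XZ+h(\pi(v))\nabla^v_YZ$ for $f,h\in\mathcal F(M)$, and with $\nabla_XY\in\mathfrak T^1_0(M,A)$. $\nabla^V$ is the affine connection on $\Omega$ with $(\nabla^V_XY)_p=\nabla^{V_p}_XY$. $\nabla$ is torsion-free if $\nabla^v_XY-\nabla^v_YX=[X,Y]_{\pi(v)}$. For any local $A$-admissible extension $V$ of $v$ (independently of $V$): $(\nabla_Xh)(v)=X_{\pi(v)}(h(V))-(\partial^\nu h)_v(\nabla^v_XV)$ for $h\in\mathcal F(A)$, $\nabla^v_X\mathcal Y=\nabla^v_X(\mathcal Y_V)-(\partial^\nu\mathcal Y)_v(\nabla^v_XV)$ for $\mathcal Y\in\mathfrak T^1_0(M,A)$, and $(\nabla_XT)(X_1,\ldots,X_s)=\nabla_X(T(X_1,\ldots,X_s))-\sum_jT(\ldots,\nabla_XX_j,\ldots)$; $(\nabla_XT)_v$ depends only on $X_{\pi(v)}$. $\hat\nabla g=\mathcal Q$ means $(\hat\nabla_ug)_v(w,z)=\mathcal Q_v(u,w,z)$. Curvature tensor: $\hat R_v(X,Y)Z=\hat\nabla^v_X(\hat\nabla_YZ)-\hat\nabla^v_Y(\hat\nabla_XZ)-\hat\nabla^v_{[X,Y]}Z$;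 $\overline R(X,Y)Z=\overline\nabla_X\overline\nabla_YZ-\overline\nabla_Y\overline\nabla_XZ-\overline\nabla_{[X,Y]}Z$. A geodesic vector field is an $A$-admissible $V$ whose integral curves are geodesics of $L$, i.e. auto-parallel curves of the Levi-Civita–Chern connection (the unique torsion-free $A$-anisotropic connection with $\nabla g=0$), which coincide with those of $\hat\nabla$; equivalently $\hat\nabla^V_VV=0$. *)

theory Defs
  imports "HOL-Analysis.Analysis"
begin

section \<open>Smooth maps between Euclidean spaces\<close>

text \<open>
  For open \<open>S\<close> and a Euclidean domain, \<open>Ck_on k S f\<close> says that all iterated partial derivatives of
  \<open>f\<close> of order at most \<open>k\<close> exist and are continuous on \<open>S\<close>. It is only used for open \<open>S\<close>.
\<close>

primrec Ck_on :: "nat \<Rightarrow> 'a::real_normed_vector set \<Rightarrow> ('a \<Rightarrow> 'b::real_normed_vector) \<Rightarrow> bool" where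
  "Ck_on 0 S f \<longleftrightarrow> continuous_on S f"
| "Ck_on (Suc k) S f \<longleftrightarrow>
     (\<forall>x\<in>S. f differentiable (at x)) \<and> (\<forall>u. Ck_on k S (\<lambda>x. frechet_derivative f (at x) u))"

definition smooth_on :: "'a::real_normed_vector set \<Rightarrow> ('a \<Rightarrow> 'b::real_normed_vector) \<Rightarrow> bool" where
  "smooth_on S f \<longleftrightarrow> (\<forall>k. Ck_on k S f)"


section \<open>Smooth manifolds\<close>

text \<open>
  The manifold is the whole type \<open>'m\<close>, of class \<open>t2_space\<close> and \<open>second_countable_topology\<close>, with a
  smooth atlas of charts \<open>(U, \<phi>)\<close> modelled on the Euclidean space \<open>'e\<close>. The atlas need not be
  maximal: every notion below is required in all charts of the atlas, and so depends on the smooth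
  structure only.
\<close>

type_synonym ('m, 'e) chart = "'m set \<times> ('m \<Rightarrow> 'e)"

abbreviation cdom :: "('m, 'e) chart \<Rightarrow> 'm set" where "cdom \<equiv> fst"
abbreviation cmap :: "('m, 'e) chart \<Rightarrow> 'm \<Rightarrow> 'e" where "cmap \<equiv> snd"

definition cinv :: "('m, 'e) chart \<Rightarrow> 'e \<Rightarrow> 'm" where
  "cinv c = inv_into (cdom c) (cmap c)"

definition smooth_atlas ::
    "('m::{t2_space,second_countable_topology}, 'e::euclidean_space) chart set \<Rightarrow> bool" where
  "smooth_atlas \<A> \<longleftrightarrow>
     (\<Union>c\<in>\<A>. cdom c) = UNIV \<and>
     (\<forall>c\<in>\<A>. open (cdom c) \<and> open (cmap c ` cdom c) \<and>
        homeomorphism (cdom c) (cmap c ` cdom c) (cmap c) (cinv c)) \<and>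
     (\<forall>c\<in>\<A>. \<forall>d\<in>\<A>. smooth_on (cmap c ` (cdom c \<inter> cdom d)) (cmap d \<circ> cinv c))"

definition smooth_fun ::
    "('m, 'e::euclidean_space) chart set \<Rightarrow> 'm set \<Rightarrow> ('m \<Rightarrow> 'b::real_normed_vector) \<Rightarrow> bool" where
  "smooth_fun \<A> U f \<longleftrightarrow> (\<forall>c\<in>\<A>. smooth_on (cmap c ` (U \<inter> cdom c)) (f \<circ> cinv c))"


section \<open>The tangent bundle\<close>

text \<open>
  Every point \<open>p\<close> gets a preferred chart \<open>chart_at \<A> p\<close>, and the tangent space at \<open>p\<close> is the model
  space \<open>'e\<close>: a tangent vector at \<open>p\<close> is represented by its components in the preferred chart at \<open>p\<close>.
  So \<open>TM\<close> is \<open>'m \<times> 'e\<close> as a set, with \<open>\<pi> = fst\<close>. Since the preferred chart varies with the point,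
  the topology and the smooth structure of \<open>TM\<close> are not those of the product; they are given by the
  induced charts \<open>tchart \<A> c\<close> below.
\<close>

definition chart_at :: "('m, 'e) chart set \<Rightarrow> 'm \<Rightarrow> ('m, 'e) chart" where
  "chart_at \<A> p = (SOME c. c \<in> \<A> \<and> p \<in> cdom c)"

definition change_deriv ::
    "('m, 'e::euclidean_space) chart \<Rightarrow> ('m, 'e) chart \<Rightarrow> 'm \<Rightarrow> 'e \<Rightarrow> 'e" where
  "change_deriv c d p = frechet_derivative (cmap d \<circ> cinv c) (at (cmap c p))"

text \<open>
  \<open>tcoord \<A> c p x\<close> are the components in the chart \<open>c\<close> of the tangent vector \<open>x\<close> at \<open>p\<close>, and
  \<open>coord_field \<A> c a\<close> is the vector field on the domain of \<open>c\<close> with constant components \<open>a\<close>.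
\<close>

definition tcoord ::
    "('m, 'e::euclidean_space) chart set \<Rightarrow> ('m, 'e) chart \<Rightarrow> 'm \<Rightarrow> 'e \<Rightarrow> 'e" where
  "tcoord \<A> c p x = change_deriv (chart_at \<A> p) c p x"

definition coord_field ::
    "('m, 'e::euclidean_space) chart set \<Rightarrow> ('m, 'e) chart \<Rightarrow> 'e \<Rightarrow> 'm \<Rightarrow> 'e" where
  "coord_field \<A> c a p = change_deriv c (chart_at \<A> p) p a"

definition tchart ::
    "('m, 'e::euclidean_space) chart set \<Rightarrow> ('m, 'e) chart \<Rightarrow> 'm \<times> 'e \<Rightarrow> 'e \<times> 'e" where
  "tchart \<A> c v = (cmap c (fst v), tcoord \<A> c (fst v) (snd v))"

definition tchart_inv ::
    "('m, 'e::euclidean_space) chart set \<Rightarrow> ('m, 'e) chart \<Rightarrow> 'e \<times> 'e \<Rightarrow> 'm \<times> 'e" where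
  "tchart_inv \<A> c = inv_into (cdom c \<times> UNIV) (tchart \<A> c)"

definition open_TM :: "('m, 'e::euclidean_space) chart set \<Rightarrow> ('m \<times> 'e) set \<Rightarrow> bool" where
  "open_TM \<A> A \<longleftrightarrow> (\<forall>c\<in>\<A>. open (tchart \<A> c ` (A \<inter> (cdom c \<times> UNIV))))"

definition smooth_fun_TM ::
    "('m, 'e::euclidean_space) chart set \<Rightarrow> ('m \<times> 'e) set \<Rightarrow>
      ('m \<times> 'e \<Rightarrow> 'b::real_normed_vector) \<Rightarrow> bool" where
  "smooth_fun_TM \<A> A h \<longleftrightarrow>
     (\<forall>c\<in>\<A>. smooth_on (tchart \<A> c ` (A \<inter> (cdom c \<times> UNIV))) (h \<circ> tchart_inv \<A> c))"

definition conic_domain :: "('m, 'e::euclidean_space) chart set \<Rightarrow> ('m \<times> 'e) set \<Rightarrow> bool" where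
  "conic_domain \<A> A \<longleftrightarrow>
     open_TM \<A> A \<and> (\<forall>(p, x)\<in>A. x \<noteq> 0) \<and>
     (\<forall>(p, x)\<in>A. \<forall>l>0. (p, l *\<^sub>R x) \<in> A) \<and> fst ` A = UNIV"


section \<open>Vector fields\<close>

text \<open>
  A vector field on \<open>U\<close> is a total function \<open>'m \<Rightarrow> 'e\<close> whose values outside \<open>U\<close> are irrelevant.
\<close>

definition vector_field ::
    "('m, 'e::euclidean_space) chart set \<Rightarrow> 'm set \<Rightarrow> ('m \<Rightarrow> 'e) \<Rightarrow> bool" where
  "vector_field \<A> U X \<longleftrightarrow>
     (\<forall>c\<in>\<A>. smooth_on (cmap c ` (U \<inter> cdom c)) ((\<lambda>p. tcoord \<A> c p (X p)) \<circ> cinv c))"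

text \<open>\<open>tderiv \<A> p x f\<close> is the derivative \<open>x(f)\<close> of \<open>f\<close> in the direction of the tangent vector \<open>x\<close> at \<open>p\<close>.\<close>

definition tderiv ::
    "('m, 'e::euclidean_space) chart set \<Rightarrow> 'm \<Rightarrow> 'e \<Rightarrow> ('m \<Rightarrow> 'b::real_normed_vector) \<Rightarrow> 'b" where
  "tderiv \<A> p x f =
     frechet_derivative (f \<circ> cinv (chart_at \<A> p)) (at (cmap (chart_at \<A> p) p)) x"

text \<open>\<open>[X, Y]\<close> at \<open>p\<close>: the tangent vector acting on smooth functions near \<open>p\<close> as the commutator.\<close>

definition lie_bracket ::
    "('m::topological_space, 'e::euclidean_space) chart set \<Rightarrow> ('m \<Rightarrow> 'e) \<Rightarrow> ('m \<Rightarrow> 'e) \<Rightarrow> 'm \<Rightarrow> 'e" where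
  "lie_bracket \<A> X Y p =
     (THE z. \<forall>U (f :: 'm \<Rightarrow> real). open U \<and> p \<in> U \<and> smooth_fun \<A> U f \<longrightarrow>
        tderiv \<A> p z f =
          tderiv \<A> p (X p) (\<lambda>q. tderiv \<A> q (Y q) f) - tderiv \<A> p (Y p) (\<lambda>q. tderiv \<A> q (X q) f))"

definition admissible ::
    "('m::topological_space, 'e::euclidean_space) chart set \<Rightarrow> ('m \<times> 'e) set \<Rightarrow>
      'm set \<Rightarrow> ('m \<Rightarrow> 'e) \<Rightarrow> bool" where
  "admissible \<A> A U V \<longleftrightarrow> open U \<and> vector_field \<A> U V \<and> (\<forall>p\<in>U. (p, V p) \<in> A)"


section \<open>Anisotropic tensors and pseudo-Finsler metrics\<close>

text \<open>\<open>along T V\<close> is \<open>T\<^sub>V\<close>.\<close>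

definition along :: "('m \<times> 'e \<Rightarrow> 'b) \<Rightarrow> ('m \<Rightarrow> 'e) \<Rightarrow> 'm \<Rightarrow> 'b" where
  "along T V p = T (p, V p)"

definition vert_deriv ::
    "('m \<times> 'e::real_normed_vector \<Rightarrow> 'b::real_normed_vector) \<Rightarrow> 'm \<times> 'e \<Rightarrow> 'e \<Rightarrow> 'b" where
  "vert_deriv T v z = vector_derivative (\<lambda>t. T (fst v, snd v + t *\<^sub>R z)) (at 0)"

text \<open>The elements of the space \<open>\<T>\<^sup>1\<^sub>0(M, A)\<close>.\<close>

definition aniso_field ::
    "('m, 'e::euclidean_space) chart set \<Rightarrow> ('m \<times> 'e) set \<Rightarrow> ('m \<times> 'e \<Rightarrow> 'e) \<Rightarrow> bool" where
  "aniso_field \<A> A Y \<longleftrightarrow>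
     (\<forall>c\<in>\<A>. smooth_on (tchart \<A> c ` (A \<inter> (cdom c \<times> UNIV)))
        ((\<lambda>v. tcoord \<A> c (fst v) (Y v)) \<circ> tchart_inv \<A> c))"

text \<open>Anisotropic tensors of type \<open>(0, 3)\<close>; smoothness means smoothness of the components in each chart.\<close>

definition aniso_tensor3 ::
    "('m, 'e::euclidean_space) chart set \<Rightarrow> ('m \<times> 'e) set \<Rightarrow>
      ('m \<times> 'e \<Rightarrow> 'e \<Rightarrow> 'e \<Rightarrow> 'e \<Rightarrow> real) \<Rightarrow> bool" where
  "aniso_tensor3 \<A> A T \<longleftrightarrow>
     (\<forall>v\<in>A. \<forall>x y. linear (\<lambda>z. T v z x y) \<and> linear (\<lambda>z. T v x z y) \<and> linear (\<lambda>z. T v x y z)) \<and>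
     (\<forall>c\<in>\<A>. \<forall>a1 a2 a3. smooth_on (tchart \<A> c ` (A \<inter> (cdom c \<times> UNIV)))
        ((\<lambda>v. T v (coord_field \<A> c a1 (fst v)) (coord_field \<A> c a2 (fst v))
                 (coord_field \<A> c a3 (fst v))) \<circ> tchart_inv \<A> c))"

definition symmetric3 ::
    "('m \<times> 'e) set \<Rightarrow> ('m \<times> 'e \<Rightarrow> 'e \<Rightarrow> 'e \<Rightarrow> 'e \<Rightarrow> real) \<Rightarrow> bool" where
  "symmetric3 A T \<longleftrightarrow> (\<forall>v\<in>A. \<forall>x y z. T v x y z = T v y x z \<and> T v x y z = T v x z y)"

definition fund_tensor :: "('m \<times> 'e::real_vector \<Rightarrow> real) \<Rightarrow> 'm \<times> 'e \<Rightarrow> 'e \<Rightarrow> 'e \<Rightarrow> real" where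
  "fund_tensor L v u w =
     1 / 2 * deriv (\<lambda>t. deriv (\<lambda>s. L (fst v, snd v + t *\<^sub>R u + s *\<^sub>R w)) 0) 0"

definition cartan_tensor ::
    "('m \<times> 'e::real_vector \<Rightarrow> real) \<Rightarrow> 'm \<times> 'e \<Rightarrow> 'e \<Rightarrow> 'e \<Rightarrow> 'e \<Rightarrow> real" where
  "cartan_tensor L v w1 w2 w3 =
     1 / 4 * deriv (\<lambda>s3. deriv (\<lambda>s2. deriv (\<lambda>s1.
       L (fst v, snd v + s1 *\<^sub>R w1 + s2 *\<^sub>R w2 + s3 *\<^sub>R w3)) 0) 0) 0"

definition pseudo_finsler ::
    "('m, 'e::euclidean_space) chart set \<Rightarrow> ('m \<times> 'e) set \<Rightarrow> ('m \<times> 'e \<Rightarrow> real) \<Rightarrow> bool" where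
  "pseudo_finsler \<A> A L \<longleftrightarrow>
     conic_domain \<A> A \<and> smooth_fun_TM \<A> A L \<and>
     (\<forall>(p, x)\<in>A. \<forall>l>0. L (p, l *\<^sub>R x) = l\<^sup>2 * L (p, x)) \<and>
     (\<forall>v\<in>A. \<forall>u. (\<forall>w. fund_tensor L v u w = 0) \<longrightarrow> u = 0)"


section \<open>Anisotropic connections\<close>

type_synonym ('m, 'e) aniso_conn = "'m \<times> 'e \<Rightarrow> ('m \<Rightarrow> 'e) \<Rightarrow> ('m \<Rightarrow> 'e) \<Rightarrow> 'e"

definition aniso_connection ::
    "('m, 'e::euclidean_space) chart set \<Rightarrow> ('m \<times> 'e) set \<Rightarrow> ('m, 'e) aniso_conn \<Rightarrow> bool" where
  "aniso_connection \<A> A D \<longleftrightarrow>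
     (\<forall>v\<in>A. \<forall>X Y Z. vector_field \<A> UNIV X \<and> vector_field \<A> UNIV Y \<and> vector_field \<A> UNIV Z \<longrightarrow>
        D v X (\<lambda>p. Y p + Z p) = D v X Y + D v X Z) \<and>
     (\<forall>v\<in>A. \<forall>X Y (f :: 'm \<Rightarrow> real).
        vector_field \<A> UNIV X \<and> vector_field \<A> UNIV Y \<and> smooth_fun \<A> UNIV f \<longrightarrow>
        D v X (\<lambda>p. f p *\<^sub>R Y p) =
          tderiv \<A> (fst v) (X (fst v)) f *\<^sub>R Y (fst v) + f (fst v) *\<^sub>R D v X Y) \<and>
     (\<forall>v\<in>A. \<forall>X Y Z (f :: 'm \<Rightarrow> real) (h :: 'm \<Rightarrow> real).
        vector_field \<A> UNIV X \<and> vector_field \<A> UNIV Y \<and> vector_field \<A> UNIV Z \<and>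
        smooth_fun \<A> UNIV f \<and> smooth_fun \<A> UNIV h \<longrightarrow>
        D v (\<lambda>p. f p *\<^sub>R X p + h p *\<^sub>R Y p) Z = f (fst v) *\<^sub>R D v X Z + h (fst v) *\<^sub>R D v Y Z) \<and>
     (\<forall>X Y. vector_field \<A> UNIV X \<and> vector_field \<A> UNIV Y \<longrightarrow> aniso_field \<A> A (\<lambda>v. D v X Y))"

definition aniso_torsion_free ::
    "('m::topological_space, 'e::euclidean_space) chart set \<Rightarrow> ('m \<times> 'e) set \<Rightarrow>
      ('m, 'e) aniso_conn \<Rightarrow> bool" where
  "aniso_torsion_free \<A> A D \<longleftrightarrow>
     (\<forall>v\<in>A. \<forall>X Y. vector_field \<A> UNIV X \<and> vector_field \<A> UNIV Y \<longrightarrow>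
        D v X Y - D v Y X = lie_bracket \<A> X Y (fst v))"

text \<open>
  A connection acts on vector fields of \<open>M\<close>. On fields that are only defined near \<open>\<pi>(v)\<close> it is
  evaluated through globally defined fields with the same germ; by locality the choice is irrelevant.
\<close>

definition germ_ext ::
    "('m::topological_space, 'e::euclidean_space) chart set \<Rightarrow> 'm \<Rightarrow> ('m \<Rightarrow> 'e) \<Rightarrow> 'm \<Rightarrow> 'e" where
  "germ_ext \<A> p Y = (SOME Y'. vector_field \<A> UNIV Y' \<and> (\<forall>\<^sub>F q in nhds p. Y' q = Y q))"

definition conn_loc ::
    "('m::topological_space, 'e::euclidean_space) chart set \<Rightarrow> ('m, 'e) aniso_conn \<Rightarrow>
      ('m, 'e) aniso_conn" where
  "conn_loc \<A> D v X Y = D v (germ_ext \<A> (fst v) X) (germ_ext \<A> (fst v) Y)"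

text \<open>\<open>conn_along \<A> D V\<close> is the affine connection \<open>\<nabla>\<^sup>V\<close>.\<close>

definition conn_along ::
    "('m::topological_space, 'e::euclidean_space) chart set \<Rightarrow> ('m, 'e) aniso_conn \<Rightarrow> ('m \<Rightarrow> 'e) \<Rightarrow>
      ('m \<Rightarrow> 'e) \<Rightarrow> ('m \<Rightarrow> 'e) \<Rightarrow> 'm \<Rightarrow> 'e" where
  "conn_along \<A> D V X Y p = conn_loc \<A> D (p, V p) X Y"

text \<open>
  The derivatives of anisotropic objects use an admissible local extension of \<open>v\<close>; the result does
  not depend on its choice.
\<close>

definition adm_ext ::
    "('m::topological_space, 'e::euclidean_space) chart set \<Rightarrow> ('m \<times> 'e) set \<Rightarrow> 'm \<times> 'e \<Rightarrow> 'm \<Rightarrow> 'e" where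
  "adm_ext \<A> A v = (SOME V. \<exists>U. fst v \<in> U \<and> admissible \<A> A U V \<and> V (fst v) = snd v)"

definition conn_fun ::
    "('m::topological_space, 'e::euclidean_space) chart set \<Rightarrow> ('m \<times> 'e) set \<Rightarrow> ('m, 'e) aniso_conn \<Rightarrow>
      'm \<times> 'e \<Rightarrow> ('m \<Rightarrow> 'e) \<Rightarrow> ('m \<times> 'e \<Rightarrow> real) \<Rightarrow> real" where
  "conn_fun \<A> A D v X h =
     (let V = adm_ext \<A> A v in
        tderiv \<A> (fst v) (X (fst v)) (along h V) - vert_deriv h v (conn_loc \<A> D v X V))"

definition conn_field ::
    "('m::topological_space, 'e::euclidean_space) chart set \<Rightarrow> ('m \<times> 'e) set \<Rightarrow> ('m, 'e) aniso_conn \<Rightarrow>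
      'm \<times> 'e \<Rightarrow> ('m \<Rightarrow> 'e) \<Rightarrow> ('m \<times> 'e \<Rightarrow> 'e) \<Rightarrow> 'e" where
  "conn_field \<A> A D v X Y =
     (let V = adm_ext \<A> A v in
        conn_loc \<A> D v X (along Y V) - vert_deriv Y v (conn_loc \<A> D v X V))"

text \<open>\<open>(\<nabla>\<^sub>X T)(Y, Z)\<close> at \<open>v\<close> for \<open>T\<close> of type \<open>(0, 2)\<close>.\<close>

definition conn_tensor2 ::
    "('m::topological_space, 'e::euclidean_space) chart set \<Rightarrow> ('m \<times> 'e) set \<Rightarrow> ('m, 'e) aniso_conn \<Rightarrow>
      ('m \<times> 'e \<Rightarrow> 'e \<Rightarrow> 'e \<Rightarrow> real) \<Rightarrow> 'm \<times> 'e \<Rightarrow> ('m \<Rightarrow> 'e) \<Rightarrow> ('m \<Rightarrow> 'e) \<Rightarrow> ('m \<Rightarrow> 'e) \<Rightarrow> real" where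
  "conn_tensor2 \<A> A D T v X Y Z =
     conn_fun \<A> A D v X (\<lambda>w. T w (Y (fst w)) (Z (fst w)))
     - T v (D v X Y) (Z (fst v)) - T v (Y (fst v)) (D v X Z)"

definition has_metric_derivative ::
    "('m::topological_space, 'e::euclidean_space) chart set \<Rightarrow> ('m \<times> 'e) set \<Rightarrow> ('m \<times> 'e \<Rightarrow> real) \<Rightarrow>
      ('m, 'e) aniso_conn \<Rightarrow> ('m \<times> 'e \<Rightarrow> 'e \<Rightarrow> 'e \<Rightarrow> 'e \<Rightarrow> real) \<Rightarrow> bool" where
  "has_metric_derivative \<A> A L D Q \<longleftrightarrow>
     (\<forall>v\<in>A. \<forall>X Y Z. vector_field \<A> UNIV X \<and> vector_field \<A> UNIV Y \<and> vector_field \<A> UNIV Z \<longrightarrow>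
        conn_tensor2 \<A> A D (fund_tensor L) v X Y Z = Q v (X (fst v)) (Y (fst v)) (Z (fst v)))"

text \<open>
  The curvature on vector fields, and the resulting tensor, evaluated on tangent vectors \<open>x, y, z\<close> at
  \<open>\<pi>(v)\<close> through arbitrary fields with these values.
\<close>

definition aniso_curvature ::
    "('m::topological_space, 'e::euclidean_space) chart set \<Rightarrow> ('m \<times> 'e) set \<Rightarrow> ('m, 'e) aniso_conn \<Rightarrow>
      'm \<times> 'e \<Rightarrow> ('m \<Rightarrow> 'e) \<Rightarrow> ('m \<Rightarrow> 'e) \<Rightarrow> ('m \<Rightarrow> 'e) \<Rightarrow> 'e" where
  "aniso_curvature \<A> A D v X Y Z =
     conn_field \<A> A D v X (\<lambda>w. D w Y Z) - conn_field \<A> A D v Y (\<lambda>w. D w X Z)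
     - D v (lie_bracket \<A> X Y) Z"

definition field_through ::
    "('m, 'e::euclidean_space) chart set \<Rightarrow> 'm \<Rightarrow> 'e \<Rightarrow> 'm \<Rightarrow> 'e" where
  "field_through \<A> p x = (SOME X. vector_field \<A> UNIV X \<and> X p = x)"

definition curvature_tensor ::
    "('m::topological_space, 'e::euclidean_space) chart set \<Rightarrow> ('m \<times> 'e) set \<Rightarrow> ('m, 'e) aniso_conn \<Rightarrow>
      'm \<times> 'e \<Rightarrow> 'e \<Rightarrow> 'e \<Rightarrow> 'e \<Rightarrow> 'e" where
  "curvature_tensor \<A> A D v x y z =
     aniso_curvature \<A> A D v
       (field_through \<A> (fst v) x) (field_through \<A> (fst v) y) (field_through \<A> (fst v) z)"


section \<open>Affine connections on an open set\<close>

type_synonym ('m, 'e) affine_conn = "('m \<Rightarrow> 'e) \<Rightarrow> ('m \<Rightarrow> 'e) \<Rightarrow> 'm \<Rightarrow> 'e"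

definition affine_connection ::
    "('m, 'e::euclidean_space) chart set \<Rightarrow> 'm set \<Rightarrow> ('m, 'e) affine_conn \<Rightarrow> bool" where
  "affine_connection \<A> \<Omega> D \<longleftrightarrow>
     (\<forall>X Y. vector_field \<A> \<Omega> X \<and> vector_field \<A> \<Omega> Y \<longrightarrow> vector_field \<A> \<Omega> (D X Y)) \<and>
     (\<forall>X Y Z. vector_field \<A> \<Omega> X \<and> vector_field \<A> \<Omega> Y \<and> vector_field \<A> \<Omega> Z \<longrightarrow>
        (\<forall>p\<in>\<Omega>. D X (\<lambda>q. Y q + Z q) p = D X Y p + D X Z p)) \<and>
     (\<forall>X Y (f :: 'm \<Rightarrow> real).
        vector_field \<A> \<Omega> X \<and> vector_field \<A> \<Omega> Y \<and> smooth_fun \<A> \<Omega> f \<longrightarrow>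
        (\<forall>p\<in>\<Omega>. D X (\<lambda>q. f q *\<^sub>R Y q) p = tderiv \<A> p (X p) f *\<^sub>R Y p + f p *\<^sub>R D X Y p)) \<and>
     (\<forall>X Y Z (f :: 'm \<Rightarrow> real) (h :: 'm \<Rightarrow> real).
        vector_field \<A> \<Omega> X \<and> vector_field \<A> \<Omega> Y \<and> vector_field \<A> \<Omega> Z \<and>
        smooth_fun \<A> \<Omega> f \<and> smooth_fun \<A> \<Omega> h \<longrightarrow>
        (\<forall>p\<in>\<Omega>. D (\<lambda>q. f q *\<^sub>R X q + h q *\<^sub>R Y q) Z p = f p *\<^sub>R D X Z p + h p *\<^sub>R D Y Z p))"

definition levi_civita ::
    "('m::topological_space, 'e::euclidean_space) chart set \<Rightarrow> 'm set \<Rightarrow> ('m \<Rightarrow> 'e \<Rightarrow> 'e \<Rightarrow> real) \<Rightarrow>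
      ('m, 'e) affine_conn \<Rightarrow> bool" where
  "levi_civita \<A> \<Omega> h D \<longleftrightarrow>
     affine_connection \<A> \<Omega> D \<and>
     (\<forall>X Y. vector_field \<A> \<Omega> X \<and> vector_field \<A> \<Omega> Y \<longrightarrow>
        (\<forall>p\<in>\<Omega>. D X Y p - D Y X p = lie_bracket \<A> X Y p)) \<and>
     (\<forall>X Y Z. vector_field \<A> \<Omega> X \<and> vector_field \<A> \<Omega> Y \<and> vector_field \<A> \<Omega> Z \<longrightarrow>
        (\<forall>p\<in>\<Omega>. tderiv \<A> p (X p) (\<lambda>q. h q (Y q) (Z q)) = h p (D X Y p) (Z p) + h p (Y p) (D X Z p)))"

definition affine_curvature ::
    "('m::topological_space, 'e::euclidean_space) chart set \<Rightarrow> ('m, 'e) affine_conn \<Rightarrow>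
      ('m \<Rightarrow> 'e) \<Rightarrow> ('m \<Rightarrow> 'e) \<Rightarrow> ('m \<Rightarrow> 'e) \<Rightarrow> 'm \<Rightarrow> 'e" where
  "affine_curvature \<A> D X Y Z p = D X (D Y Z) p - D Y (D X Z) p - D (lie_bracket \<A> X Y) Z p"


section \<open>Geodesics\<close>

definition smooth_curve ::
    "('m::topological_space, 'e::euclidean_space) chart set \<Rightarrow> real set \<Rightarrow> (real \<Rightarrow> 'm) \<Rightarrow> bool" where
  "smooth_curve \<A> I \<gamma> \<longleftrightarrow>
     continuous_on I \<gamma> \<and> (\<forall>c\<in>\<A>. smooth_on (I \<inter> \<gamma> -` cdom c) (cmap c \<circ> \<gamma>))"

definition velocity ::
    "('m, 'e::euclidean_space) chart set \<Rightarrow> (real \<Rightarrow> 'm) \<Rightarrow> real \<Rightarrow> 'm \<times> 'e" where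
  "velocity \<A> \<gamma> t = (\<gamma> t, vector_derivative (cmap (chart_at \<A> (\<gamma> t)) \<circ> \<gamma>) (at t))"

text \<open>
  The components in the chart \<open>c\<close> of the covariant derivative of \<open>\<gamma>'\<close> along \<open>\<gamma>\<close>, with reference
  vector \<open>\<gamma>'\<close>: if \<open>y\<close> is \<open>\<gamma>\<close> read in \<open>c\<close> and \<open>a = y'(t)\<close>, then the usual expression
  \<open>y''\<^sup>k + \<Gamma>\<^sup>k\<^sub>i\<^sub>j(\<gamma>') y'\<^sup>i y'\<^sup>j\<close> has as its second term the components of \<open>\<nabla>\<^sub>E E\<close>, where \<open>E\<close> is the
  field with constant components \<open>a\<close>.
\<close>

definition acceleration ::
    "('m::topological_space, 'e::euclidean_space) chart set \<Rightarrow> ('m, 'e) aniso_conn \<Rightarrow>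
      ('m, 'e) chart \<Rightarrow> (real \<Rightarrow> 'm) \<Rightarrow> real \<Rightarrow> 'e" where
  "acceleration \<A> D c \<gamma> t =
     (let y = cmap c \<circ> \<gamma>; E = coord_field \<A> c (vector_derivative y (at t)) in
        vector_derivative (\<lambda>s. vector_derivative y (at s)) (at t)
        + tcoord \<A> c (\<gamma> t) (conn_loc \<A> D (velocity \<A> \<gamma> t) E E))"

definition autoparallel ::
    "('m::topological_space, 'e::euclidean_space) chart set \<Rightarrow> ('m \<times> 'e) set \<Rightarrow> ('m, 'e) aniso_conn \<Rightarrow>
      real set \<Rightarrow> (real \<Rightarrow> 'm) \<Rightarrow> bool" where
  "autoparallel \<A> A D I \<gamma> \<longleftrightarrow>
     open I \<and> is_interval I \<and> smooth_curve \<A> I \<gamma> \<and>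
     (\<forall>t\<in>I. velocity \<A> \<gamma> t \<in> A \<and> (\<forall>c\<in>\<A>. \<gamma> t \<in> cdom c \<longrightarrow> acceleration \<A> D c \<gamma> t = 0))"

definition levi_civita_chern ::
    "('m::topological_space, 'e::euclidean_space) chart set \<Rightarrow> ('m \<times> 'e) set \<Rightarrow> ('m \<times> 'e \<Rightarrow> real) \<Rightarrow>
      ('m, 'e) aniso_conn \<Rightarrow> bool" where
  "levi_civita_chern \<A> A L D \<longleftrightarrow>
     aniso_connection \<A> A D \<and> aniso_torsion_free \<A> A D \<and>
     has_metric_derivative \<A> A L D (\<lambda>v x y z. 0)"

text \<open>
  The Levi-Civita--Chern connection of a pseudo-Finsler metric exists and is unique (on \<open>A\<close> and on
  smooth fields), so the existential quantifier below speaks about that connection.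
\<close>

definition geodesic ::
    "('m::topological_space, 'e::euclidean_space) chart set \<Rightarrow> ('m \<times> 'e) set \<Rightarrow> ('m \<times> 'e \<Rightarrow> real) \<Rightarrow>
      real set \<Rightarrow> (real \<Rightarrow> 'm) \<Rightarrow> bool" where
  "geodesic \<A> A L I \<gamma> \<longleftrightarrow> (\<exists>D. levi_civita_chern \<A> A L D \<and> autoparallel \<A> A D I \<gamma>)"

definition integral_curve ::
    "('m::topological_space, 'e::euclidean_space) chart set \<Rightarrow> 'm set \<Rightarrow> ('m \<Rightarrow> 'e) \<Rightarrow>
      real set \<Rightarrow> (real \<Rightarrow> 'm) \<Rightarrow> bool" where
  "integral_curve \<A> \<Omega> V I \<gamma> \<longleftrightarrow>
     open I \<and> is_interval I \<and> \<gamma> ` I \<subseteq> \<Omega> \<and> continuous_on I \<gamma> \<and>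
     (\<forall>t\<in>I. \<forall>c\<in>\<A>. \<gamma> t \<in> cdom c \<longrightarrow>
        ((cmap c \<circ> \<gamma>) has_vector_derivative tcoord \<A> c (\<gamma> t) (V (\<gamma> t))) (at t))"

definition geodesic_field ::
    "('m::topological_space, 'e::euclidean_space) chart set \<Rightarrow> ('m \<times> 'e) set \<Rightarrow> ('m \<times> 'e \<Rightarrow> real) \<Rightarrow>
      'm set \<Rightarrow> ('m \<Rightarrow> 'e) \<Rightarrow> bool" where
  "geodesic_field \<A> A L \<Omega> V \<longleftrightarrow>
     admissible \<A> A \<Omega> V \<and> (\<forall>I \<gamma>. integral_curve \<A> \<Omega> V I \<gamma> \<longrightarrow> geodesic \<A> A L I \<gamma>)"

end

theory Submission
  imports Defs
begin

text \<open>
  Torsion-freeness and \<open>\<nabla>g = Q\<close> determine \<open>\<nabla>\<^sup>V\<close> by a Koszul argument: along \<open>V\<close> the metric \<open>g\<^sub>V\<close> has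
  derivative \<open>2 C\<^sub>V(\<nabla>\<^sup>V\<^sub>X V, \<cdot>, \<cdot>) + Q\<^sub>V(X, \<cdot>, \<cdot>)\<close>, so the difference with the Levi-Civita connection of \<open>g\<^sub>V\<close>
  is expressed by \<open>C\<^sub>V\<close> and \<open>Q\<^sub>V\<close>; both vanish on \<open>V\<close>, by homogeneity and by assumption. In particular
  \<open>\<nabla>\<^sup>V\<^sub>V V\<close> does not depend on \<open>Q\<close>, and it vanishes for a geodesic field because \<open>V\<close> has an integral curve
  through every point. The curvature \<open>R\<^sub>v(v, x)v\<close> differs from that of the affine connection \<open>\<nabla>\<^sup>V\<close> by
  vertical derivatives of \<open>\<nabla>\<close> applied to \<open>\<nabla>\<^sup>V\<^sub>V V = 0\<close> and by the vertical derivative \<open>P\<^sub>v(v, v, \<cdot>)\<close>.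
  The latter is zero since the spray \<open>\<nabla>\<^sup>v\<^sub>v v\<close> has the vertical derivative \<open>2 \<nabla>\<^sup>v\<^sub>u v\<close>.
\<close>

section \<open>Calculus of smooth maps\<close>

text \<open>A tangent vector is stored by its components in a chart that may change from point to
  point, and the notions to be compared rest on arbitrary choices: a global field with a given germ
  (\<open>germ_ext\<close>), an admissible extension (\<open>adm_ext\<close>), a field through a
  vector (\<open>field_through\<close>). Each choice is removed in the same way: in one fixed chart
  the quantity equals an expression in components, their partial derivatives and the Christoffel
  symbols \<open>G\<close>, in which the choice no longer occurs. The mechanism is the horizontal
  lift \<open>(a, - G(a, y))\<close> of a vector \<open>a\<close> to the point
  \<open>(x, y)\<close>: differentiating along an extension \<open>V\<close> and subtracting the
  vertical correction cancels the derivative of \<open>V\<close>. Since the connection takes global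
  fields only, the symbols come from cut-off frames and are meaningful only near the base point, so
  the computation on the spray is arranged to take place over a single fibre. Geodesics refer to the
  Levi-Civita--Chern connection, a second anisotropic connection, with \<open>Q = 0\<close>; it is
  compared with the given one through \<open>barD V V\<close>.\<close>

definition pd :: "'a::real_normed_vector \<Rightarrow> ('a \<Rightarrow> 'b::real_normed_vector) \<Rightarrow> 'a \<Rightarrow> 'b" where
  "pd u f x = frechet_derivative f (at x) u"

lemma pd_has_derivative:
  "f differentiable (at x) \<Longrightarrow> (f has_derivative (\<lambda>u. pd u f x)) (at x)"
  by (simp add: pd_def frechet_derivative_works[symmetric])

lemma pd_eq: "(f has_derivative f') (at x) \<Longrightarrow> pd u f x = f' u"
  by (simp add: pd_def frechet_derivative_at[symmetric])

lemma pd_linear: "f differentiable (at x) \<Longrightarrow> linear (\<lambda>u. pd u f x)"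
  by (rule has_derivative_linear[OF pd_has_derivative])

text \<open>The two functions have the same set of derivatives at the point, and
  \<open>frechet_derivative\<close> chooses from that set; so the equality also covers the case in
  which the set is empty.\<close>

lemma pd_cong:
  assumes "open S" "x \<in> S" "\<And>y. y \<in> S \<Longrightarrow> f y = g y"
  shows "pd u f x = pd u g x"
proof -
  have "(f has_derivative d) (at x) \<longleftrightarrow> (g has_derivative d) (at x)" for d
    using has_derivative_transform_within_open[OF _ assms(1,2), of f d UNIV g]
      has_derivative_transform_within_open[OF _ assms(1,2), of g d UNIV f] assms(3) by auto
  then show ?thesis by (simp add: pd_def frechet_derivative_def)
qed

lemma differentiable_cong_open:
  assumes "open S" "x \<in> S" "\<And>y. y \<in> S \<Longrightarrow> f y = g y" "f differentiable (at x)"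
  shows "g differentiable (at x)"
  using assms has_derivative_transform_within_open[OF _ assms(1,2), of f _ UNIV g]
  unfolding differentiable_def by blast

text \<open>With the direction as first argument, \<open>pd u f\<close> is again a function, so
  iterated partial derivatives can be handled by rewriting. This form is used below in place of the
  defining equation.\<close>

lemma Ck_on_Suc_pd:
  "Ck_on (Suc k) S f \<longleftrightarrow> (\<forall>x\<in>S. f differentiable (at x)) \<and> (\<forall>u. Ck_on k S (pd u f))"
  by (simp add: pd_def[abs_def])

declare Ck_on.simps(2) [simp del]

lemma Ck_on_subset: "Ck_on k S f \<Longrightarrow> T \<subseteq> S \<Longrightarrow> Ck_on k T f"
  by (induction k arbitrary: f) (auto simp: Ck_on_Suc_pd intro: continuous_on_subset)

lemma Ck_on_cong:
  assumes "open S" "\<And>x. x \<in> S \<Longrightarrow> f x = g x" "Ck_on k S f"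
  shows "Ck_on k S g"
  using assms(2,3)
proof (induction k arbitrary: f g)
  case 0
  then show ?case using continuous_on_cong[of S S f g] by simp
next
  case (Suc k)
  show ?case
    unfolding Ck_on_Suc_pd
  proof (intro conjI ballI allI)
    fix x assume "x \<in> S"
    then show "g differentiable (at x)"
      using Suc.prems differentiable_cong_open[OF assms(1), of x f g] by (auto simp: Ck_on_Suc_pd)
  next
    fix u
    show "Ck_on k S (pd u g)"
      using Suc.prems
      by (intro Suc.IH[of "pd u f" "pd u g"]) (auto simp: Ck_on_Suc_pd intro: pd_cong[OF assms(1)])
  qed
qed

text \<open>Derivatives are taken at a point in the full space, never within the set, so every
  clause of the recursion can be checked on a neighbourhood of each point.\<close>

lemma Ck_on_local:
  assumes "\<And>x. x \<in> S \<Longrightarrow> \<exists>T. open T \<and> x \<in> T \<and> Ck_on k T f"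
  shows "Ck_on k S f"
  using assms
proof (induction k arbitrary: f)
  case 0
  have "isCont f x" if "x \<in> S" for x
    using 0[OF that] by (auto simp: continuous_on_eq_continuous_at)
  then show ?case by (simp add: continuous_at_imp_continuous_on)
next
  case (Suc k)
  show ?case
    unfolding Ck_on_Suc_pd
  proof (intro conjI ballI allI)
    show "f differentiable (at x)" if "x \<in> S" for x
      using Suc.prems[OF that] by (auto simp: Ck_on_Suc_pd)
    show "Ck_on k S (pd u f)" for u
      by (rule Suc.IH) (use Suc.prems in \<open>fastforce simp: Ck_on_Suc_pd\<close>)
  qed
qed

lemma Ck_on_Suc_imp: "Ck_on (Suc k) S f \<Longrightarrow> Ck_on k S f"
proof (induction k arbitrary: f)
  case 0
  then show ?case
    by (auto simp: Ck_on_Suc_pd intro!: continuous_at_imp_continuous_on differentiable_imp_continuous_within)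
next
  case (Suc k)
  then show ?case by (subst (asm) Ck_on_Suc_pd, subst Ck_on_Suc_pd) blast
qed

text \<open>Unfolds smoothness like a coinductive predicate: partial derivatives of smooth maps are
  smooth, and later arguments need not mention the order \<open>k\<close>.\<close>

lemma smooth_on_iff:
  "smooth_on S f \<longleftrightarrow> (\<forall>x\<in>S. f differentiable (at x)) \<and> (\<forall>u. smooth_on S (pd u f))"
proof
  assume f: "smooth_on S f"
  then have "Ck_on (Suc k) S f" for k by (simp add: smooth_on_def)
  then show "(\<forall>x\<in>S. f differentiable (at x)) \<and> (\<forall>u. smooth_on S (pd u f))"
    unfolding Ck_on_Suc_pd smooth_on_def by blast
next
  assume "(\<forall>x\<in>S. f differentiable (at x)) \<and> (\<forall>u. smooth_on S (pd u f))"
  then have "Ck_on (Suc k) S f" for k by (simp add: Ck_on_Suc_pd smooth_on_def)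
  then show "smooth_on S f" by (auto simp: smooth_on_def intro: Ck_on_Suc_imp)
qed

lemma smooth_on_differentiable: "smooth_on S f \<Longrightarrow> x \<in> S \<Longrightarrow> f differentiable (at x)"
  using smooth_on_iff by blast

lemma smooth_on_pd: "smooth_on S f \<Longrightarrow> smooth_on S (pd u f)"
  using smooth_on_iff by blast

lemma smooth_on_continuous_on: "smooth_on S f \<Longrightarrow> continuous_on S f"
  unfolding smooth_on_def using Ck_on.simps(1) by blast

lemma smooth_on_subset: "smooth_on S f \<Longrightarrow> T \<subseteq> S \<Longrightarrow> smooth_on T f"
  unfolding smooth_on_def by (rule allI, rule Ck_on_subset) auto

lemma smooth_on_cong:
  "open S \<Longrightarrow> (\<And>x. x \<in> S \<Longrightarrow> f x = g x) \<Longrightarrow> smooth_on S f \<Longrightarrow> smooth_on S g"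
  unfolding smooth_on_def by (rule allI, rule Ck_on_cong[of S f g]) auto

lemma smooth_on_local:
  "(\<And>x. x \<in> S \<Longrightarrow> \<exists>T. open T \<and> x \<in> T \<and> smooth_on T f) \<Longrightarrow> smooth_on S f"
  unfolding smooth_on_def by (rule allI, rule Ck_on_local) blast

lemma Ck_on_const: "Ck_on k S (\<lambda>x. c)"
proof (induction k arbitrary: c)
  case (Suc k)
  have "pd u (\<lambda>x. c) = (\<lambda>x. 0)" for u :: 'a by (simp add: pd_def fun_eq_iff)
  then show ?case using Suc by (simp add: Ck_on_Suc_pd)
qed simp

lemma smooth_on_const: "smooth_on S (\<lambda>x. c)"
  by (simp add: smooth_on_def Ck_on_const)

lemma smooth_on_bounded_linear: "bounded_linear f \<Longrightarrow> smooth_on S f"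
proof -
  assume f: "bounded_linear f"
  have "Ck_on k S f" for k
  proof (cases k)
    case 0
    then show ?thesis by (simp add: linear_continuous_on f)
  next
    case (Suc n)
    have "pd u f = (\<lambda>x. f u)" for u
      using pd_eq[OF bounded_linear_imp_has_derivative[OF f]] by (simp add: fun_eq_iff)
    then show ?thesis using Suc Ck_on_const
      by (auto simp: Ck_on_Suc_pd bounded_linear_imp_differentiable[OF f])
  qed
  then show ?thesis by (simp add: smooth_on_def)
qed

lemma smooth_on_ident: "smooth_on S (\<lambda>x. x)"
  by (simp add: smooth_on_bounded_linear)

lemma Ck_on_add:
  assumes S: "open S" and "Ck_on k S f" "Ck_on k S g"
  shows "Ck_on k S (\<lambda>x. f x + g x)"
  using assms(2,3)
proof (induction k arbitrary: f g)
  case 0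
  then show ?case by (simp add: continuous_on_add)
next
  case (Suc k)
  have der: "((\<lambda>x. f x + g x) has_derivative (\<lambda>u. pd u f x + pd u g x)) (at x)" if "x \<in> S" for x
    using that Suc.prems
    by (auto simp: Ck_on_Suc_pd intro!: has_derivative_add pd_has_derivative)
  show ?case
    unfolding Ck_on_Suc_pd
  proof (intro conjI ballI allI)
    show "(\<lambda>x. f x + g x) differentiable (at x)" if "x \<in> S" for x
      using der[OF that] by (rule differentiableI)
    show "Ck_on k S (pd u (\<lambda>x. f x + g x))" for u
      by (rule Ck_on_cong[OF S _ Suc.IH[of "pd u f" "pd u g"]])
          (insert Suc.prems, auto simp: Ck_on_Suc_pd pd_eq[OF der])
  qed
qed

lemma Ck_on_bilinear:
  assumes b: "bounded_bilinear b" and S: "open S"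
  shows "Ck_on k S f \<Longrightarrow> Ck_on k S g \<Longrightarrow> Ck_on k S (\<lambda>x. b (f x) (g x))"
proof (induction k arbitrary: f g)
  case 0
  then show ?case by (simp add: bounded_bilinear.continuous_on[OF b])
next
  case (Suc k)
  have der: "((\<lambda>x. b (f x) (g x)) has_derivative (\<lambda>u. b (f x) (pd u g x) + b (pd u f x) (g x))) (at x)"
    if "x \<in> S" for x
    using that Suc.prems
    by (auto simp: Ck_on_Suc_pd intro!: bounded_bilinear.FDERIV[OF b] pd_has_derivative)
  show ?case
    unfolding Ck_on_Suc_pd
  proof (intro conjI ballI allI)
    show "(\<lambda>x. b (f x) (g x)) differentiable (at x)" if "x \<in> S" for x
      using der[OF that] by (rule differentiableI)
    have C: "Ck_on k S f" "Ck_on k S g" using Suc.prems by (auto intro: Ck_on_Suc_imp)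
    show "Ck_on k S (pd u (\<lambda>x. b (f x) (g x)))" for u
      by (rule Ck_on_cong[OF S _ Ck_on_add[OF S, of k "\<lambda>x. b (f x) (pd u g x)" "\<lambda>x. b (pd u f x) (g x)"]])
          (insert Suc.prems C, auto simp: Ck_on_Suc_pd pd_eq[OF der] intro!: Suc.IH)
  qed
qed

lemma Ck_on_sum:
  assumes S: "open S" and "\<And>i. i \<in> I \<Longrightarrow> Ck_on k S (f i)"
  shows "Ck_on k S (\<lambda>x. \<Sum>i\<in>I. f i x)"
  using assms(2)
  by (induction I rule: infinite_finite_induct) (auto simp: Ck_on_const intro!: Ck_on_add[OF S])

lemma linear_Basis_sum:
  fixes P :: "'a::euclidean_space \<Rightarrow> 'b::real_vector"
  assumes "linear P"
  shows "P u = (\<Sum>b\<in>Basis. (u \<bullet> b) *\<^sub>R P b)"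
proof -
  have "P u = P (\<Sum>b\<in>Basis. (u \<bullet> b) *\<^sub>R b)" by (simp add: euclidean_representation)
  then show ?thesis by (simp add: linear_sum[OF assms] linear_cmul[OF assms])
qed

text \<open>In the derivative of a composite the direction \<open>pd u g x\<close> moves with
  \<open>x\<close>, whereas \<open>Ck_on\<close> only knows fixed directions. The third form,
  expanded over \<open>Basis\<close>, restores fixed directions and lets the induction in
  \<open>Ck_on_compose\<close> go through.\<close>

lemma pd_chain:
  fixes g :: "'a::real_normed_vector \<Rightarrow> 'b::euclidean_space"
  assumes "g differentiable (at x)" "f differentiable (at (g x))"
  shows "((\<lambda>x. f (g x)) has_derivative (\<lambda>u. pd (pd u g x) f (g x))) (at x)"
    and "pd u (\<lambda>x. f (g x)) x = pd (pd u g x) f (g x)"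
    and "pd u (\<lambda>x. f (g x)) x = (\<Sum>b\<in>Basis. (pd u g x \<bullet> b) *\<^sub>R pd b f (g x))"
proof -
  show *: "((\<lambda>x. f (g x)) has_derivative (\<lambda>u. pd (pd u g x) f (g x))) (at x)"
    using diff_chain_at[OF pd_has_derivative[OF assms(1)] pd_has_derivative[OF assms(2)]]
    by (simp add: o_def)
  show **: "pd u (\<lambda>x. f (g x)) x = pd (pd u g x) f (g x)"
    by (rule pd_eq[OF *])
  show "pd u (\<lambda>x. f (g x)) x = (\<Sum>b\<in>Basis. (pd u g x \<bullet> b) *\<^sub>R pd b f (g x))"
    unfolding ** by (rule linear_Basis_sum[OF pd_linear[OF assms(2)]])
qed

lemma Ck_on_inner_left: "open S \<Longrightarrow> Ck_on k S f \<Longrightarrow> Ck_on k S (\<lambda>x. f x \<bullet> c)"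
  by (rule Ck_on_bilinear[OF bounded_bilinear_inner _ _ Ck_on_const])

lemma Ck_on_compose:
  fixes g :: "'a::real_normed_vector \<Rightarrow> 'b::euclidean_space"
  assumes S: "open S" and "Ck_on k T f" "Ck_on k S g" "g ` S \<subseteq> T"
  shows "Ck_on k S (\<lambda>x. f (g x))"
  using assms(2,3)
proof (induction k arbitrary: f)
  case 0
  then show ?case using assms(4) by (simp add: continuous_on_compose2)
next
  case (Suc k)
  have d: "g differentiable (at x)" "f differentiable (at (g x))" if "x \<in> S" for x
    using that Suc.prems assms(4) by (auto simp: Ck_on_Suc_pd)
  show ?case
    unfolding Ck_on_Suc_pd
  proof (intro conjI ballI allI)
    show "(\<lambda>x. f (g x)) differentiable (at x)" if "x \<in> S" for x
      using pd_chain(1)[OF d[OF that]] by (rule differentiableI)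
    show "Ck_on k S (pd u (\<lambda>x. f (g x)))" for u
    proof (rule Ck_on_cong[OF S])
      show "(\<Sum>b\<in>Basis. (pd u g x \<bullet> b) *\<^sub>R pd b f (g x)) = pd u (\<lambda>x. f (g x)) x" if "x \<in> S" for x
        using pd_chain(3)[OF d[OF that]] by simp
      show "Ck_on k S (\<lambda>x. \<Sum>b\<in>Basis. (pd u g x \<bullet> b) *\<^sub>R pd b f (g x))"
      proof (rule Ck_on_sum[OF S], rule Ck_on_bilinear[OF bounded_bilinear_scaleR S])
        fix b :: 'b
        show "Ck_on k S (\<lambda>x. pd u g x \<bullet> b)"
          using Suc.prems by (intro Ck_on_inner_left[OF S]) (simp add: Ck_on_Suc_pd)
        show "Ck_on k S (\<lambda>x. pd b f (g x))"
          using Suc.prems by (intro Suc.IH[of "pd b f"] Ck_on_Suc_imp[of k S g]) (simp_all add: Ck_on_Suc_pd)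
      qed
    qed
  qed
qed

lemma smooth_on_compose:
  fixes g :: "'a::real_normed_vector \<Rightarrow> 'b::euclidean_space"
  shows "open S \<Longrightarrow> smooth_on T f \<Longrightarrow> smooth_on S g \<Longrightarrow> g ` S \<subseteq> T \<Longrightarrow> smooth_on S (\<lambda>x. f (g x))"
  unfolding smooth_on_def by (rule allI, rule Ck_on_compose) auto

lemma smooth_on_add: "open S \<Longrightarrow> smooth_on S f \<Longrightarrow> smooth_on S g \<Longrightarrow> smooth_on S (\<lambda>x. f x + g x)"
  unfolding smooth_on_def by (rule allI, rule Ck_on_add) auto

lemma smooth_on_sum:
  "open S \<Longrightarrow> (\<And>i. i \<in> I \<Longrightarrow> smooth_on S (f i)) \<Longrightarrow> smooth_on S (\<lambda>x. \<Sum>i\<in>I. f i x)"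
  unfolding smooth_on_def by (simp add: Ck_on_sum)

lemma smooth_on_bilinear:
  "bounded_bilinear b \<Longrightarrow> open S \<Longrightarrow> smooth_on S f \<Longrightarrow> smooth_on S g \<Longrightarrow> smooth_on S (\<lambda>x. b (f x) (g x))"
  unfolding smooth_on_def by (rule allI, rule Ck_on_bilinear) auto

lemmas smooth_on_scaleR = smooth_on_bilinear[OF bounded_bilinear_scaleR]
lemmas smooth_on_mult = smooth_on_bilinear[OF bounded_bilinear_mult]
lemmas smooth_on_inner = smooth_on_bilinear[OF bounded_bilinear_inner]

lemma smooth_on_diff: "open S \<Longrightarrow> smooth_on S f \<Longrightarrow> smooth_on S g \<Longrightarrow> smooth_on S (\<lambda>x. f x - g x)"
  using smooth_on_add[of S f "\<lambda>x. - g x"] smooth_on_scaleR[of S "\<lambda>x. - 1" g, OF _ smooth_on_const]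
  by simp

lemma smooth_on_Pair:
  fixes f :: "'a::real_normed_vector \<Rightarrow> 'b::real_normed_vector"
    and g :: "'a \<Rightarrow> 'c::real_normed_vector"
  assumes S: "open S" and "smooth_on S f" "smooth_on S g"
  shows "smooth_on S (\<lambda>x. (f x, g x))"
proof -
  have "Ck_on k S (\<lambda>x. (f x, g x))" if "Ck_on k S f" "Ck_on k S g" for k
    using that
  proof (induction k arbitrary: f g)
    case 0
    then show ?case by (simp add: continuous_on_Pair)
  next
    case (Suc k)
    have der: "((\<lambda>x. (f x, g x)) has_derivative (\<lambda>u. (pd u f x, pd u g x))) (at x)" if "x \<in> S" for x
      using that Suc.prems
      by (auto simp: Ck_on_Suc_pd intro!: has_derivative_Pair pd_has_derivative)
    show ?case
      unfolding Ck_on_Suc_pd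
    proof (intro conjI ballI allI)
      show "(\<lambda>x. (f x, g x)) differentiable (at x)" if "x \<in> S" for x
        using der[OF that] by (rule differentiableI)
      show "Ck_on k S (pd u (\<lambda>x. (f x, g x)))" for u
        by (rule Ck_on_cong[OF S _ Suc.IH[of "pd u f" "pd u g"]])
          (insert Suc.prems, auto simp: Ck_on_Suc_pd pd_eq[OF der])
    qed
  qed
  then show ?thesis using assms by (simp add: smooth_on_def)
qed

text \<open>By linearity in the direction, a derivative along a moving direction is a combination of
  derivatives along basis vectors with smooth coefficients. This covers Jacobians applied to
  component functions as well as Lie brackets.\<close>

lemma smooth_on_pd_along:
  fixes f :: "'a::euclidean_space \<Rightarrow> 'b::real_normed_vector"
  assumes "open S" "smooth_on T f" "smooth_on S g" "smooth_on S h" "g ` S \<subseteq> T"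
  shows "smooth_on S (\<lambda>x. pd (h x) f (g x))"
proof (rule smooth_on_cong[OF assms(1)])
  show "smooth_on S (\<lambda>x. \<Sum>b\<in>Basis. (h x \<bullet> b) *\<^sub>R pd b f (g x))"
    by (rule smooth_on_sum[OF assms(1)], rule smooth_on_scaleR[OF assms(1)],
        rule smooth_on_inner[OF assms(1,4) smooth_on_const],
        rule smooth_on_compose[OF assms(1) smooth_on_pd[OF assms(2)] assms(3,5)])
  fix x assume "x \<in> S"
  then have l: "linear (\<lambda>u. pd u f (g x))"
    using assms by (intro pd_linear smooth_on_differentiable) auto
  then show "(\<Sum>b\<in>Basis. (h x \<bullet> b) *\<^sub>R pd b f (g x)) = pd (h x) f (g x)"
    using linear_Basis_sum[OF l, of "h x"] by simp
qed

section \<open>Derivatives along lines and the symmetry of second derivatives\<close>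

lemma line_derivative:
  assumes "f differentiable (at (y + s *\<^sub>R u))"
  shows "((\<lambda>s. f (y + s *\<^sub>R u)) has_vector_derivative pd u f (y + s *\<^sub>R u)) (at s)"
proof -
  have "((\<lambda>s. y + s *\<^sub>R u) has_derivative (\<lambda>r. r *\<^sub>R u)) (at s)"
    by (auto intro!: derivative_eq_intros)
  from diff_chain_at[OF this pd_has_derivative[OF assms]]
  show ?thesis
    using linear_cmul[OF pd_linear[OF assms]] by (simp add: has_vector_derivative_def o_def)
qed

text \<open>The mean value theorem is applied twice: in the direction \<open>u\<close> to the
  difference of \<open>f\<close> along two parallel segments, then in the direction \<open>v\<close>
  to \<open>pd u f\<close>.\<close>

lemma double_difference:
  fixes f :: "'a::real_normed_vector \<Rightarrow> real"
  assumes h: "h > 0" and S: "\<forall>s\<in>{0..h}. \<forall>t\<in>{0..h}. x + s *\<^sub>R u + t *\<^sub>R v \<in> S"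
    and d1: "\<And>y. y \<in> S \<Longrightarrow> f differentiable (at y)"
    and d2: "\<And>y. y \<in> S \<Longrightarrow> pd u f differentiable (at y)"
  obtains s t where "0 \<le> s" "s \<le> h" "0 \<le> t" "t \<le> h"
    "f (x + h *\<^sub>R u + h *\<^sub>R v) - f (x + h *\<^sub>R u) - f (x + h *\<^sub>R v) + f x
      = h * (h * pd v (pd u f) (x + s *\<^sub>R u + t *\<^sub>R v))"
proof -
  define p where "p s = f ((x + h *\<^sub>R v) + s *\<^sub>R u) - f (x + s *\<^sub>R u)" for s
  have "DERIV p s :> pd u f ((x + h *\<^sub>R v) + s *\<^sub>R u) - pd u f (x + s *\<^sub>R u)"
    if "0 \<le> s" "s \<le> h" for s
  proof -
    have "f differentiable (at ((x + h *\<^sub>R v) + s *\<^sub>R u))" "f differentiable (at (x + s *\<^sub>R u))"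
      using d1 S[rule_format, of s h] S[rule_format, of s 0] that h by (simp_all add: ac_simps)
    from line_derivative[OF this(1)] line_derivative[OF this(2)]
    show ?thesis
      unfolding p_def has_real_derivative_iff_has_vector_derivative
      by (rule has_vector_derivative_diff)
  qed
  from MVT2[OF h this] obtain s where s: "0 < s" "s < h"
    "p h - p 0 = h * (pd u f ((x + h *\<^sub>R v) + s *\<^sub>R u) - pd u f (x + s *\<^sub>R u))" by auto
  define q where "q t = pd u f ((x + s *\<^sub>R u) + t *\<^sub>R v)" for t
  have "DERIV q t :> pd v (pd u f) ((x + s *\<^sub>R u) + t *\<^sub>R v)" if "0 \<le> t" "t \<le> h" for t
    unfolding q_def has_real_derivative_iff_has_vector_derivative
    using d2 S[rule_format, of s t] that s by (intro line_derivative) simp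
  from MVT2[OF h this] obtain t where t: "0 < t" "t < h"
    "q h - q 0 = h * pd v (pd u f) ((x + s *\<^sub>R u) + t *\<^sub>R v)" by auto
  show ?thesis
  proof (rule that[of s t])
    have "p h - p 0 = h * (q h - q 0)"
      using s(3) by (simp add: q_def ac_simps)
    then show "f (x + h *\<^sub>R u + h *\<^sub>R v) - f (x + h *\<^sub>R u) - f (x + h *\<^sub>R v) + f x
      = h * (h * pd v (pd u f) (x + s *\<^sub>R u + t *\<^sub>R v))"
      using t(3) by (simp add: p_def ac_simps)
  qed (use s t in auto)
qed

text \<open>The mixed difference of \<open>double_difference\<close> is symmetric in the two
  directions, so for each small step the two mixed derivatives agree at suitable points close to
  \<open>x\<close>; continuity then excludes a gap at \<open>x\<close> itself.\<close>

lemma pd_commute_real: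
  fixes f :: "'a::real_normed_vector \<Rightarrow> real"
  assumes S: "open S" "x \<in> S" and f: "smooth_on S f"
  shows "pd v (pd u f) x = pd u (pd v f) x"
proof (rule ccontr)
  let ?A = "pd v (pd u f)" and ?B = "pd u (pd v f)"
  assume "?A x \<noteq> ?B x"
  then have e: "\<bar>?A x - ?B x\<bar> / 2 > 0" (is "?e > 0") by simp
  have c: "isCont ?A x" "isCont ?B x"
    using S f smooth_on_continuous_on[OF smooth_on_pd[OF smooth_on_pd[OF f]]]
    by (simp_all add: continuous_on_eq_continuous_at)
  obtain d1 where d1: "d1 > 0" "\<And>y. dist y x < d1 \<Longrightarrow> dist (?A y) (?A x) < ?e"
    using c(1) e unfolding continuous_at_eps_delta by blast
  obtain d2 where d2: "d2 > 0" "\<And>y. dist y x < d2 \<Longrightarrow> dist (?B y) (?B x) < ?e"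
    using c(2) e unfolding continuous_at_eps_delta by blast
  note d = d1 d2
  obtain d3 where d3: "d3 > 0" "ball x d3 \<subseteq> S" using S openE by blast
  define d where "d = min d1 (min d2 d3)"
  \<comment> \<open>With this step the whole parallelogram spanned by \<open>h u\<close> and
    \<open>h v\<close> stays within distance \<open>d\<close> of \<open>x\<close>; the summand
    \<open>1\<close> keeps the quotient meaningful for \<open>u = v = 0\<close>.\<close>
  define h where "h = d / (norm u + norm v + 1)"
  have n: "norm u + norm v + 1 > 0" by (simp add: add_nonneg_pos)
  have dp: "d > 0" using d d3 by (simp add: d_def)
  then have h: "h > 0" using n by (simp add: h_def)
  have near: "dist (x + s *\<^sub>R u + t *\<^sub>R v) x < d" if "0 \<le> s" "s \<le> h" "0 \<le> t" "t \<le> h" for s t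
  proof -
    have "norm (s *\<^sub>R u + t *\<^sub>R v) \<le> s * norm u + t * norm v"
      using norm_triangle_ineq[of "s *\<^sub>R u" "t *\<^sub>R v"] that by simp
    also have "\<dots> \<le> h * norm u + h * norm v" using that by (intro add_mono mult_right_mono) auto
    also have "\<dots> < h * (norm u + norm v + 1)" using h by (simp add: algebra_simps)
    also have "\<dots> = d" using n by (simp add: h_def)
    finally show ?thesis by (simp add: dist_norm algebra_simps)
  qed
  have inS: "\<forall>s\<in>{0..h}. \<forall>t\<in>{0..h}. x + s *\<^sub>R u + t *\<^sub>R v \<in> S"
    using near d3(2) by (force simp: d_def dist_commute)
  obtain s t where 1: "0 \<le> s" "s \<le> h" "0 \<le> t" "t \<le> h"
    "f (x + h *\<^sub>R u + h *\<^sub>R v) - f (x + h *\<^sub>R u) - f (x + h *\<^sub>R v) + f x = h * (h * ?A (x + s *\<^sub>R u + t *\<^sub>R v))"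
    by (rule double_difference[OF h inS smooth_on_differentiable[OF f]
        smooth_on_differentiable[OF smooth_on_pd[OF f]]])
  have inS': "\<forall>s\<in>{0..h}. \<forall>t\<in>{0..h}. x + s *\<^sub>R v + t *\<^sub>R u \<in> S"
  proof (intro ballI)
    fix s t assume "s \<in> {0..h}" "t \<in> {0..h}"
    then show "x + s *\<^sub>R v + t *\<^sub>R u \<in> S" using inS[rule_format, of t s] by (simp add: ac_simps)
  qed
  obtain s' t' where 2: "0 \<le> s'" "s' \<le> h" "0 \<le> t'" "t' \<le> h"
    "f (x + h *\<^sub>R v + h *\<^sub>R u) - f (x + h *\<^sub>R v) - f (x + h *\<^sub>R u) + f x = h * (h * ?B (x + s' *\<^sub>R v + t' *\<^sub>R u))"
    by (rule double_difference[OF h inS' smooth_on_differentiable[OF f]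
        smooth_on_differentiable[OF smooth_on_pd[OF f]]])
  have eq: "x + h *\<^sub>R v + h *\<^sub>R u = x + h *\<^sub>R u + h *\<^sub>R v" by simp
  have "h * (h * ?A (x + s *\<^sub>R u + t *\<^sub>R v)) = h * (h * ?B (x + s' *\<^sub>R v + t' *\<^sub>R u))"
    using 1(5) 2(5)[unfolded eq] by linarith
  then have "?A (x + s *\<^sub>R u + t *\<^sub>R v) = ?B (x + s' *\<^sub>R v + t' *\<^sub>R u)"
    using h by simp
  moreover have "dist (?A (x + s *\<^sub>R u + t *\<^sub>R v)) (?A x) < ?e"
    using near[OF 1(1-4)] by (intro d) (simp add: d_def)
  moreover have "dist (?B (x + s' *\<^sub>R v + t' *\<^sub>R u)) (?B x) < ?e"
    using near[OF 2(3,4,1,2)] by (intro d) (simp add: d_def ac_simps)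
  ultimately show False by (simp add: dist_real_def abs_if split: if_splits)
qed

lemma smooth_on_inner_left: "open S \<Longrightarrow> smooth_on S f \<Longrightarrow> smooth_on S (\<lambda>x. f x \<bullet> b)"
  by (rule smooth_on_inner[OF _ _ smooth_on_const])

lemma pd_inner_left: "f differentiable (at x) \<Longrightarrow> pd u (\<lambda>x. f x \<bullet> b) x = pd u f x \<bullet> b"
  by (rule pd_eq[OF has_derivative_inner_left[OF pd_has_derivative]])

lemma pd_commute:
  fixes f :: "'a::real_normed_vector \<Rightarrow> 'b::euclidean_space"
  assumes S: "open S" "x \<in> S" and f: "smooth_on S f"
  shows "pd v (pd u f) x = pd u (pd v f) x"
proof (rule euclidean_eqI)
  fix b :: 'b
  have *: "pd v (pd u (\<lambda>x. f x \<bullet> b)) x = pd v (pd u f) x \<bullet> b" for u v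
  proof -
    have "pd v (pd u (\<lambda>x. f x \<bullet> b)) x = pd v (\<lambda>x. pd u f x \<bullet> b) x"
      by (rule pd_cong[OF S]) (simp add: pd_inner_left smooth_on_differentiable[OF f])
    also have "\<dots> = pd v (pd u f) x \<bullet> b"
      by (rule pd_inner_left) (rule smooth_on_differentiable[OF smooth_on_pd[OF f] S(2)])
    finally show ?thesis .
  qed
  show "pd v (pd u f) x \<bullet> b = pd u (pd v f) x \<bullet> b"
    using pd_commute_real[OF S smooth_on_inner_left[OF S(1) f], of v u b] by (simp add: *)
qed

section \<open>Bump functions\<close>

text \<open>The function \<open>exp (- 1 / t)\<close>, extended by \<open>0\<close>, together with
  its products with powers of \<open>1 / t\<close>. The powers are included so that differentiation
  maps the family into its own linear combinations.\<close>

definition flat :: "nat \<Rightarrow> real \<Rightarrow> real" where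
  "flat n t = (if t > 0 then (1 / t) ^ n * exp (- (1 / t)) else 0)"

lemma flat_derivative: "(flat n has_real_derivative flat (n + 2) t - n * flat (n + 1) t) (at t)"
proof -
  consider "t > 0" | "t < 0" | "t = 0" by linarith
  then show ?thesis
  proof cases
    case 1
    have "((\<lambda>t. (1 / t) ^ n * exp (- (1 / t))) has_real_derivative flat (n + 2) t - n * flat (n + 1) t) (at t)"
    proof -
      define s where "s = 1 / t"
      have i: "((\<lambda>t. 1 / t) has_real_derivative - (s * s)) (at t)"
        using 1 by (auto intro!: derivative_eq_intros simp: s_def field_simps power2_eq_square)
      have "((\<lambda>t. (1 / t) ^ n * exp (- (1 / t))) has_real_derivative
          real n * (- (s * s) * s ^ (n - Suc 0)) * exp (- s) + exp (- s) * (s * s) * s ^ n) (at t)"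
        using DERIV_mult[OF DERIV_power[OF i, of n] DERIV_fun_exp[OF DERIV_minus[OF i]]]
        by (simp add: s_def)
      moreover have "real n * (- (s * s) * s ^ (n - Suc 0)) * exp (- s) + exp (- s) * (s * s) * s ^ n
          = flat (n + 2) t - n * flat (n + 1) t"
        using 1 by (cases n) (simp_all add: flat_def s_def[symmetric] algebra_simps)
      ultimately show ?thesis by simp
    qed
    then show ?thesis
      by (rule has_field_derivative_transform_within_open[where S = "{0<..}"])
        (use 1 in \<open>auto simp: flat_def\<close>)
  next
    case 2
    have "((\<lambda>t. 0) has_real_derivative flat (n + 2) t - n * flat (n + 1) t) (at t)"
      using 2 by (simp add: flat_def)
    then show ?thesis
      by (rule has_field_derivative_transform_within_open[where S = "{..<0}"])
        (use 2 in \<open>auto simp: flat_def\<close>)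
  next
    \<comment> \<open>At \<open>0\<close> the difference quotient of \<open>flat n\<close> is
      \<open>flat (n + 1)\<close> itself. It tends to \<open>0\<close> from the right because the
      exponential beats every power, and it vanishes on the left.\<close>
    case 3
    have R: "(flat (n + 1) \<longlongrightarrow> 0) (at_right 0)"
    proof (rule Lim_transform_eventually)
      show "((\<lambda>t. (inverse t) ^ (n + 1) / exp (inverse t)) \<longlongrightarrow> 0) (at_right (0::real))"
        by (rule filterlim_compose[OF tendsto_power_div_exp_0 filterlim_inverse_at_top_right])
      show "\<forall>\<^sub>F t in at_right 0. (inverse t) ^ (n + 1) / exp (inverse t) = flat (n + 1) t"
        by (auto simp: eventually_at_right_field flat_def exp_minus field_simps intro!: exI[of _ 1])
    qed
    have L: "(flat (n + 1) \<longlongrightarrow> 0) (at_left 0)"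
      by (rule Lim_transform_eventually[OF tendsto_const])
        (auto simp: eventually_at_left_field flat_def intro!: exI[of _ "-1"])
    have "(flat (n + 1) \<longlongrightarrow> 0) (at 0)" using L R by (simp add: filterlim_split_at)
    moreover have "\<forall>\<^sub>F h in at 0. flat (n + 1) h = (flat n (0 + h) - flat n 0) / h"
      by (auto simp: eventually_at_filter flat_def field_simps)
    ultimately have "((\<lambda>h. (flat n (0 + h) - flat n 0) / h) \<longlongrightarrow> 0) (at 0)"
      by (rule Lim_transform_eventually)
    then show ?thesis using 3 by (simp add: DERIV_def flat_def)
  qed
qed

lemma smooth_on_flat: "smooth_on S (flat n)"
proof -
  have "Ck_on k UNIV (flat n)" for k
  proof (induction k arbitrary: n)
    case 0
    show ?case using flat_derivative
      by (auto intro!: continuous_at_imp_continuous_on DERIV_isCont)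
  next
    case (Suc k)
    have "pd u (flat n) = (\<lambda>t. u * flat (n + 2) t + (- u * n) * flat (n + 1) t)" for u
      using pd_eq[OF flat_derivative[unfolded has_field_derivative_def]] by (auto simp: fun_eq_iff algebra_simps)
    moreover have "Ck_on k UNIV (\<lambda>t. u * flat (n + 2) t + (- u * n) * flat (n + 1) t)" for u
      by (rule Ck_on_add; (rule Ck_on_bilinear[OF bounded_bilinear_mult])?) (auto intro: Ck_on_const Suc)
    moreover have "flat n differentiable (at t)" for t
      using flat_derivative[of n t] by (auto simp: has_field_derivative_def intro: differentiableI)
    ultimately show ?case by (simp add: Ck_on_Suc_pd)
  qed
  then show ?thesis
    by (intro smooth_on_subset[of UNIV _ S]) (simp_all add: smooth_on_def)
qed

text \<open>
  The inner function vanishes for \<open>dist x a \<le> r\<close> and is at least \<open>1\<close> for \<open>dist x a \<ge> 2 * r\<close>, so no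
  quotient is needed to get a plateau.
\<close>

lemma euclidean_bump:
  fixes a :: "'a::euclidean_space"
  assumes r: "r > 0"
  obtains b :: "'a \<Rightarrow> real" where "smooth_on UNIV b" "\<And>x. dist x a < r \<Longrightarrow> b x = 1"
    "\<And>x. dist x a \<ge> 2 * r \<Longrightarrow> b x = 0"
proof
  \<comment> \<open>As \<open>(2 r)\<^sup>2 - r\<^sup>2 = 3 r\<^sup>2\<close> and
    \<open>flat 0\<close> is increasing, this normalization makes the argument of the outer
    \<open>flat 0\<close> at most \<open>0\<close> from distance \<open>2 r\<close> on. Inside
    radius \<open>r\<close> that argument is \<open>1\<close>, and the factor \<open>exp 1\<close>
    in \<open>b\<close> turns \<open>flat 0 1\<close> into \<open>1\<close>.\<close>
  define K where "K = 1 / flat 0 (3 * r\<^sup>2)"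
  define b where "b x = exp 1 * flat 0 (1 - K * flat 0 ((x - a) \<bullet> (x - a) - r\<^sup>2))" for x
  have K: "K * flat 0 (3 * r\<^sup>2) = 1" "K > 0" using r by (simp_all add: K_def flat_def)
  have sq: "(x - a) \<bullet> (x - a) = (dist x a)\<^sup>2" for x by (simp add: dist_norm dot_square_norm)
  have 1: "smooth_on UNIV (\<lambda>x. (x - a) \<bullet> (x - a) - r\<^sup>2)"
    by (intro smooth_on_diff smooth_on_inner smooth_on_ident smooth_on_const open_UNIV)
  have 2: "smooth_on UNIV (\<lambda>x. 1 - K * flat 0 ((x - a) \<bullet> (x - a) - r\<^sup>2))"
    by (intro smooth_on_diff smooth_on_mult smooth_on_const open_UNIV
        smooth_on_compose[OF _ smooth_on_flat[of UNIV] 1]) simp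
  show "smooth_on UNIV b"
    unfolding b_def
    by (intro smooth_on_mult smooth_on_const open_UNIV smooth_on_compose[OF _ smooth_on_flat[of UNIV] 2]) simp
  show "b x = 1" if "dist x a < r" for x
  proof -
    have "(dist x a)\<^sup>2 < r\<^sup>2" using that by (simp add: power_strict_mono)
    then show ?thesis unfolding b_def sq by (simp add: flat_def exp_minus)
  qed
  show "b x = 0" if "dist x a \<ge> 2 * r" for x
  proof -
    have "(2 * r)\<^sup>2 \<le> (dist x a)\<^sup>2" using that r by (intro power_mono) auto
    then have le: "3 * r\<^sup>2 \<le> (dist x a)\<^sup>2 - r\<^sup>2" by (simp add: power_mult_distrib)
    moreover have p: "3 * r\<^sup>2 > 0" using r by simp
    ultimately have "1 / ((dist x a)\<^sup>2 - r\<^sup>2) \<le> 1 / (3 * r\<^sup>2)" by (intro frac_le) auto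
    then have "flat 0 (3 * r\<^sup>2) \<le> flat 0 ((dist x a)\<^sup>2 - r\<^sup>2)"
      using order_less_le_trans[OF p le] p by (simp add: flat_def)
    then have "1 \<le> K * flat 0 ((dist x a)\<^sup>2 - r\<^sup>2)"
      using K mult_left_mono[of _ _ K] by (metis less_imp_le)
    then show ?thesis unfolding b_def sq by (simp add: flat_def)
  qed
qed

section \<open>Integral curves in Euclidean space\<close>

text \<open>Picard iteration by the Banach fixed point theorem. The time is clamped to
  \<open>{-e..e}\<close> by \<open>c\<close>, so that every iterate is bounded and continuous on the
  whole line and the complete space \<open>bcontfun\<close> can be used; for times below
  \<open>e\<close> in absolute value the clamp is the identity.\<close>

lemma ode_global:
  fixes F :: "'a::euclidean_space \<Rightarrow> 'a"
  assumes K: "\<And>x y. dist (F x) (F y) \<le> K * dist x y" "K \<ge> 0"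
  obtains e y where "e > 0" "y 0 = x0" "\<And>t. \<bar>t\<bar> < e \<Longrightarrow> (y has_vector_derivative F (y t)) (at t)"
proof -
  \<comment> \<open>The operator contains two integrals over intervals of length at most
    \<open>2 e\<close>, which gives the contraction constant \<open>4 e K\<close>; this choice
    bounds it by \<open>1/2\<close>, also when \<open>K = 0\<close>.\<close>
  define e where "e = 1 / (8 * (K + 1))"
  have e: "e > 0" "4 * e * K \<le> 1 / 2" using K(2) by (simp_all add: e_def field_simps)
  define c where "c t = min e (max (- e) t)" for t
  \<comment> \<open>The integral over \<open>{a..b}\<close> is zero when \<open>b < a\<close>.
    Starting at \<open>-e\<close> and taking the difference \<open>J u (c t) - J u 0\<close>
    produces the oriented integral from \<open>0\<close> to \<open>c t\<close> for both signs of
    \<open>t\<close>.\<close>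
  define J where "J u s = integral {-e..s} (\<lambda>s. F (apply_bcontfun u s))" for u :: "real \<Rightarrow>\<^sub>C 'a" and s
  define P where "P u t = x0 + (J u (c t) - J u 0)" for u t
  have F: "continuous_on T F" for T
    using lipschitz_on_continuous_on[OF lipschitz_onI[of T F K]] K by blast
  have cont: "continuous_on T (\<lambda>s. F (apply_bcontfun u s))" for T and u :: "real \<Rightarrow>\<^sub>C 'a"
    by (rule continuous_on_compose2[OF F[of UNIV]]) auto
  have int: "(\<lambda>s. F (apply_bcontfun u s)) integrable_on {a..b}" for a b and u :: "real \<Rightarrow>\<^sub>C 'a"
    by (rule integrable_continuous_real[OF cont])
  have c: "c t \<in> {-e..e}" for t using e by (auto simp: c_def)
  have Jc: "continuous_on {-e..e} (J u)" for u
    unfolding J_def by (rule indefinite_integral_continuous_1[OF int])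
  have cc: "continuous_on UNIV c"
    unfolding c_def by (intro continuous_intros)
  have Pc: "P u \<in> bcontfun" for u
  proof -
    have "continuous_on UNIV (\<lambda>t. J u (c t))"
      by (rule continuous_on_compose2[OF Jc cc]) (use c in auto)
    moreover have "bounded (range (\<lambda>t. J u (c t)))"
      by (rule bounded_subset[OF compact_imp_bounded[OF compact_continuous_image[OF Jc]]])
        (use c in auto)
    then have "bounded (range (P u))"
      unfolding P_def by (intro bounded_plus_comp bounded_minus_comp) (auto simp: image_constant_conv)
    ultimately show ?thesis unfolding bcontfun_def P_def by (auto intro!: continuous_intros)
  qed
  define T where "T u = Bcontfun (P u)" for u
  have T: "apply_bcontfun (T u) = P u" for u unfolding T_def by (rule Bcontfun_inverse[OF Pc])
  have J: "norm (J u s - J w s) \<le> K * dist u w * (2 * e)" if "s \<in> {-e..e}" for u w s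
  proof -
    have "J u s - J w s = integral {-e..s} (\<lambda>s. F (apply_bcontfun u s) - F (apply_bcontfun w s))"
      unfolding J_def by (rule integral_diff[symmetric]) (rule int)+
    also have "norm \<dots> \<le> K * dist u w * (s - (- e))"
    proof (rule integral_bound)
      fix t
      have "dist (F (apply_bcontfun u t)) (F (apply_bcontfun w t)) \<le> K * dist (apply_bcontfun u t) (apply_bcontfun w t)"
        by (rule K)
      also have "\<dots> \<le> K * dist u w" by (intro mult_left_mono dist_bounded K)
      finally show "norm (F (apply_bcontfun u t) - F (apply_bcontfun w t)) \<le> K * dist u w"
        by (simp add: dist_norm)
    qed (use that in \<open>auto intro!: continuous_on_diff cont\<close>)
    also have "\<dots> \<le> K * dist u w * (2 * e)"
      using that K(2) by (intro mult_left_mono) auto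
    finally show ?thesis .
  qed
  have "\<exists>!u. T u = u"
  proof (rule banach_fix_type[of "1/2"])
    show "\<forall>u w. dist (T u) (T w) \<le> 1 / 2 * dist u w"
    proof (intro allI dist_bound)
      fix u w t
      have "dist (apply_bcontfun (T u) t) (apply_bcontfun (T w) t)
        = norm ((J u (c t) - J w (c t)) - (J u 0 - J w 0))"
        by (simp add: T P_def dist_norm algebra_simps)
      also have "\<dots> \<le> K * dist u w * (2 * e) + K * dist u w * (2 * e)"
        by (rule order_trans[OF norm_triangle_ineq4 add_mono[OF J[OF c] J]]) (use e in auto)
      also have "\<dots> = 4 * e * K * dist u w" by simp
      also have "\<dots> \<le> 1 / 2 * dist u w" using e(2) by (intro mult_right_mono) auto
      finally show "dist (apply_bcontfun (T u) t) (apply_bcontfun (T w) t) \<le> 1 / 2 * dist u w" .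
    qed
  qed auto
  then obtain u where u: "T u = u" by blast
  define y where "y = apply_bcontfun u"
  have y: "y = P u" using T[of u] u by (simp add: y_def)
  show ?thesis
  proof
    show "e > 0" by (rule e)
    show "y 0 = x0" using e by (simp add: y P_def c_def)
    show "(y has_vector_derivative F (y t)) (at t)" if t: "\<bar>t\<bar> < e" for t
    proof -
      have tb: "t \<in> {-e<..<e}" using t by auto
      have "(J u has_vector_derivative F (y t)) (at t within {-e..e})"
        unfolding J_def y_def by (rule integral_has_vector_derivative[OF cont]) (use tb in auto)
      then have "(J u has_vector_derivative F (y t)) (at t within {-e<..<e})"
        by (rule has_vector_derivative_within_subset) auto
      then have "(J u has_vector_derivative F (y t)) (at t)"
        by (simp only: at_within_open[OF tb open_greaterThanLessThan])
      then have "((\<lambda>t. x0 + (J u t - J u 0)) has_vector_derivative 0 + (F (y t) - 0)) (at t)"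
        by (intro has_vector_derivative_add has_vector_derivative_diff has_vector_derivative_const)
      then have "((\<lambda>t. x0 + (J u t - J u 0)) has_vector_derivative F (y t)) (at t)" by simp
      then show ?thesis
        by (rule has_vector_derivative_transform_within_open[where S = "{-e<..<e}"])
          (use tb in \<open>auto simp: y P_def c_def\<close>)
    qed
  qed
qed

text \<open>Composing \<open>f\<close> with the nearest-point projection onto a closed ball gives a
  globally Lipschitz field that agrees with \<open>f\<close> on the ball. By continuity the global
  solution remains in the ball for a short time.\<close>

lemma ode_local:
  fixes f :: "'a::euclidean_space \<Rightarrow> 'a"
  assumes S: "open S" "x0 \<in> S" and f: "smooth_on S f"
  obtains e y where "e > 0" "y 0 = x0"
    "\<And>t. \<bar>t\<bar> < e \<Longrightarrow> y t \<in> S" "\<And>t. \<bar>t\<bar> < e \<Longrightarrow> (y has_vector_derivative f (y t)) (at t)"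
proof -
  obtain r where r: "r > 0" "cball x0 r \<subseteq> S" using S open_contains_cball by blast
  let ?C = "cball x0 r"
  have "bounded ((\<lambda>x. norm (pd b f x)) ` ?C)" for b
    by (intro compact_imp_bounded compact_continuous_image continuous_on_norm
        continuous_on_subset[OF smooth_on_continuous_on[OF smooth_on_pd[OF f]]]) (use r in auto)
  then have "\<forall>b. \<exists>B. \<forall>x\<in>?C. norm (pd b f x) \<le> B" unfolding bounded_iff by auto
  then obtain B where B: "\<And>b x. x \<in> ?C \<Longrightarrow> norm (pd b f x) \<le> B b" by metis
  \<comment> \<open>A linear map is bounded by the sum of the norms of its values on the basis
    vectors, and these values are the partial derivatives bounded on the ball.\<close>
  define K where "K = (\<Sum>b\<in>Basis. B b)"
  have C0: "x0 \<in> ?C" using r by simp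
  have K0: "K \<ge> 0" unfolding K_def using order_trans[OF norm_ge_zero B[OF C0]] by (rule sum_nonneg)
  have on: "onorm (\<lambda>u. pd u f x) \<le> K" if "x \<in> ?C" for x
  proof (rule onorm_le)
    fix u
    have "linear (\<lambda>u. pd u f x)"
      using f r that by (intro pd_linear smooth_on_differentiable) auto
    from linear_Basis_sum[OF this, of u]
    have "norm (pd u f x) \<le> (\<Sum>b\<in>Basis. norm ((u \<bullet> b) *\<^sub>R pd b f x))"
      by (metis norm_sum)
    also have "\<dots> \<le> (\<Sum>b\<in>Basis. norm u * B b)"
      using B[OF that] by (intro sum_mono) (auto intro!: mult_mono Basis_le_norm)
    finally show "norm (pd u f x) \<le> K * norm u" by (simp add: K_def sum_distrib_left mult.commute)
  qed
  have lip: "norm (f x - f y) \<le> K * norm (x - y)" if "x \<in> ?C" "y \<in> ?C" for x y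
    by (rule differentiable_bound[OF convex_cball _ on that])
      (use f r in \<open>auto intro!: has_derivative_at_withinI pd_has_derivative smooth_on_differentiable\<close>)
  define F where "F x = f (closest_point ?C x)" for x
  have cp: "closest_point ?C x \<in> ?C" for x by (rule closest_point_in_set) (use r in auto)
  have "dist (F x) (F y) \<le> K * dist x y" for x y
  proof -
    have "dist (F x) (F y) \<le> K * dist (closest_point ?C x) (closest_point ?C y)"
      unfolding F_def dist_norm by (rule lip[OF cp cp])
    also have "\<dots> \<le> K * dist x y"
      by (intro mult_left_mono closest_point_lipschitz K0) (use r in auto)
    finally show ?thesis .
  qed
  from ode_global[OF this K0, of x0] obtain e y where y: "e > 0" "y 0 = x0"
    "\<And>t. \<bar>t\<bar> < e \<Longrightarrow> (y has_vector_derivative F (y t)) (at t)" by metis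
  have "isCont y 0" using y(3)[of 0] y(1) by (auto intro: has_vector_derivative_continuous)
  then obtain d where d: "d > 0" "\<And>t. dist t 0 < d \<Longrightarrow> dist (y t) (y 0) < r"
    unfolding continuous_at_eps_delta using r(1) by blast
  show ?thesis
  proof (rule that[of "min e d" y])
    fix t :: real assume t: "\<bar>t\<bar> < min e d"
    then have C: "y t \<in> ?C" using d(2)[of t] y(2) by (simp add: dist_commute less_imp_le)
    then show "y t \<in> S" using r by auto
    have "F (y t) = f (y t)" using C by (simp add: F_def closest_point_self)
    then show "(y has_vector_derivative f (y t)) (at t)" using y(3)[of t] t by simp
  qed (use y d in auto)
qed

section \<open>Charts and tangent vectors\<close>

locale smooth_manifold =
  fixes \<A> :: "('m::{t2_space,second_countable_topology}, 'e::euclidean_space) chart set"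
  assumes atlas: "smooth_atlas \<A>"
begin

lemma open_cdom: "c \<in> \<A> \<Longrightarrow> open (cdom c)"
  and open_cran: "c \<in> \<A> \<Longrightarrow> open (cmap c ` cdom c)"
  and chart_homeo: "c \<in> \<A> \<Longrightarrow> homeomorphism (cdom c) (cmap c ` cdom c) (cmap c) (cinv c)"
  and smooth_trans: "c \<in> \<A> \<Longrightarrow> d \<in> \<A> \<Longrightarrow>
    smooth_on (cmap c ` (cdom c \<inter> cdom d)) (cmap d \<circ> cinv c)"
  using atlas unfolding smooth_atlas_def by simp_all

lemma cinv_cmap: "c \<in> \<A> \<Longrightarrow> p \<in> cdom c \<Longrightarrow> cinv c (cmap c p) = p"
  using homeomorphism_apply1[OF chart_homeo] .

lemma open_cmap_image:
  assumes c: "c \<in> \<A>" and W: "open W" "W \<subseteq> cdom c"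
  shows "open (cmap c ` W)"
proof -
  have "cmap c ` W = cmap c ` cdom c \<inter> cinv c -` W"
    using W(2) cinv_cmap[OF c] by (force simp: image_iff)
  then show ?thesis
    using continuous_open_preimage[OF homeomorphism_cont2[OF chart_homeo[OF c]] open_cran[OF c] W(1)]
    by simp
qed

lemma chart_at: "chart_at \<A> p \<in> \<A>" "p \<in> cdom (chart_at \<A> p)"
proof -
  have "p \<in> (\<Union>c\<in>\<A>. cdom c)" using atlas by (simp add: smooth_atlas_def)
  then have "\<exists>c. c \<in> \<A> \<and> p \<in> cdom c" by blast
  then have "chart_at \<A> p \<in> \<A> \<and> p \<in> cdom (chart_at \<A> p)" unfolding chart_at_def by (rule someI_ex)
  then show "chart_at \<A> p \<in> \<A>" "p \<in> cdom (chart_at \<A> p)" by auto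
qed

lemma trans_cmap: "c \<in> \<A> \<Longrightarrow> p \<in> cdom c \<Longrightarrow> (cmap d \<circ> cinv c) (cmap c p) = cmap d p"
  by (simp add: cinv_cmap)

lemma trans_differentiable:
  "c \<in> \<A> \<Longrightarrow> d \<in> \<A> \<Longrightarrow> p \<in> cdom c \<Longrightarrow> p \<in> cdom d \<Longrightarrow>
    (cmap d \<circ> cinv c) differentiable (at (cmap c p))"
  by (rule smooth_on_differentiable[OF smooth_trans]) auto

lemma change_deriv_pd: "change_deriv c d p u = pd u (cmap d \<circ> cinv c) (cmap c p)"
  by (simp add: change_deriv_def pd_def)

lemma pd_change_chart:
  assumes c: "c \<in> \<A>" and d: "d \<in> \<A>" and p: "p \<in> cdom c" "p \<in> cdom d"
    and f: "(f \<circ> cinv d) differentiable (at (cmap d p))"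
  shows "(f \<circ> cinv c) differentiable (at (cmap c p))"
    and "pd u (f \<circ> cinv c) (cmap c p) = pd (change_deriv c d p u) (f \<circ> cinv d) (cmap d p)"
proof -
  let ?S = "cmap c ` (cdom c \<inter> cdom d)" and ?t = "cmap d \<circ> cinv c"
  have S: "open ?S" "cmap c p \<in> ?S"
    using open_cmap_image[OF c] open_cdom[OF c] open_cdom[OF d] p by auto
  have eq: "(f \<circ> cinv d) (?t x) = (f \<circ> cinv c) x" if "x \<in> ?S" for x
    using that c d by (auto simp: cinv_cmap)
  have t: "?t differentiable (at (cmap c p))" by (rule trans_differentiable[OF c d p])
  have f': "(f \<circ> cinv d) differentiable (at (?t (cmap c p)))" using f c p by (simp add: cinv_cmap)
  show "(f \<circ> cinv c) differentiable (at (cmap c p))"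
    by (rule differentiable_cong_open[OF S eq differentiableI[OF pd_chain(1)[OF t f']]])
  show "pd u (f \<circ> cinv c) (cmap c p) = pd (change_deriv c d p u) (f \<circ> cinv d) (cmap d p)"
  proof -
    have "pd u (f \<circ> cinv c) (cmap c p) = pd u (\<lambda>x. (f \<circ> cinv d) (?t x)) (cmap c p)"
      by (rule pd_cong[OF S]) (simp only: eq)
    then show ?thesis
      using pd_chain(2)[OF t f', of u] by (simp only: change_deriv_pd trans_cmap[OF c p(1)])
  qed
qed

text \<open>The chain rule of \<open>pd_change_chart\<close>, with a third chart map inserted for
  \<open>f\<close>. This cocycle identity is what makes components in different charts describe one
  tangent vector.\<close>

lemma change_deriv_comp:
  assumes "c \<in> \<A>" "d \<in> \<A>" "e \<in> \<A>" "p \<in> cdom c" "p \<in> cdom d" "p \<in> cdom e"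
  shows "change_deriv d e p (change_deriv c d p u) = change_deriv c e p u"
  using pd_change_chart(2)[OF assms(1,2,4,5) trans_differentiable[OF assms(2,3,5,6)]]
  by (simp add: change_deriv_pd)

lemma change_deriv_self:
  assumes "c \<in> \<A>" "p \<in> cdom c"
  shows "change_deriv c c p u = u"
proof -
  have "pd u (cmap c \<circ> cinv c) (cmap c p) = pd u (\<lambda>x. x) (cmap c p)"
    by (rule pd_cong[OF open_cran[OF assms(1)]]) (use assms in \<open>auto simp: cinv_cmap\<close>)
  then show ?thesis by (simp add: change_deriv_pd pd_def)
qed

lemma change_deriv_linear:
  "c \<in> \<A> \<Longrightarrow> d \<in> \<A> \<Longrightarrow> p \<in> cdom c \<Longrightarrow> p \<in> cdom d \<Longrightarrow> linear (change_deriv c d p)"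
  using pd_linear[OF trans_differentiable] by (simp add: change_deriv_pd[abs_def])

lemma change_tcoord:
  "c \<in> \<A> \<Longrightarrow> d \<in> \<A> \<Longrightarrow> p \<in> cdom c \<Longrightarrow> p \<in> cdom d \<Longrightarrow> change_deriv c d p (tcoord \<A> c p x) = tcoord \<A> d p x"
  unfolding tcoord_def by (rule change_deriv_comp) (simp_all add: chart_at)

lemma tcoord_coord_field: "c \<in> \<A> \<Longrightarrow> p \<in> cdom c \<Longrightarrow> tcoord \<A> c p (coord_field \<A> c a p) = a"
  unfolding tcoord_def coord_field_def by (simp add: change_deriv_comp chart_at change_deriv_self)

lemma coord_field_tcoord: "c \<in> \<A> \<Longrightarrow> p \<in> cdom c \<Longrightarrow> coord_field \<A> c (tcoord \<A> c p x) p = x"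
  unfolding tcoord_def coord_field_def by (simp add: change_deriv_comp chart_at change_deriv_self)

lemma tcoord_linear: "c \<in> \<A> \<Longrightarrow> p \<in> cdom c \<Longrightarrow> linear (tcoord \<A> c p)"
  using change_deriv_linear[OF chart_at(1) _ chart_at(2)] by (simp add: tcoord_def[abs_def])

lemma coord_field_linear: "c \<in> \<A> \<Longrightarrow> p \<in> cdom c \<Longrightarrow> linear (\<lambda>a. coord_field \<A> c a p)"
  using change_deriv_linear[OF _ chart_at(1) _ chart_at(2)] by (simp add: coord_field_def)

lemma tcoord_chart_at: "tcoord \<A> (chart_at \<A> p) p x = x"
  unfolding tcoord_def by (rule change_deriv_self[OF chart_at])

lemmas tcoord_simps = linear_add[OF tcoord_linear] linear_diff[OF tcoord_linear]
  linear_cmul[OF tcoord_linear] linear_0[OF tcoord_linear] linear_sum[OF tcoord_linear]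

lemma tchart_inv_eq:
  assumes "c \<in> \<A>" "p \<in> cdom c"
  shows "tchart_inv \<A> c (cmap c p, y) = (p, coord_field \<A> c y p)"
proof -
  have "inj_on (tchart \<A> c) (cdom c \<times> UNIV)"
    using assms(1) by (intro inj_on_inverseI[where g = "\<lambda>(x, y). (cinv c x, coord_field \<A> c y (cinv c x))"])
      (auto simp: tchart_def cinv_cmap coord_field_tcoord)
  moreover have "(p, coord_field \<A> c y p) \<in> cdom c \<times> UNIV" using assms by simp
  moreover have "tchart \<A> c (p, coord_field \<A> c y p) = (cmap c p, y)"
    using assms by (simp add: tchart_def tcoord_coord_field)
  ultimately show ?thesis unfolding tchart_inv_def by (metis inv_into_f_f)
qed

lemma tchart_inv_tchart: "c \<in> \<A> \<Longrightarrow> fst v \<in> cdom c \<Longrightarrow> tchart_inv \<A> c (tchart \<A> c v) = v"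
  by (simp add: tchart_def tchart_inv_eq coord_field_tcoord)

lemma in_tchart_image:
  assumes "c \<in> \<A>" "p \<in> cdom c"
  shows "(cmap c p, y) \<in> tchart \<A> c ` (B \<inter> (cdom c \<times> UNIV)) \<longleftrightarrow> (p, coord_field \<A> c y p) \<in> B"
proof
  assume "(cmap c p, y) \<in> tchart \<A> c ` (B \<inter> (cdom c \<times> UNIV))"
  then obtain v where v: "v \<in> B" "fst v \<in> cdom c" "tchart \<A> c v = (cmap c p, y)" by auto
  then show "(p, coord_field \<A> c y p) \<in> B"
    using tchart_inv_tchart[OF assms(1) v(2)] tchart_inv_eq[OF assms] by simp
next
  assume "(p, coord_field \<A> c y p) \<in> B"
  then show "(cmap c p, y) \<in> tchart \<A> c ` (B \<inter> (cdom c \<times> UNIV))"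
    using assms by (auto simp: tchart_def tcoord_coord_field intro!: image_eqI[of _ _ "(p, coord_field \<A> c y p)"])
qed

section \<open>Smooth functions and vector fields\<close>

definition rep :: "('m, 'e) chart \<Rightarrow> ('m \<Rightarrow> 'e) \<Rightarrow> 'e \<Rightarrow> 'e" where
  "rep c X x = tcoord \<A> c (cinv c x) (X (cinv c x))"

lemma vector_field_rep:
  "vector_field \<A> U X \<longleftrightarrow> (\<forall>c\<in>\<A>. smooth_on (cmap c ` (U \<inter> cdom c)) (rep c X))"
  unfolding vector_field_def rep_def comp_def ..

lemma rep_cmap: "c \<in> \<A> \<Longrightarrow> p \<in> cdom c \<Longrightarrow> rep c X (cmap c p) = tcoord \<A> c p (X p)"
  by (simp add: rep_def cinv_cmap)

lemma open_chart_part: "c \<in> \<A> \<Longrightarrow> open U \<Longrightarrow> open (cmap c ` (U \<inter> cdom c))"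
  by (rule open_cmap_image) (auto simp: open_cdom)

lemma vector_field_subset: "vector_field \<A> U X \<Longrightarrow> W \<subseteq> U \<Longrightarrow> vector_field \<A> W X"
  unfolding vector_field_rep by (blast intro: smooth_on_subset)

lemma smooth_fun_subset: "smooth_fun \<A> U f \<Longrightarrow> W \<subseteq> U \<Longrightarrow> smooth_fun \<A> W f"
  unfolding smooth_fun_def by (blast intro: smooth_on_subset)

lemma vector_field_cong:
  assumes "open U" "\<And>p. p \<in> U \<Longrightarrow> X p = Y p" "vector_field \<A> U X"
  shows "vector_field \<A> U Y"
  unfolding vector_field_rep
proof
  fix c assume c: "c \<in> \<A>"
  show "smooth_on (cmap c ` (U \<inter> cdom c)) (rep c Y)"
    by (rule smooth_on_cong[OF open_chart_part[OF c assms(1)], of "rep c X"])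
      (use assms c in \<open>auto simp: vector_field_rep rep_cmap\<close>)
qed

lemma smooth_fun_cong:
  assumes "open U" "\<And>p. p \<in> U \<Longrightarrow> f p = g p" "smooth_fun \<A> U f"
  shows "smooth_fun \<A> U g"
  unfolding smooth_fun_def
proof
  fix c assume c: "c \<in> \<A>"
  show "smooth_on (cmap c ` (U \<inter> cdom c)) (g \<circ> cinv c)"
    by (rule smooth_on_cong[OF open_chart_part[OF c assms(1)], of "f \<circ> cinv c"])
      (use assms c in \<open>auto simp: smooth_fun_def cinv_cmap\<close>)
qed

lemma vector_field_Un:
  assumes "open U" "open W" "vector_field \<A> U X" "vector_field \<A> W X"
  shows "vector_field \<A> (U \<union> W) X"
  unfolding vector_field_rep
proof
  fix c assume c: "c \<in> \<A>"
  show "smooth_on (cmap c ` ((U \<union> W) \<inter> cdom c)) (rep c X)"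
    by (rule smooth_on_local)
      (use assms c open_chart_part[OF c assms(1)] open_chart_part[OF c assms(2)]
        in \<open>auto simp: vector_field_rep\<close>)
qed

lemma smooth_fun_Un:
  assumes "open U" "open W" "smooth_fun \<A> U f" "smooth_fun \<A> W f"
  shows "smooth_fun \<A> (U \<union> W) f"
  unfolding smooth_fun_def
proof
  fix c assume c: "c \<in> \<A>"
  show "smooth_on (cmap c ` ((U \<union> W) \<inter> cdom c)) (f \<circ> cinv c)"
    by (rule smooth_on_local)
      (use assms c open_chart_part[OF c assms(1)] open_chart_part[OF c assms(2)]
        in \<open>auto simp: smooth_fun_def\<close>)
qed

lemma smooth_fun_const: "smooth_fun \<A> U (\<lambda>p. k)"
  by (simp add: smooth_fun_def comp_def smooth_on_const)

lemma vector_field_zero: "open U \<Longrightarrow> vector_field \<A> U (\<lambda>p. 0)"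
  unfolding vector_field_rep
proof
  fix c assume c: "open U" "c \<in> \<A>"
  show "smooth_on (cmap c ` (U \<inter> cdom c)) (rep c (\<lambda>p. 0))"
    by (rule smooth_on_cong[OF open_chart_part[OF c(2,1)] _ smooth_on_const[of _ 0]])
      (use c in \<open>auto simp: rep_cmap tcoord_simps\<close>)
qed

lemma vector_field_add:
  assumes "open U" "vector_field \<A> U X" "vector_field \<A> U Y"
  shows "vector_field \<A> U (\<lambda>p. X p + Y p)"
  unfolding vector_field_rep
proof
  fix c assume c: "c \<in> \<A>"
  show "smooth_on (cmap c ` (U \<inter> cdom c)) (rep c (\<lambda>p. X p + Y p))"
    by (rule smooth_on_cong[OF open_chart_part[OF c assms(1)] _
          smooth_on_add[OF open_chart_part[OF c assms(1)], of "rep c X" "rep c Y"]])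
      (use assms c in \<open>auto simp: vector_field_rep rep_cmap tcoord_simps\<close>)
qed

lemma vector_field_scaleR:
  assumes "open U" "smooth_fun \<A> U f" "vector_field \<A> U X"
  shows "vector_field \<A> U (\<lambda>p. f p *\<^sub>R X p)"
  unfolding vector_field_rep
proof
  fix c assume c: "c \<in> \<A>"
  show "smooth_on (cmap c ` (U \<inter> cdom c)) (rep c (\<lambda>p. f p *\<^sub>R X p))"
    by (rule smooth_on_cong[OF open_chart_part[OF c assms(1)] _
          smooth_on_scaleR[OF open_chart_part[OF c assms(1)], of "f \<circ> cinv c" "rep c X"]])
      (use assms c in \<open>auto simp: vector_field_rep smooth_fun_def rep_cmap tcoord_simps cinv_cmap\<close>)
qed

lemma vector_field_diff:
  assumes "open U" "vector_field \<A> U X" "vector_field \<A> U Y"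
  shows "vector_field \<A> U (\<lambda>p. X p - Y p)"
  using vector_field_add[OF assms(1,2) vector_field_scaleR[OF assms(1) smooth_fun_const assms(3), of "-1"]]
  by simp

lemma vector_field_sum:
  "open U \<Longrightarrow> (\<And>i. i \<in> I \<Longrightarrow> vector_field \<A> U (X i)) \<Longrightarrow> vector_field \<A> U (\<lambda>p. \<Sum>i\<in>I. X i p)"
  by (induction I rule: infinite_finite_induct) (auto intro: vector_field_zero vector_field_add)

lemma smooth_fun_mult:
  fixes f g :: "'m \<Rightarrow> real"
  assumes "open U" "smooth_fun \<A> U f" "smooth_fun \<A> U g"
  shows "smooth_fun \<A> U (\<lambda>p. f p * g p)"
  unfolding smooth_fun_def
proof
  fix c assume c: "c \<in> \<A>"
  show "smooth_on (cmap c ` (U \<inter> cdom c)) ((\<lambda>p. f p * g p) \<circ> cinv c)"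
    using smooth_on_mult[OF open_chart_part[OF c assms(1)], of "f \<circ> cinv c" "g \<circ> cinv c"] assms c
    by (simp add: smooth_fun_def comp_def)
qed

lemma smooth_fun_diff:
  assumes "open U" "smooth_fun \<A> U f" "smooth_fun \<A> U g"
  shows "smooth_fun \<A> U (\<lambda>p. f p - g p)"
  unfolding smooth_fun_def
proof
  fix c assume c: "c \<in> \<A>"
  show "smooth_on (cmap c ` (U \<inter> cdom c)) ((\<lambda>p. f p - g p) \<circ> cinv c)"
    using smooth_on_diff[OF open_chart_part[OF c assms(1)], of "f \<circ> cinv c" "g \<circ> cinv c"] assms c
    by (simp add: smooth_fun_def comp_def)
qed

lemma trans_image_subset:
  assumes "c \<in> \<A>" "d \<in> \<A>"
  shows "(cmap c \<circ> cinv d) ` cmap d ` (W \<inter> cdom d) \<subseteq> cmap c ` W"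
  using assms by (auto simp: cinv_cmap)

text \<open>In another chart the components arise by applying the Jacobian of the transition map to
  the given ones, and this operation preserves smoothness. So a single chart around the set
  suffices.\<close>

lemma vector_field_chartI:
  assumes c: "c \<in> \<A>" and W: "open W" "W \<subseteq> cdom c" and X: "smooth_on (cmap c ` W) (rep c X)"
  shows "vector_field \<A> W X"
  unfolding vector_field_rep
proof
  fix d assume d: "d \<in> \<A>"
  let ?S = "cmap d ` (W \<inter> cdom d)" and ?t = "cmap c \<circ> cinv d"
  have S: "open ?S" by (rule open_chart_part[OF d W(1)])
  have t: "smooth_on ?S ?t" by (rule smooth_on_subset[OF smooth_trans[OF d c]]) (use W in auto)
  have sub: "?t ` ?S \<subseteq> cmap c ` W" by (rule trans_image_subset[OF c d])
  have sub': "?t ` ?S \<subseteq> cmap c ` (cdom c \<inter> cdom d)" using W d c by (auto simp: cinv_cmap)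
  show "smooth_on ?S (rep d X)"
  proof (rule smooth_on_cong[OF S])
    show "smooth_on ?S (\<lambda>x. pd (rep c X (?t x)) (cmap d \<circ> cinv c) (?t x))"
      by (rule smooth_on_pd_along[OF S smooth_trans[OF c d] t smooth_on_compose[OF S X t sub] sub'])
    fix x assume "x \<in> ?S"
    then obtain p where p: "p \<in> W" "p \<in> cdom d" "x = cmap d p" by auto
    then show "pd (rep c X (?t x)) (cmap d \<circ> cinv c) (?t x) = rep d X x"
      using W c d change_tcoord[OF c d, of p "X p"]
      by (auto simp: cinv_cmap rep_cmap change_deriv_pd[symmetric])
  qed
qed

lemma smooth_fun_chartI:
  assumes c: "c \<in> \<A>" and W: "open W" "W \<subseteq> cdom c" and f: "smooth_on (cmap c ` W) (f \<circ> cinv c)"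
  shows "smooth_fun \<A> W f"
  unfolding smooth_fun_def
proof
  fix d assume d: "d \<in> \<A>"
  let ?S = "cmap d ` (W \<inter> cdom d)" and ?t = "cmap c \<circ> cinv d"
  have S: "open ?S" by (rule open_chart_part[OF d W(1)])
  have t: "smooth_on ?S ?t" by (rule smooth_on_subset[OF smooth_trans[OF d c]]) (use W in auto)
  have sub: "?t ` ?S \<subseteq> cmap c ` W" by (rule trans_image_subset[OF c d])
  show "smooth_on ?S (f \<circ> cinv d)"
    by (rule smooth_on_cong[OF S _ smooth_on_compose[OF S f t sub]])
      (use W c d in \<open>auto simp: cinv_cmap subset_iff\<close>)
qed

lemma rep_coord_field: "c \<in> \<A> \<Longrightarrow> x \<in> cmap c ` cdom c \<Longrightarrow> rep c (coord_field \<A> c a) x = a"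
  by (auto simp: rep_cmap tcoord_coord_field)

lemma vector_field_coord_field:
  assumes "c \<in> \<A>"
  shows "vector_field \<A> (cdom c) (coord_field \<A> c a)"
proof (rule vector_field_chartI[OF assms open_cdom[OF assms] subset_refl])
  show "smooth_on (cmap c ` cdom c) (rep c (coord_field \<A> c a))"
    by (rule smooth_on_cong[OF open_cran[OF assms] _ smooth_on_const[of _ a]])
      (simp add: rep_coord_field[OF assms])
qed

section \<open>Bump functions and extension of germs\<close>

text \<open>The support condition is expressed by an open cover: \<beta> vanishes on an open
  \<open>Z\<close> that together with \<open>W\<close> covers the manifold. A product with \<beta>
  is then smooth on two open sets, and smoothness glues.\<close>

definition is_bump :: "'m set \<Rightarrow> 'm set \<Rightarrow> ('m \<Rightarrow> real) \<Rightarrow> bool" where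
  "is_bump W N \<beta> \<longleftrightarrow> smooth_fun \<A> UNIV \<beta> \<and> open N \<and> (\<forall>q\<in>N. \<beta> q = 1) \<and>
     (\<exists>Z. open Z \<and> Z \<union> W = UNIV \<and> (\<forall>q\<in>Z. \<beta> q = 0))"

lemma is_bumpD:
  assumes "is_bump W N \<beta>"
  shows "smooth_fun \<A> UNIV \<beta>" "open N" "\<And>q. q \<in> N \<Longrightarrow> \<beta> q = 1" "\<And>q. q \<notin> W \<Longrightarrow> \<beta> q = 0" "N \<subseteq> W"
proof -
  obtain Z where Z: "Z \<union> W = UNIV" "\<forall>q\<in>Z. \<beta> q = 0" using assms by (auto simp: is_bump_def)
  show "smooth_fun \<A> UNIV \<beta>" "open N" and 1: "\<And>q. q \<in> N \<Longrightarrow> \<beta> q = 1"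
    using assms by (auto simp: is_bump_def)
  show "\<beta> q = 0" if "q \<notin> W" for q using Z that by blast
  show "N \<subseteq> W" using Z 1 by (metis UNIV_I UnE subsetI zero_neq_one)
qed

lemma bump_exists:
  assumes W: "open W" "p \<in> W"
  obtains N \<beta> where "is_bump W N \<beta>" "p \<in> N"
proof -
  let ?c = "chart_at \<A> p"
  note c = chart_at(1)[of p] and pc = chart_at(2)[of p]
  let ?x = "cmap ?c p" and ?O = "cmap ?c ` (W \<inter> cdom ?c)"
  have "open ?O" "?x \<in> ?O" using open_chart_part[OF c W(1)] W(2) pc by auto
  then obtain r0 where r0: "r0 > 0" "cball ?x r0 \<subseteq> ?O" using open_contains_cball by blast
  define r where "r = r0 / 2"
  have r: "r > 0" "cball ?x (2 * r) \<subseteq> ?O" using r0 by (simp_all add: r_def)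
  obtain b :: "'e \<Rightarrow> real" where b: "smooth_on UNIV b" "\<And>x. dist x ?x < r \<Longrightarrow> b x = 1"
    "\<And>x. dist x ?x \<ge> 2 * r \<Longrightarrow> b x = 0" using euclidean_bump[OF r(1), of ?x] by blast
  define \<beta> where "\<beta> q = (if q \<in> cdom ?c then b (cmap ?c q) else 0)" for q
  define K where "K = cinv ?c ` cball ?x (2 * r)"
  define N where "N = {q \<in> cdom ?c. cmap ?c q \<in> ball ?x r}"
  have KW: "K \<subseteq> W \<inter> cdom ?c" using r(2) c by (force simp: K_def cinv_cmap subset_iff)
  have "compact K" unfolding K_def
    by (rule compact_continuous_image[OF continuous_on_subset[OF homeomorphism_cont2[OF chart_homeo[OF c]]] compact_cball])
      (use r(2) in auto)
  \<comment> \<open>The Hausdorff property enters here: the compact set \<open>K\<close> carrying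
    \<beta> is closed not only in the chart domain but in the manifold.\<close>
  then have Z: "open (- K)" by (simp add: compact_imp_closed open_Compl)
  have Z0: "\<beta> q = 0" if "q \<in> - K" for q
  proof (cases "q \<in> cdom ?c")
    case True
    then have "cmap ?c q \<notin> cball ?x (2 * r)"
      using that cinv_cmap[OF c True] unfolding K_def by (metis ComplD imageI)
    then show ?thesis using True b(3) by (simp add: \<beta>_def dist_commute)
  qed (simp add: \<beta>_def)
  have "open N"
  proof -
    have "N = cdom ?c \<inter> cmap ?c -` ball ?x r" by (auto simp: N_def)
    then show ?thesis
      using continuous_open_preimage[OF homeomorphism_cont1[OF chart_homeo[OF c]] open_cdom[OF c] open_ball] by simp
  qed
  have "smooth_fun \<A> (cdom ?c) \<beta>"
    by (rule smooth_fun_chartI[OF c open_cdom[OF c] subset_refl],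
        rule smooth_on_cong[OF open_cran[OF c] _ smooth_on_subset[OF b(1) subset_UNIV]])
      (use c in \<open>auto simp: \<beta>_def cinv_cmap\<close>)
  moreover have "smooth_fun \<A> (- K) \<beta>"
    by (rule smooth_fun_cong[OF Z _ smooth_fun_const[of _ 0]]) (simp add: Z0)
  ultimately have "smooth_fun \<A> (cdom ?c \<union> - K) \<beta>"
    by (intro smooth_fun_Un open_cdom[OF c] Z)
  moreover have "cdom ?c \<union> - K = UNIV" using KW by auto
  ultimately have "smooth_fun \<A> UNIV \<beta>" by simp
  moreover have "\<beta> q = 1" if "q \<in> N" for q
    using that b(2) by (auto simp: N_def \<beta>_def dist_commute)
  ultimately have "is_bump W N \<beta>"
    unfolding is_bump_def using Z Z0 KW \<open>open N\<close> by (auto intro!: exI[of _ "- K"])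
  then show ?thesis by (rule that) (use pc r in \<open>auto simp: N_def\<close>)
qed

lemma bump_scaleR:
  assumes "open W" "is_bump W N \<beta>" "vector_field \<A> W X"
  shows "vector_field \<A> UNIV (\<lambda>q. \<beta> q *\<^sub>R X q)"
proof -
  obtain Z where Z: "open Z" "Z \<union> W = UNIV" "\<forall>q\<in>Z. \<beta> q = 0"
    using assms(2) by (auto simp: is_bump_def)
  have "vector_field \<A> Z (\<lambda>q. \<beta> q *\<^sub>R X q)"
    by (rule vector_field_cong[OF Z(1) _ vector_field_zero[OF Z(1)]]) (use Z in simp)
  moreover have "vector_field \<A> W (\<lambda>q. \<beta> q *\<^sub>R X q)"
    by (rule vector_field_scaleR[OF assms(1) smooth_fun_subset[OF is_bumpD(1)[OF assms(2)]] assms(3)]) simp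
  ultimately show ?thesis using vector_field_Un[OF Z(1) assms(1)] Z(2) by simp
qed

lemma bump_mult:
  fixes f :: "'m \<Rightarrow> real"
  assumes "open W" "is_bump W N \<beta>" "smooth_fun \<A> W f"
  shows "smooth_fun \<A> UNIV (\<lambda>q. \<beta> q * f q)"
proof -
  obtain Z where Z: "open Z" "Z \<union> W = UNIV" "\<forall>q\<in>Z. \<beta> q = 0"
    using assms(2) by (auto simp: is_bump_def)
  have "smooth_fun \<A> Z (\<lambda>q. \<beta> q * f q)"
    by (rule smooth_fun_cong[OF Z(1) _ smooth_fun_const[of Z 0]]) (use Z in simp)
  moreover have "smooth_fun \<A> W (\<lambda>q. \<beta> q * f q)"
    by (rule smooth_fun_mult[OF assms(1) smooth_fun_subset[OF is_bumpD(1)[OF assms(2)]] assms(3)]) simp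
  ultimately show ?thesis using smooth_fun_Un[OF Z(1) assms(1)] Z(2) by simp
qed

text \<open>A cut-off of \<open>X\<close> witnesses the choice, so the chosen field really is global
  and has the germ of \<open>X\<close>.\<close>

lemma germ_ext:
  assumes W: "open W" "p \<in> W" and X: "vector_field \<A> W X"
  shows "vector_field \<A> UNIV (germ_ext \<A> p X)"
    and "\<exists>N. open N \<and> p \<in> N \<and> N \<subseteq> W \<and> (\<forall>q\<in>N. germ_ext \<A> p X q = X q)"
proof -
  obtain N \<beta> where b: "is_bump W N \<beta>" "p \<in> N" using bump_exists[OF W] .
  have "vector_field \<A> UNIV (\<lambda>q. \<beta> q *\<^sub>R X q) \<and> (\<forall>\<^sub>F q in nhds p. \<beta> q *\<^sub>R X q = X q)"
    using bump_scaleR[OF W(1) b(1) X] is_bumpD(2,3)[OF b(1)] b(2)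
    by (auto simp: eventually_nhds intro!: exI[of _ N])
  then have *: "vector_field \<A> UNIV (germ_ext \<A> p X) \<and> (\<forall>\<^sub>F q in nhds p. germ_ext \<A> p X q = X q)"
    unfolding germ_ext_def by (rule someI[where P = "\<lambda>Y. vector_field \<A> UNIV Y \<and> (\<forall>\<^sub>F q in nhds p. Y q = X q)"])
  then show "vector_field \<A> UNIV (germ_ext \<A> p X)" by simp
  from * obtain S where "open S" "p \<in> S" "\<forall>q\<in>S. germ_ext \<A> p X q = X q"
    by (auto simp: eventually_nhds)
  then show "\<exists>N. open N \<and> p \<in> N \<and> N \<subseteq> W \<and> (\<forall>q\<in>N. germ_ext \<A> p X q = X q)"
    using W by (intro exI[of _ "S \<inter> W"]) auto
qed

lemma field_through: "vector_field \<A> UNIV (field_through \<A> p x)" "field_through \<A> p x p = x"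
proof -
  let ?c = "chart_at \<A> p"
  obtain N \<beta> where b: "is_bump (cdom ?c) N \<beta>" "p \<in> N"
    using bump_exists[OF open_cdom[OF chart_at(1)] chart_at(2)] .
  have "vector_field \<A> UNIV (\<lambda>q. \<beta> q *\<^sub>R coord_field \<A> ?c x q)"
    by (rule bump_scaleR[OF open_cdom[OF chart_at(1)] b(1) vector_field_coord_field[OF chart_at(1)]])
  moreover have "\<beta> p *\<^sub>R coord_field \<A> ?c x p = x"
    using is_bumpD(3)[OF b] coord_field_tcoord[OF chart_at, of p x] by (simp add: tcoord_chart_at)
  ultimately have "vector_field \<A> UNIV (field_through \<A> p x) \<and> field_through \<A> p x p = x"
    unfolding field_through_def
    by (intro someI[where P = "\<lambda>X. vector_field \<A> UNIV X \<and> X p = x"] conjI)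
  then show "vector_field \<A> UNIV (field_through \<A> p x)" "field_through \<A> p x p = x" by auto
qed

section \<open>Derivations and the Lie bracket\<close>

lemma tderiv_chart:
  assumes "c \<in> \<A>" "p \<in> cdom c" "(f \<circ> cinv c) differentiable (at (cmap c p))"
  shows "tderiv \<A> p x f = pd (tcoord \<A> c p x) (f \<circ> cinv c) (cmap c p)"
  using pd_change_chart(2)[OF chart_at(1) assms(1) chart_at(2) assms(2,3), of x]
  by (simp add: tderiv_def pd_def tcoord_def)

lemma tderiv_cong:
  assumes N: "open N" "p \<in> N" "\<And>q. q \<in> N \<Longrightarrow> f q = g q"
  shows "tderiv \<A> p x f = tderiv \<A> p x g"
proof -
  let ?c = "chart_at \<A> p"
  have "pd x (f \<circ> cinv ?c) (cmap ?c p) = pd x (g \<circ> cinv ?c) (cmap ?c p)"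
    by (rule pd_cong[OF open_chart_part[OF chart_at(1) N(1)]])
      (use N chart_at in \<open>auto simp: cinv_cmap\<close>)
  then show ?thesis by (simp add: tderiv_def pd_def)
qed

lemma smooth_fun_differentiable:
  "smooth_fun \<A> U f \<Longrightarrow> c \<in> \<A> \<Longrightarrow> p \<in> U \<Longrightarrow> p \<in> cdom c \<Longrightarrow> (f \<circ> cinv c) differentiable (at (cmap c p))"
  unfolding smooth_fun_def by (rule smooth_on_differentiable) auto

lemma rep_differentiable:
  "vector_field \<A> U X \<Longrightarrow> c \<in> \<A> \<Longrightarrow> p \<in> U \<Longrightarrow> p \<in> cdom c \<Longrightarrow> rep c X differentiable (at (cmap c p))"
  unfolding vector_field_rep by (rule smooth_on_differentiable) auto

text \<open>The coordinate functions of the preferred chart are admissible test functions on its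
  domain, and their derivatives along \<open>z\<close> are the components of \<open>z\<close>. This
  yields the uniqueness behind the definite description in \<open>lie_bracket\<close>.\<close>

lemma tderiv_eq_zero:
  assumes "\<And>U (f :: 'm \<Rightarrow> real). open U \<Longrightarrow> p \<in> U \<Longrightarrow> smooth_fun \<A> U f \<Longrightarrow> tderiv \<A> p z f = 0"
  shows "z = 0"
proof (rule euclidean_eqI)
  fix b :: 'e assume "b \<in> Basis"
  let ?c = "chart_at \<A> p" and ?f = "\<lambda>q. cmap (chart_at \<A> p) q \<bullet> b"
  have d: "((\<lambda>x. x \<bullet> b) has_derivative (\<lambda>u. u \<bullet> b)) (at x)" for x :: 'e
    by (intro has_derivative_inner_left has_derivative_ident)
  have eq: "x \<bullet> b = (?f \<circ> cinv ?c) x" if "x \<in> cmap ?c ` cdom ?c" for x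
    using that by (auto simp: cinv_cmap[OF chart_at(1)])
  have "smooth_fun \<A> (cdom ?c) ?f"
    by (rule smooth_fun_chartI[OF chart_at(1) open_cdom[OF chart_at(1)] subset_refl],
        rule smooth_on_cong[OF open_cran[OF chart_at(1)] eq])
      (simp_all add: smooth_on_inner smooth_on_ident smooth_on_const open_cran[OF chart_at(1)])
  from assms[OF open_cdom[OF chart_at(1)] chart_at(2) this]
  have "pd z (?f \<circ> cinv ?c) (cmap ?c p) = 0" by (simp add: tderiv_def pd_def)
  then have "pd z (\<lambda>x. x \<bullet> b) (cmap ?c p) = 0"
    using pd_cong[OF open_cran[OF chart_at(1)] imageI[OF chart_at(2)], of p "\<lambda>x. x \<bullet> b" "?f \<circ> cinv ?c" z] eq
    by simp
  then show "z \<bullet> b = 0 \<bullet> b" using pd_eq[OF d, of z "cmap ?c p"] by simp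
qed

end

text \<open>A product rule for a family \<open>H z\<close> of linear maps whose differentiability is
  known only for each fixed vector. Expanding the moving vector \<open>Y x\<close> in the basis
  reduces it to products of a scalar function with such fixed evaluations.\<close>

lemma linear_slot_derivative:
  fixes Y :: "'a::real_normed_vector \<Rightarrow> 'b::euclidean_space"
    and H :: "'c::real_normed_vector \<Rightarrow> 'b \<Rightarrow> 'd::real_normed_vector"
  assumes S: "open S" "g x \<in> S"
    and lin: "\<And>z. z \<in> S \<Longrightarrow> linear (H z)"
    and H: "\<And>b. (\<lambda>z. H z b) differentiable (at (g x))"
    and g: "g differentiable (at x)" and Y: "Y differentiable (at x)"
  shows "((\<lambda>x. H (g x) (Y x)) has_derivative
    (\<lambda>u. pd (pd u g x) (\<lambda>z. H z (Y x)) (g x) + H (g x) (pd u Y x))) (at x)"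
proof -
  have Hg: "((\<lambda>x. H (g x) b) has_derivative (\<lambda>u. pd (pd u g x) (\<lambda>z. H z b) (g x))) (at x)" for b
    using diff_chain_at[OF pd_has_derivative[OF g] pd_has_derivative[OF H]] by (simp add: o_def)
  have Yb: "((\<lambda>x. Y x \<bullet> b) has_derivative (\<lambda>u. pd u Y x \<bullet> b)) (at x)" for b
    by (rule has_derivative_inner_left[OF pd_has_derivative[OF Y]])
  have 1: "((\<lambda>x. \<Sum>b\<in>Basis. (Y x \<bullet> b) *\<^sub>R H (g x) b) has_derivative
     (\<lambda>u. \<Sum>b\<in>Basis. (Y x \<bullet> b) *\<^sub>R pd (pd u g x) (\<lambda>z. H z b) (g x) + (pd u Y x \<bullet> b) *\<^sub>R H (g x) b)) (at x)"
    by (intro has_derivative_sum has_derivative_scaleR Yb Hg)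
  have 2: "pd w (\<lambda>z. H z a) (g x) = (\<Sum>b\<in>Basis. (a \<bullet> b) *\<^sub>R pd w (\<lambda>z. H z b) (g x))" for w a
  proof -
    have "((\<lambda>z. \<Sum>b\<in>Basis. (a \<bullet> b) *\<^sub>R H z b) has_derivative
        (\<lambda>w. \<Sum>b\<in>Basis. (a \<bullet> b) *\<^sub>R pd w (\<lambda>z. H z b) (g x))) (at (g x))"
      by (intro has_derivative_sum has_derivative_scaleR_right pd_has_derivative H)
    from pd_eq[OF this, of w]
    have "pd w (\<lambda>z. \<Sum>b\<in>Basis. (a \<bullet> b) *\<^sub>R H z b) (g x) = (\<Sum>b\<in>Basis. (a \<bullet> b) *\<^sub>R pd w (\<lambda>z. H z b) (g x))" .
    moreover have "pd w (\<lambda>z. H z a) (g x) = pd w (\<lambda>z. \<Sum>b\<in>Basis. (a \<bullet> b) *\<^sub>R H z b) (g x)"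
      by (rule pd_cong[OF S]) (rule linear_Basis_sum[OF lin])
    ultimately show ?thesis by simp
  qed
  have 3: "(\<lambda>u. \<Sum>b\<in>Basis. (Y x \<bullet> b) *\<^sub>R pd (pd u g x) (\<lambda>z. H z b) (g x) + (pd u Y x \<bullet> b) *\<^sub>R H (g x) b)
     = (\<lambda>u. pd (pd u g x) (\<lambda>z. H z (Y x)) (g x) + H (g x) (pd u Y x))"
    by (simp add: fun_eq_iff sum.distrib 2[of _ "Y x"] linear_Basis_sum[OF lin[OF S(2)], symmetric])
  have "isCont g x" by (rule differentiable_imp_continuous_within[OF g])
  then have "\<forall>\<^sub>F y in nhds x. g y \<in> S"
    using S by (simp add: continuous_at_open eventually_nhds)
  then obtain N where N: "open N" "x \<in> N" "\<And>y. y \<in> N \<Longrightarrow> g y \<in> S"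
    by (auto simp: eventually_nhds)
  show ?thesis
    by (rule has_derivative_transform_within_open[OF 1[unfolded 3] N(1,2)])
      (simp add: linear_Basis_sum[OF lin[OF N(3)], symmetric])
qed

lemma bilinear_slot_derivative:
  fixes Y Z :: "'a::real_normed_vector \<Rightarrow> 'b::euclidean_space"
    and G :: "'c::euclidean_space \<Rightarrow> 'b \<Rightarrow> 'b \<Rightarrow> 'd::real_normed_vector"
  assumes S: "open S" "g x \<in> S"
    and lin: "\<And>z. z \<in> S \<Longrightarrow> bilinear (G z)"
    and G: "\<And>a b. (\<lambda>z. G z a b) differentiable (at (g x))"
    and g: "g differentiable (at x)" and Y: "Y differentiable (at x)" and Z: "Z differentiable (at x)"
  shows "((\<lambda>x. G (g x) (Y x) (Z x)) has_derivative
    (\<lambda>u. pd (pd u g x) (\<lambda>z. G z (Y x) (Z x)) (g x) + G (g x) (pd u Y x) (Z x) + G (g x) (Y x) (pd u Z x))) (at x)"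
proof -
  have "isCont g x" by (rule differentiable_imp_continuous_within[OF g])
  then have "\<forall>\<^sub>F y in nhds x. g y \<in> S"
    using S by (simp add: continuous_at_open eventually_nhds)
  then obtain N where N: "open N" "x \<in> N" "\<And>y. y \<in> N \<Longrightarrow> g y \<in> S"
    by (auto simp: eventually_nhds)
  have 1: "((\<lambda>x. G (g x) (Y x) b) has_derivative
    (\<lambda>u. pd (pd u g x) (\<lambda>z. G z (Y x) b) (g x) + G (g x) (pd u Y x) b)) (at x)" for b
    by (rule linear_slot_derivative[of S g x "\<lambda>z a. G z a b"])
      (use S lin in \<open>auto simp: bilinear_def G g Y\<close>)
  \<comment> \<open>The first slot has been absorbed into the family of linear maps
    \<open>G (g y) (Y y)\<close>, indexed by \<open>y\<close> itself; hence the base map of this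
    second application is the identity.\<close>
  have "((\<lambda>y. G (g y) (Y y) (Z y)) has_derivative
     (\<lambda>u. pd (pd u (\<lambda>y. y) x) (\<lambda>y. G (g y) (Y y) (Z x)) x + G (g x) (Y x) (pd u Z x))) (at x)"
    by (rule linear_slot_derivative[of N "\<lambda>y. y" x "\<lambda>y. G (g y) (Y y)" Z])
      (use N lin Z in \<open>auto simp: bilinear_def intro: differentiableI[OF 1]\<close>)
  moreover have "pd u (\<lambda>y. y) x = u" for u by (simp add: pd_def)
  ultimately show ?thesis by (simp add: pd_eq[OF 1])
qed

lemma pd_along_derivative:
  fixes F :: "'a::euclidean_space \<Rightarrow> 'b::real_normed_vector"
  assumes S: "open S" "x \<in> S" and F: "smooth_on S F" and Y: "Y differentiable (at x)"
  shows "((\<lambda>x. pd (Y x) F x) has_derivative (\<lambda>u. pd u (pd (Y x) F) x + pd (pd u Y x) F x)) (at x)"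
proof -
  have "((\<lambda>x. pd (Y x) F x) has_derivative
      (\<lambda>u. pd (pd u (\<lambda>x. x) x) (\<lambda>z. pd (Y x) F z) x + pd (pd u Y x) F x)) (at x)"
    by (rule linear_slot_derivative[of S "\<lambda>x. x" x "\<lambda>z a. pd a F z"])
      (use S Y F in \<open>auto intro: pd_linear smooth_on_differentiable smooth_on_pd\<close>)
  moreover have "pd u (\<lambda>y. y) x = u" for u :: 'a by (simp add: pd_def)
  ultimately show ?thesis by simp
qed

context smooth_manifold
begin

lemma tderiv_rep:
  assumes "c \<in> \<A>" "smooth_fun \<A> U f" "p \<in> U" "p \<in> cdom c"
  shows "tderiv \<A> p (X p) f = pd (rep c X (cmap c p)) (f \<circ> cinv c) (cmap c p)"
  using tderiv_chart[OF assms(1,4) smooth_fun_differentiable[OF assms(2,1,3,4)]] rep_cmap[OF assms(1,4)]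
  by simp

text \<open>In the commutator of the two derivations the second derivatives of the test function
  cancel by symmetry, which leaves a first-order operator with these components. Uniqueness of the
  tangent vector then identifies it with the described one.\<close>

lemma lie_bracket_rep:
  assumes c: "c \<in> \<A>" and W: "open W" "p \<in> W" "p \<in> cdom c"
    and X: "vector_field \<A> W X" and Y: "vector_field \<A> W Y"
  defines "x \<equiv> cmap c p"
  shows "tcoord \<A> c p (lie_bracket \<A> X Y p) = pd (rep c X x) (rep c Y) x - pd (rep c Y x) (rep c X) x"
proof -
  have comm: "tderiv \<A> p (X p) (\<lambda>q. tderiv \<A> q (Y q) f)
      = pd (pd (rep c X x) (rep c Y) x) (f \<circ> cinv c) x + pd (rep c X x) (pd (rep c Y x) (f \<circ> cinv c)) x"
    if X: "vector_field \<A> W X" and Y: "vector_field \<A> W Y" and U: "open U" "p \<in> U" "smooth_fun \<A> U f"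
    for U X Y and f :: "'m \<Rightarrow> real"
  proof -
    let ?N = "U \<inter> W \<inter> cdom c" and ?F = "f \<circ> cinv c"
    have N: "open ?N" "p \<in> ?N" using U W open_cdom[OF c] by auto
    let ?S = "cmap c ` ?N"
    have S: "open ?S" "x \<in> ?S" using open_cmap_image[OF c N(1)] N(2) by (auto simp: x_def)
    have F: "smooth_on ?S ?F"
      using U(3) c by (auto simp: smooth_fun_def intro: smooth_on_subset)
    have d: "((\<lambda>x. pd (rep c Y x) ?F x) has_derivative
        (\<lambda>u. pd u (pd (rep c Y x) ?F) x + pd (pd u (rep c Y) x) ?F x)) (at x)"
      by (rule pd_along_derivative[OF S F]) (use Y c W in \<open>auto simp: x_def intro: rep_differentiable\<close>)
    have eq: "pd (rep c Y y) ?F y = ((\<lambda>q. tderiv \<A> q (Y q) f) \<circ> cinv c) y" if "y \<in> ?S" for y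
      using that tderiv_rep[OF c U(3), of _ Y] by (auto simp: cinv_cmap[OF c])
    have "((\<lambda>q. tderiv \<A> q (Y q) f) \<circ> cinv c) differentiable (at x)"
      by (rule differentiable_cong_open[OF S eq differentiableI[OF d]])
    from tderiv_chart[OF c W(3) this[unfolded x_def], of "X p"]
    have "tderiv \<A> p (X p) (\<lambda>q. tderiv \<A> q (Y q) f)
        = pd (rep c X x) ((\<lambda>q. tderiv \<A> q (Y q) f) \<circ> cinv c) x"
      by (simp add: rep_cmap[OF c W(3)] x_def)
    also have "\<dots> = pd (rep c X x) (\<lambda>x. pd (rep c Y x) ?F x) x"
      by (rule pd_cong[OF S eq[symmetric]])
    finally show ?thesis by (simp add: pd_eq[OF d])
  qed
  define b where "b = pd (rep c X x) (rep c Y) x - pd (rep c Y x) (rep c X) x"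
  define z where "z = coord_field \<A> c b p"
  have z: "tderiv \<A> p z f = tderiv \<A> p (X p) (\<lambda>q. tderiv \<A> q (Y q) f) - tderiv \<A> p (Y p) (\<lambda>q. tderiv \<A> q (X q) f)"
    if U: "open U" "p \<in> U" "smooth_fun \<A> U f" for U and f :: "'m \<Rightarrow> real"
  proof -
    have S: "open (cmap c ` (U \<inter> cdom c))" "x \<in> cmap c ` (U \<inter> cdom c)"
      using open_chart_part[OF c U(1)] U(2) W(3) by (auto simp: x_def)
    have F: "smooth_on (cmap c ` (U \<inter> cdom c)) (f \<circ> cinv c)"
      using U(3) c by (auto simp: smooth_fun_def)
    have D: "(f \<circ> cinv c) differentiable (at x)" by (rule smooth_on_differentiable[OF F S(2)])
    have "tderiv \<A> p z f = pd b (f \<circ> cinv c) x"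
      using tderiv_chart[OF c W(3) D[unfolded x_def], of z] tcoord_coord_field[OF c W(3)]
      by (simp add: z_def x_def)
    also have "\<dots> = pd (pd (rep c X x) (rep c Y) x) (f \<circ> cinv c) x - pd (pd (rep c Y x) (rep c X) x) (f \<circ> cinv c) x"
      unfolding b_def by (rule linear_diff[OF pd_linear[OF D]])
    finally show ?thesis
      using comm[OF X Y U] comm[OF Y X U] pd_commute[OF S F, of "rep c X x" "rep c Y x"] by simp
  qed
  have "lie_bracket \<A> X Y p = z"
    unfolding lie_bracket_def
  proof (rule the_equality)
    show "\<forall>U (f :: 'm \<Rightarrow> real). open U \<and> p \<in> U \<and> smooth_fun \<A> U f \<longrightarrow> tderiv \<A> p z f =
      tderiv \<A> p (X p) (\<lambda>q. tderiv \<A> q (Y q) f) - tderiv \<A> p (Y p) (\<lambda>q. tderiv \<A> q (X q) f)"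
      using z by blast
    fix z' assume z': "\<forall>U (f :: 'm \<Rightarrow> real). open U \<and> p \<in> U \<and> smooth_fun \<A> U f \<longrightarrow> tderiv \<A> p z' f =
      tderiv \<A> p (X p) (\<lambda>q. tderiv \<A> q (Y q) f) - tderiv \<A> p (Y p) (\<lambda>q. tderiv \<A> q (X q) f)"
    have "z' - z = 0"
    proof (rule tderiv_eq_zero)
      fix U and f :: "'m \<Rightarrow> real" assume U: "open U" "p \<in> U" "smooth_fun \<A> U f"
      have "(f \<circ> cinv (chart_at \<A> p)) differentiable (at (cmap (chart_at \<A> p) p))"
        by (rule smooth_fun_differentiable[OF U(3) chart_at(1) U(2) chart_at(2)])
      from linear_diff[OF pd_linear[OF this]]
      have "tderiv \<A> p (z' - z) f = tderiv \<A> p z' f - tderiv \<A> p z f"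
        by (simp add: tderiv_def pd_def)
      then show "tderiv \<A> p (z' - z) f = 0" using z' z[OF U] U by simp
    qed
    then show "z' = z" by simp
  qed
  then show ?thesis using tcoord_coord_field[OF c W(3)] by (simp add: z_def b_def)
qed

lemma tderiv_const: "tderiv \<A> p x (\<lambda>q. k) = 0"
  by (simp add: tderiv_def comp_def)

end

section \<open>Christoffel symbols of an anisotropic connection\<close>

locale aniso_conn = smooth_manifold \<A>
  for \<A> :: "('m::{t2_space,second_countable_topology}, 'e::euclidean_space) chart set" +
  fixes A :: "('m \<times> 'e) set" and D :: "('m, 'e) aniso_conn"
  assumes conic: "conic_domain \<A> A" and conn: "aniso_connection \<A> A D"
begin

lemma
  assumes v: "v \<in> A"
  shows conn_add: "vector_field \<A> UNIV X \<Longrightarrow> vector_field \<A> UNIV Y \<Longrightarrow> vector_field \<A> UNIV Z \<Longrightarrow>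
        D v X (\<lambda>p. Y p + Z p) = D v X Y + D v X Z"
    and conn_leibniz: "vector_field \<A> UNIV X \<Longrightarrow> vector_field \<A> UNIV Y \<Longrightarrow> smooth_fun \<A> UNIV f \<Longrightarrow>
        D v X (\<lambda>p. f p *\<^sub>R Y p) = tderiv \<A> (fst v) (X (fst v)) f *\<^sub>R Y (fst v) + f (fst v) *\<^sub>R D v X Y"
    and conn_lincomb: "vector_field \<A> UNIV X \<Longrightarrow> vector_field \<A> UNIV Y \<Longrightarrow> vector_field \<A> UNIV Z \<Longrightarrow>
        smooth_fun \<A> UNIV f \<Longrightarrow> smooth_fun \<A> UNIV h \<Longrightarrow>
        D v (\<lambda>p. f p *\<^sub>R X p + h p *\<^sub>R Y p) Z = f (fst v) *\<^sub>R D v X Z + h (fst v) *\<^sub>R D v Y Z"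
  using conn v unfolding aniso_connection_def by blast+

lemma conn_smooth: "vector_field \<A> UNIV X \<Longrightarrow> vector_field \<A> UNIV Y \<Longrightarrow> aniso_field \<A> A (\<lambda>v. D v X Y)"
  using conn unfolding aniso_connection_def by blast

lemma conn_sum_right:
  assumes v: "v \<in> A" and X: "vector_field \<A> UNIV X" and Y: "\<And>i. i \<in> I \<Longrightarrow> vector_field \<A> UNIV (Y i)"
  shows "D v X (\<lambda>p. \<Sum>i\<in>I. Y i p) = (\<Sum>i\<in>I. D v X (Y i))"
proof -
  have 0: "D v X (\<lambda>p. 0) = 0"
    using conn_leibniz[OF v X vector_field_zero[OF open_UNIV] smooth_fun_const[of _ 0]]
    by (simp add: tderiv_const)
  show ?thesis
    using Y
    by (induction I rule: infinite_finite_induct)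
      (auto simp: 0 conn_add[OF v X] vector_field_sum)
qed

lemma conn_sum_left:
  assumes v: "v \<in> A" and Z: "vector_field \<A> UNIV Z" and X: "\<And>i. i \<in> I \<Longrightarrow> vector_field \<A> UNIV (X i)"
    and f: "\<And>i. i \<in> I \<Longrightarrow> smooth_fun \<A> UNIV (f i)"
  shows "D v (\<lambda>p. \<Sum>i\<in>I. f i p *\<^sub>R X i p) Z = (\<Sum>i\<in>I. f i (fst v) *\<^sub>R D v (X i) Z)"
proof -
  have z: "vector_field \<A> UNIV (\<lambda>p. 0)" by (rule vector_field_zero[OF open_UNIV])
  have 0: "D v (\<lambda>p. 0) Z = 0"
    using conn_lincomb[OF v z z Z smooth_fun_const[of _ 0] smooth_fun_const[of _ 0]] by simp
  show ?thesis
    using X f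
  proof (induction I rule: infinite_finite_induct)
    case (insert i I)
    have s: "vector_field \<A> UNIV (\<lambda>p. \<Sum>i\<in>I. f i p *\<^sub>R X i p)"
      using insert.prems by (intro vector_field_sum vector_field_scaleR) auto
    have "D v (\<lambda>p. f i p *\<^sub>R X i p + 1 *\<^sub>R (\<Sum>i\<in>I. f i p *\<^sub>R X i p)) Z
        = f i (fst v) *\<^sub>R D v (X i) Z + 1 *\<^sub>R D v (\<lambda>p. \<Sum>i\<in>I. f i p *\<^sub>R X i p) Z"
      using insert.prems by (intro conn_lincomb[OF v _ s Z _ smooth_fun_const]) auto
    then show ?case using insert by simp
  qed (auto simp: 0)
qed

definition frame :: "('m, 'e) chart \<Rightarrow> ('m \<Rightarrow> real) \<Rightarrow> 'e \<Rightarrow> 'm \<Rightarrow> 'e" where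
  "frame c \<beta> a q = \<beta> q *\<^sub>R coord_field \<A> c a q"

text \<open>
  The frame is made of the coordinate fields cut off by a bump function \<open>\<beta>\<close>, since \<open>D\<close> acts on global
  fields only; these are the Christoffel symbols of \<open>D\<close> only where \<open>\<beta> = 1\<close>.
\<close>

definition chr :: "('m, 'e) chart \<Rightarrow> ('m \<Rightarrow> real) \<Rightarrow> 'e \<times> 'e \<Rightarrow> 'e \<Rightarrow> 'e \<Rightarrow> 'e" where
  "chr c \<beta> z a b = (\<Sum>i\<in>Basis. \<Sum>j\<in>Basis. ((a \<bullet> i) * (b \<bullet> j)) *\<^sub>R
     tcoord \<A> c (fst (tchart_inv \<A> c z)) (D (tchart_inv \<A> c z) (frame c \<beta> i) (frame c \<beta> j)))"

lemma bilinear_chr: "bilinear (chr c \<beta> z)"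
  unfolding bilinear_def chr_def
  by (intro conjI allI linearI)
    (simp_all add: inner_add_left distrib_left distrib_right scaleR_left_distrib sum.distrib
      scaleR_sum_right mult.assoc mult.left_commute)

abbreviation dom_TM :: "('m, 'e) chart \<Rightarrow> ('e \<times> 'e) set" where
  "dom_TM c \<equiv> tchart \<A> c ` (A \<inter> (cdom c \<times> UNIV))"

lemma open_dom_TM: "c \<in> \<A> \<Longrightarrow> open (dom_TM c)"
  using conic by (simp add: conic_domain_def open_TM_def)

lemma vector_field_frame: "c \<in> \<A> \<Longrightarrow> is_bump (cdom c) N \<beta> \<Longrightarrow> vector_field \<A> UNIV (frame c \<beta> a)"
  unfolding frame_def[abs_def] by (rule bump_scaleR[OF open_cdom _ vector_field_coord_field])

lemma smooth_on_chr:
  assumes c: "c \<in> \<A>" and b: "is_bump (cdom c) N \<beta>"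
  shows "smooth_on (dom_TM c) (\<lambda>z. chr c \<beta> z a b)"
proof -
  have "smooth_on (dom_TM c) (\<lambda>z. tcoord \<A> c (fst (tchart_inv \<A> c z)) (D (tchart_inv \<A> c z) (frame c \<beta> i) (frame c \<beta> j)))" for i j
    using conn_smooth[OF vector_field_frame[OF c b] vector_field_frame[OF c b], of i j] c
    by (simp add: aniso_field_def comp_def)
  then show ?thesis
    unfolding chr_def by (intro smooth_on_sum smooth_on_scaleR smooth_on_const open_dom_TM[OF c])
qed

text \<open>
  \<open>\<beta>\<^sup>2 X\<close> is globally a combination of frame fields, with coefficients \<open>\<beta> X\<^sup>i\<close>, and has the germ of \<open>X\<close>
  wherever \<open>\<beta> = 1\<close>.
\<close>

lemma conn_local:
  assumes c: "c \<in> \<A>" and b: "is_bump (cdom c) N \<beta>" and v: "v \<in> A" "fst v \<in> N"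
    and X: "vector_field \<A> UNIV X" and Y: "vector_field \<A> UNIV Y"
  defines "x \<equiv> cmap c (fst v)"
  shows "tcoord \<A> c (fst v) (D v X Y) = pd (rep c X x) (rep c Y) x + chr c \<beta> (tchart \<A> c v) (rep c X x) (rep c Y x)"
proof -
  let ?q = "fst v"
  have q: "?q \<in> cdom c" using is_bumpD(5)[OF b] v by auto
  note \<beta> = is_bumpD[OF b]
  define coeff where "coeff X i p = \<beta> p * (tcoord \<A> c p (X p) \<bullet> i)" for X i p
  have raw: "smooth_fun \<A> (cdom c) (\<lambda>p. tcoord \<A> c p (X p) \<bullet> i)" if "vector_field \<A> UNIV X" for X i
  proof (rule smooth_fun_chartI[OF c open_cdom[OF c] subset_refl])
    have "smooth_on (cmap c ` cdom c) (rep c X)"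
      using that c by (auto simp: vector_field_rep)
    then have "smooth_on (cmap c ` cdom c) (\<lambda>x. rep c X x \<bullet> i)"
      by (rule smooth_on_inner_left[OF open_cran[OF c]])
    then show "smooth_on (cmap c ` cdom c) ((\<lambda>p. tcoord \<A> c p (X p) \<bullet> i) \<circ> cinv c)"
      by (simp add: rep_def o_def)
  qed
  have smooth_coeff: "smooth_fun \<A> UNIV (coeff X i)" if "vector_field \<A> UNIV X" for X i
    unfolding coeff_def by (rule bump_mult[OF open_cdom[OF c] b raw[OF that]])
  have expand: "(\<lambda>p. (\<beta> p * \<beta> p) *\<^sub>R X p) = (\<lambda>p. \<Sum>i\<in>Basis. coeff X i p *\<^sub>R frame c \<beta> i p)" for X
  proof
    fix p show "(\<beta> p * \<beta> p) *\<^sub>R X p = (\<Sum>i\<in>Basis. coeff X i p *\<^sub>R frame c \<beta> i p)"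
    proof (cases "p \<in> cdom c")
      case True
      have "X p = (\<Sum>i\<in>Basis. (tcoord \<A> c p (X p) \<bullet> i) *\<^sub>R coord_field \<A> c i p)"
        using linear_Basis_sum[OF coord_field_linear[OF c True], of "tcoord \<A> c p (X p)"]
        by (simp add: coord_field_tcoord[OF c True])
      then have "(\<beta> p * \<beta> p) *\<^sub>R X p = (\<beta> p * \<beta> p) *\<^sub>R (\<Sum>i\<in>Basis. (tcoord \<A> c p (X p) \<bullet> i) *\<^sub>R coord_field \<A> c i p)"
        by simp
      then show ?thesis
        by (simp add: coeff_def frame_def scaleR_sum_right mult_ac)
    qed (simp add: \<beta>(4) coeff_def)
  qed
  have \<beta>2: "smooth_fun \<A> UNIV (\<lambda>p. \<beta> p * \<beta> p)" by (rule smooth_fun_mult[OF open_UNIV \<beta>(1,1)])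
  have F: "vector_field \<A> UNIV (frame c \<beta> i)" for i by (rule vector_field_frame[OF c b])
  have rx: "rep c X x = tcoord \<A> c ?q (X ?q)" for X by (simp add: x_def rep_cmap[OF c q])
  have right: "D v X Y = (\<Sum>j\<in>Basis. tderiv \<A> ?q (X ?q) (coeff Y j) *\<^sub>R frame c \<beta> j ?q + coeff Y j ?q *\<^sub>R D v X (frame c \<beta> j))"
  proof -
    \<comment> \<open>As \<beta> is constantly \<open>1\<close> near the point, the Leibniz term
      produced by the factor \<open>\<beta> p * \<beta> p\<close> vanishes, and the factor can be
      inserted freely.\<close>
    have "tderiv \<A> ?q (X ?q) (\<lambda>p. \<beta> p * \<beta> p) = tderiv \<A> ?q (X ?q) (\<lambda>p. 1 :: real)"
      by (rule tderiv_cong[OF \<beta>(2) v(2)]) (simp add: \<beta>(3))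
    then have "D v X Y = D v X (\<lambda>p. (\<beta> p * \<beta> p) *\<^sub>R Y p)"
      using conn_leibniz[OF v(1) X Y \<beta>2] \<beta>(3)[OF v(2)] by (simp add: tderiv_const)
    also have "\<dots> = (\<Sum>j\<in>Basis. D v X (\<lambda>p. coeff Y j p *\<^sub>R frame c \<beta> j p))"
      unfolding expand by (rule conn_sum_right[OF v(1) X vector_field_scaleR[OF open_UNIV smooth_coeff[OF Y] F]])
    finally show ?thesis by (simp add: conn_leibniz[OF v(1) X F smooth_coeff[OF Y]])
  qed
  have left: "D v X Z = (\<Sum>i\<in>Basis. coeff X i ?q *\<^sub>R D v (frame c \<beta> i) Z)" if Z: "vector_field \<A> UNIV Z" for Z
  proof -
    have "D v X Z = D v (\<lambda>p. (\<beta> p * \<beta> p) *\<^sub>R X p + 0 *\<^sub>R X p) Z"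
      using conn_lincomb[OF v(1) X X Z \<beta>2 smooth_fun_const[of _ 0]] \<beta>(3)[OF v(2)] by simp
    also have "(\<lambda>p. (\<beta> p * \<beta> p) *\<^sub>R X p + 0 *\<^sub>R X p) = (\<lambda>p. (\<beta> p * \<beta> p) *\<^sub>R X p)" by simp
    finally show ?thesis unfolding expand by (simp add: conn_sum_left[OF v(1) Z F smooth_coeff[OF X]])
  qed
  have der: "tderiv \<A> ?q (X ?q) (coeff Y j) = pd (rep c X x) (rep c Y) x \<bullet> j" for j
  proof -
    have "tderiv \<A> ?q (X ?q) (coeff Y j) = tderiv \<A> ?q (X ?q) (\<lambda>p. tcoord \<A> c p (Y p) \<bullet> j)"
      by (rule tderiv_cong[OF \<beta>(2) v(2)]) (simp add: coeff_def \<beta>(3))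
    also have "\<dots> = pd (rep c X x) ((\<lambda>p. tcoord \<A> c p (Y p) \<bullet> j) \<circ> cinv c) x"
      unfolding x_def by (rule tderiv_rep[OF c raw[OF Y] q q])
    also have "\<dots> = pd (rep c X x) (\<lambda>x. rep c Y x \<bullet> j) x"
      by (simp add: rep_def[abs_def] o_def)
    also have "\<dots> = pd (rep c X x) (rep c Y) x \<bullet> j"
      by (rule pd_inner_left) (use rep_differentiable[OF Y c _ q] in \<open>simp add: x_def\<close>)
    finally show ?thesis .
  qed
  have c1: "coeff X i ?q = rep c X x \<bullet> i" for X i by (simp add: coeff_def \<beta>(3)[OF v(2)] rx)
  have f1: "tcoord \<A> c ?q (frame c \<beta> j ?q) = j" for j
    by (simp add: frame_def \<beta>(3)[OF v(2)] tcoord_coord_field[OF c q])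
  have "tcoord \<A> c ?q (D v X Y) = (\<Sum>j\<in>Basis. (pd (rep c X x) (rep c Y) x \<bullet> j) *\<^sub>R j
      + (rep c Y x \<bullet> j) *\<^sub>R (\<Sum>i\<in>Basis. (rep c X x \<bullet> i) *\<^sub>R tcoord \<A> c ?q (D v (frame c \<beta> i) (frame c \<beta> j))))"
    unfolding right by (simp add: tcoord_simps[OF c q] der c1 f1 left[OF F])
  also have "\<dots> = pd (rep c X x) (rep c Y) x + (\<Sum>j\<in>Basis. \<Sum>i\<in>Basis.
      ((rep c X x \<bullet> i) * (rep c Y x \<bullet> j)) *\<^sub>R tcoord \<A> c ?q (D v (frame c \<beta> i) (frame c \<beta> j)))"
    by (simp add: sum.distrib euclidean_representation scaleR_sum_right mult_ac)
  also have "(\<Sum>j\<in>Basis. \<Sum>i\<in>Basis.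
      ((rep c X x \<bullet> i) * (rep c Y x \<bullet> j)) *\<^sub>R tcoord \<A> c ?q (D v (frame c \<beta> i) (frame c \<beta> j)))
      = chr c \<beta> (tchart \<A> c v) (rep c X x) (rep c Y x)"
    unfolding chr_def tchart_inv_tchart[OF c q] by (rule sum.swap)
  finally show ?thesis .
qed

text \<open>The right-hand side of \<open>conn_local\<close> involves only values and first
  derivatives of components at the point, which are the same for all fields with a given germ. So
  the choice made by \<open>germ_ext\<close> leaves no trace.\<close>

lemma conn_loc_local:
  assumes c: "c \<in> \<A>" and b: "is_bump (cdom c) N \<beta>" and v: "v \<in> A" "fst v \<in> N"
    and W: "open W" "fst v \<in> W" and X: "vector_field \<A> W X" and Y: "vector_field \<A> W Y"
  defines "x \<equiv> cmap c (fst v)"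
  shows "tcoord \<A> c (fst v) (conn_loc \<A> D v X Y)
    = pd (rep c X x) (rep c Y) x + chr c \<beta> (tchart \<A> c v) (rep c X x) (rep c Y x)"
proof -
  let ?X = "germ_ext \<A> (fst v) X" and ?Y = "germ_ext \<A> (fst v) Y"
  have q: "fst v \<in> cdom c" using is_bumpD(5)[OF b] v by auto
  obtain M where M: "open M" "fst v \<in> M" "\<forall>q\<in>M. ?X q = X q" using germ_ext(2)[OF W X] by auto
  obtain M' where M': "open M'" "fst v \<in> M'" "\<forall>q\<in>M'. ?Y q = Y q" using germ_ext(2)[OF W Y] by auto
  have "rep c ?X x = rep c X x" "rep c ?Y x = rep c Y x"
    using M M' by (simp_all add: x_def rep_cmap[OF c q])
  moreover have "pd u (rep c ?Y) x = pd u (rep c Y) x" for u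
    by (rule pd_cong[OF open_chart_part[OF c M'(1)]])
      (use M' q in \<open>auto simp: x_def rep_cmap[OF c]\<close>)
  ultimately show ?thesis
    using conn_local[OF c b v germ_ext(1)[OF W X] germ_ext(1)[OF W Y]]
    unfolding conn_loc_def x_def by simp
qed

lemma chart_bump:
  obtains N \<beta> where "is_bump (cdom (chart_at \<A> p)) N \<beta>" "p \<in> N"
  using bump_exists[OF open_cdom[OF chart_at(1)] chart_at(2)] .

end

section \<open>Homogeneity and the vertical derivative of the Christoffel symbols\<close>

lemma pd_linear_on: "smooth_on S f \<Longrightarrow> x \<in> S \<Longrightarrow> linear (\<lambda>u. pd u f x)"
  by (rule pd_linear[OF smooth_on_differentiable])

lemma line_derivative_0:
  "f differentiable (at y) \<Longrightarrow> ((\<lambda>s. f (y + s *\<^sub>R u)) has_vector_derivative pd u f y) (at 0)"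
  using line_derivative[of f y 0 u] by simp

text \<open>Differentiating Euler's identity in the direction \<open>h\<close> also hits the moving
  direction \<open>(0, snd z)\<close>, whence the correction term. For vertical \<open>h\<close> the
  degree of homogeneity drops by one; for \<open>h = (a, 0)\<close> it is preserved.\<close>

lemma euler_pd:
  fixes F :: "'e::euclidean_space \<times> 'e \<Rightarrow> real"
  assumes S: "open S" and F: "smooth_on S F"
    and eu: "\<And>z. z \<in> S \<Longrightarrow> pd (0, snd z) F z = k * F z" and z: "z \<in> S"
  shows "pd (0, snd z) (pd h F) z = k * pd h F z - pd (0, snd h) F z"
proof -
  have s: "((\<lambda>z. (0 :: 'e, snd z :: 'e)) has_derivative (\<lambda>u. (0, snd u))) (at z)"
    by (intro bounded_linear_imp_has_derivative bounded_linear_Pair bounded_linear_zero bounded_linear_snd)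
  have "pd h (\<lambda>z. pd (0, snd z) F z) z = pd h (pd (0, snd z) F) z + pd (0, snd h) F z"
    using pd_eq[OF pd_along_derivative[OF S z F differentiableI[OF s]], of h] pd_eq[OF s, of h] by simp
  moreover have "pd h (\<lambda>z. pd (0, snd z) F z) z = pd h (\<lambda>z. k * F z) z"
    by (rule pd_cong[OF S z eu])
  moreover have "pd h (\<lambda>z. k * F z) z = k * pd h F z"
    by (rule pd_eq[OF has_derivative_mult_right[OF pd_has_derivative]]) (rule smooth_on_differentiable[OF F z])
  ultimately show ?thesis using pd_commute[OF S z F, of "(0, snd z)" h] by simp
qed

text \<open>
  The spray \<open>G\<^sub>z(y, y)\<close> is determined by \<open>L\<close> alone; differentiating this formula in a vertical
  direction gives twice the nonlinear connection \<open>G\<^sub>z(u, y)\<close>, which leaves nothing for the vertical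
  derivative of \<open>G\<close> itself. The tensor \<open>q\<close> is twice the nonmetricity.
\<close>

lemma vertical_derivative_spray:
  fixes L :: "'e::euclidean_space \<times> 'e \<Rightarrow> real" and G :: "'e \<times> 'e \<Rightarrow> 'e \<Rightarrow> 'e \<Rightarrow> 'e"
  assumes S: "open S" and L: "smooth_on S L" and z0: "z0 \<in> S"
    and eu: "\<And>z. z \<in> S \<Longrightarrow> pd (0, snd z) L z = 2 * L z"
    and bil: "\<And>z. bilinear (G z)" and G: "\<And>a b. smooth_on S (\<lambda>z. G z a b)"
    and sym: "\<And>z a b. z \<in> S \<Longrightarrow> fst z = fst z0 \<Longrightarrow> G z a b = G z b a"
    and metric: "\<And>z a b c. z \<in> S \<Longrightarrow> fst z = fst z0 \<Longrightarrow>
      pd (a, - G z a (snd z)) (pd (0, b) (pd (0, c) L)) z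
        = pd (0, G z a b) (pd (0, c) L) z + pd (0, b) (pd (0, G z a c) L) z + q z a b c"
    and q: "\<And>z a b. z \<in> S \<Longrightarrow> fst z = fst z0 \<Longrightarrow> q z (snd z) a b = 0 \<and> q z a (snd z) b = 0"
    and nondeg: "\<And>u. (\<And>w. pd (0, u) (pd (0, w) L) z0 = 0) \<Longrightarrow> u = 0"
  shows "pd (0, u) (\<lambda>z. G z (snd z0) (snd z0)) z0 = 0"
proof -
  define l where "l c = pd (0, c) L" for c
  have l: "smooth_on S (l c)" for c unfolding l_def by (rule smooth_on_pd[OF L])
  have e1: "pd (0, snd z) (l c) z = l c z" if "z \<in> S" for z c
    using euler_pd[OF S L eu that, of "(0, c)"] by (simp add: l_def)
  have lin0: "linear (\<lambda>u. pd u (l c) z)" if "z \<in> S" for z c by (rule pd_linear_on[OF l that])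
  have split: "pd (a, b) F z = pd (a, 0) F z + pd (0, b) F z" and neg: "pd (0, - b) F z = - pd (0, b) F z"
    if "z \<in> S" "smooth_on S F" for a b z and F :: "'e \<times> 'e \<Rightarrow> real"
    using linear_add[OF pd_linear_on[OF that(2,1)], of "(a, 0)" "(0, b)"]
      linear_neg[OF pd_linear_on[OF that(2,1)], of "(0, b)"] by simp_all
  have lsym: "pd (0, a) (l b) z = pd (0, b) (l a) z" if "z \<in> S" for a b z
    unfolding l_def by (rule pd_commute[OF S that L])
  define N where "N z a = G z a (snd z)" for z a
  define GG where "GG z = G z (snd z) (snd z)" for z
  \<comment> \<open>This is the metric equation with the reference vector \<open>snd z\<close> in
    one slot. By Euler's identity the Hessian contracted with that vector turns into a first
    derivative, and the vertical part of the horizontal lift drops out.\<close>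
  have M1: "pd (a, 0) (l c) z = pd (0, N z a) (l c) z + l (G z a c) z"
    if z: "z \<in> S" "fst z = fst z0" for z a c
  proof -
    have "pd (a, - N z a) (pd (0, snd z) (l c)) z = pd (0, snd z) (pd (a, - N z a) (l c)) z"
      by (rule pd_commute[OF S z(1) l])
    also have "\<dots> = pd (a, - N z a) (l c) z - pd (0, - N z a) (l c) z"
      using euler_pd[OF S l[of c] _ z(1), where k = 1 and h = "(a, - N z a)"] e1 by simp
    also have "\<dots> = pd (a, 0) (l c) z" using split[OF z(1) l, of a "- N z a" c] by simp
    finally show ?thesis
      using metric[OF z, of a "snd z" c] q[OF z] e1[OF z(1)] by (simp add: N_def l_def[symmetric])
  qed
  \<comment> \<open>Putting the reference vector into the remaining slot as well shows that
    \<open>L\<close> has zero derivative along horizontal lifts.\<close>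
  have M2: "pd (a, 0) L z = l (N z a) z" if z: "z \<in> S" "fst z = fst z0" for z a
  proof -
    have "pd (a, 0) (l (snd z)) z = pd (0, snd z) (pd (a, 0) L) z"
      unfolding l_def by (rule pd_commute[OF S z(1) L])
    also have "\<dots> = 2 * pd (a, 0) L z"
      using euler_pd[OF S L eu z(1), of "(a, 0)"] linear_0[OF pd_linear_on[OF L z(1)]]
      by (simp add: zero_prod_def)
    finally have "2 * pd (a, 0) L z = pd (0, N z a) (l (snd z)) z + l (G z a (snd z)) z"
      using M1[OF z, of a "snd z"] by simp
    then show ?thesis using lsym[OF z(1), of "N z a" "snd z"] e1[OF z(1)] by (simp add: N_def)
  qed
  \<comment> \<open>By symmetry of \<open>G\<close> the first-order terms of \<open>M1\<close> and
    \<open>M2\<close> agree; their difference is the Euler-Lagrange formula for the spray, with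
    right-hand side built from \<open>L\<close> only.\<close>
  have M3: "pd (0, GG z) (l c) z = pd (snd z, 0) (l c) z - pd (c, 0) L z"
    if z: "z \<in> S" "fst z = fst z0" for z c
    using M1[OF z, of "snd z" c] M2[OF z, of c] sym[OF z, of "snd z" c] by (simp add: N_def GG_def)
  let ?y = "snd z0" and ?P = "pd (0, u) (\<lambda>z. G z (snd z0) (snd z0)) z0"
  have snd': "((snd :: 'e \<times> 'e \<Rightarrow> 'e) has_derivative snd) (at z0)"
    by (rule bounded_linear_imp_has_derivative[OF bounded_linear_snd])
  have id: "pd v (\<lambda>z. z) z0 = v" for v :: "'e \<times> 'e" by (simp add: pd_def)
  have GG': "(GG has_derivative (\<lambda>v. pd v (\<lambda>z. G z ?y ?y) z0 + G z0 (snd v) ?y + G z0 ?y (snd v))) (at z0)"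
    using bilinear_slot_derivative[OF S, of "\<lambda>z. z" z0 G snd snd] z0 bil
      smooth_on_differentiable[OF G z0] differentiableI[OF snd'] pd_eq[OF snd']
    by (simp add: GG_def[abs_def] id)
  have "pd (0, u) GG z0 = ?P + 2 *\<^sub>R N z0 u"
    using pd_eq[OF GG', of "(0, u)"] sym[OF z0 refl, of ?y u] by (simp add: N_def scaleR_2)
  moreover have "pd (0, ?P) (l c) z0 = 0" for c
  proof -
    have pair: "((\<lambda>z. (0, GG z)) has_derivative (\<lambda>v. (0, pd v GG z0))) (at z0)"
      by (intro has_derivative_Pair has_derivative_const pd_has_derivative differentiableI[OF GG'])
    have pair2: "((\<lambda>z. (snd z, 0 :: 'e)) has_derivative (\<lambda>v. (snd v, 0))) (at z0)"
      by (intro has_derivative_Pair has_derivative_const snd')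
    have lhs: "((\<lambda>z. pd (0, GG z) (l c) z) has_derivative
        (\<lambda>v. pd v (pd (0, GG z0) (l c)) z0 + pd (0, pd v GG z0) (l c) z0)) (at z0)"
      using pd_along_derivative[OF S z0 l[of c] differentiableI[OF pair]] by (simp add: pd_eq[OF pair])
    have rhs: "((\<lambda>z. pd (snd z, 0) (l c) z - pd (c, 0) L z) has_derivative
        (\<lambda>v. pd v (pd (?y, 0) (l c)) z0 + pd (snd v, 0) (l c) z0 - pd v (pd (c, 0) L) z0)) (at z0)"
      using has_derivative_diff[OF pd_along_derivative[OF S z0 l[of c] differentiableI[OF pair2]]
          pd_has_derivative[OF smooth_on_differentiable[OF smooth_on_pd[OF L] z0]], of "(c, 0)"]
      by (simp add: pd_eq[OF pair2])
    \<comment> \<open>\<open>M3\<close> is available only on the fibre of \<open>z0\<close>, so it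
      is differentiated along a vertical line in this fibre instead of as an identity on an open
      set.\<close>
    let ?line = "\<lambda>t. z0 + t *\<^sub>R (0, u)"
    have "continuous_on UNIV ?line" by (intro continuous_intros)
    then have "open (?line -` S)" by (rule open_vimage[OF S])
    have l1: "((\<lambda>t. pd (0, GG (?line t)) (l c) (?line t)) has_vector_derivative
        pd (0, u) (\<lambda>z. pd (0, GG z) (l c) z) z0) (at 0)"
      by (rule line_derivative_0[OF differentiableI[OF lhs]])
    have l2: "((\<lambda>t. pd (snd (?line t), 0) (l c) (?line t) - pd (c, 0) L (?line t)) has_vector_derivative
        pd (0, u) (\<lambda>z. pd (snd z, 0) (l c) z - pd (c, 0) L z) z0) (at 0)"
      by (rule line_derivative_0[OF differentiableI[OF rhs]])
    have M3': "pd (0, GG (?line t)) (l c) (?line t) = pd (snd (?line t), 0) (l c) (?line t) - pd (c, 0) L (?line t)"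
      if "?line t \<in> S" for t
      by (rule M3[OF that]) simp
    have "((\<lambda>t. pd (0, GG (?line t)) (l c) (?line t)) has_vector_derivative
        pd (0, u) (\<lambda>z. pd (snd z, 0) (l c) z - pd (c, 0) L z) z0) (at 0)"
      by (rule has_vector_derivative_transform_within_open[OF l2 \<open>open (?line -` S)\<close>])
        (simp_all only: vimage_eq M3' scaleR_zero_left add_0_right z0)
    from vector_derivative_unique_at[OF l1 this]
    have main: "pd (0, u) (pd (0, GG z0) (l c)) z0 + pd (0, pd (0, u) GG z0) (l c) z0
      = pd (0, u) (pd (?y, 0) (l c)) z0 + pd (u, 0) (l c) z0 - pd (0, u) (pd (c, 0) L) z0"
      using pd_eq[OF lhs, of "(0, u)"] pd_eq[OF rhs, of "(0, u)"] by simp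
    \<comment> \<open>The two second derivatives of \<open>l c\<close> combine into a derivative
      along the horizontal lift of \<open>?y\<close>, to which the metric equation applies once
      more.\<close>
    have "pd (0, u) (pd (?y, 0) (l c)) z0 - pd (0, u) (pd (0, GG z0) (l c)) z0
        = pd (?y, - GG z0) (pd (0, u) (l c)) z0"
      using split[OF z0 smooth_on_pd[OF l], of ?y "- GG z0" "(0, u)" c]
        neg[OF z0 smooth_on_pd[OF l], of "GG z0" "(0, u)" c]
        pd_commute[OF S z0 l, of "(0, u)" "(?y, 0)" c] pd_commute[OF S z0 l, of "(0, u)" "(0, GG z0)" c]
      by simp
    also have "\<dots> = pd (0, N z0 u) (l c) z0 + pd (0, u) (l (N z0 c)) z0"
      using metric[OF z0 refl, of ?y u c] q[OF z0 refl, of u c] sym[OF z0 refl, of ?y u] sym[OF z0 refl, of ?y c]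
      by (simp add: N_def GG_def l_def[symmetric])
    finally have "pd (0, pd (0, u) GG z0) (l c) z0
        = pd (0, N z0 u) (l c) z0 + pd (0, u) (l (N z0 c)) z0 + pd (u, 0) (l c) z0 - pd (0, u) (pd (c, 0) L) z0"
      using main by simp
    also have "pd (0, u) (pd (c, 0) L) z0 = pd (c, 0) (l u) z0"
      unfolding l_def by (rule pd_commute[OF S z0 L])
    \<comment> \<open>\<open>M1\<close> with arguments \<open>u, c\<close> and with
      \<open>c, u\<close> eliminates the two mixed derivatives. The terms with
      \<open>G z0 u c\<close> cancel because \<open>G\<close> is symmetric, those with
      \<open>N z0 c\<close> because the vertical Hessian is.\<close>
    finally have "pd (0, pd (0, u) GG z0) (l c) z0 = 2 * pd (0, N z0 u) (l c) z0"
      using M1[OF z0 refl, of u c] M1[OF z0 refl, of c u] lsym[OF z0, of u "N z0 c"]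
        sym[OF z0 refl, of u c] by simp
    moreover have "pd (0, ?P + 2 *\<^sub>R N z0 u) (l c) z0 = pd (0, ?P) (l c) z0 + 2 * pd (0, N z0 u) (l c) z0"
      using linear_add[OF lin0[OF z0], of "(0, ?P)" "(0, 2 *\<^sub>R N z0 u)" c]
        linear_cmul[OF lin0[OF z0], of 2 "(0, N z0 u)" c] by simp
    ultimately show ?thesis using \<open>pd (0, u) GG z0 = ?P + 2 *\<^sub>R N z0 u\<close> by simp
  qed
  ultimately show ?thesis using nondeg[of ?P] by (simp add: l_def)
qed

section \<open>Covariant derivatives in a chart\<close>

context aniso_conn
begin

lemma rep_frame:
  assumes "c \<in> \<A>" "is_bump (cdom c) N \<beta>" "p \<in> N"
  shows "rep c (frame c \<beta> a) (cmap c p) = a" and "pd u (rep c (frame c \<beta> a)) (cmap c p) = 0"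
proof -
  note \<beta> = is_bumpD[OF assms(2)]
  have eq: "rep c (frame c \<beta> a) x = a" if "x \<in> cmap c ` N" for x
    using that \<beta>(3,5) assms(1) by (auto simp: rep_cmap frame_def tcoord_coord_field)
  show "rep c (frame c \<beta> a) (cmap c p) = a" using eq assms(3) by blast
  have "pd u (rep c (frame c \<beta> a)) (cmap c p) = pd u (\<lambda>x. a) (cmap c p)"
    by (rule pd_cong[OF open_cmap_image[OF assms(1) \<beta>(2,5)]]) (use assms(3) eq in auto)
  then show "pd u (rep c (frame c \<beta> a)) (cmap c p) = 0" by (simp add: pd_def)
qed

lemma chr_frame:
  assumes c: "c \<in> \<A>" and b: "is_bump (cdom c) N \<beta>" and v: "v \<in> A" "fst v \<in> N"
  shows "tcoord \<A> c (fst v) (D v (frame c \<beta> a) (frame c \<beta> b')) = chr c \<beta> (tchart \<A> c v) a b'"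
  using conn_local[OF c b v vector_field_frame[OF c b] vector_field_frame[OF c b], of a b']
  by (simp add: rep_frame[OF c b v(2)])

text \<open>The frame fields have constant components where \<beta> is \<open>1\<close>, so their
  bracket vanishes at the base point and zero torsion becomes symmetry of the symbols.\<close>

lemma chr_symmetric:
  assumes tf: "aniso_torsion_free \<A> A D"
    and c: "c \<in> \<A>" and b: "is_bump (cdom c) N \<beta>" and v: "v \<in> A" "fst v \<in> N"
  shows "chr c \<beta> (tchart \<A> c v) a b' = chr c \<beta> (tchart \<A> c v) b' a"
proof -
  have q: "fst v \<in> cdom c" using is_bumpD(5)[OF b] v by auto
  note F = vector_field_frame[OF c b]
  have "tcoord \<A> c (fst v) (lie_bracket \<A> (frame c \<beta> a) (frame c \<beta> b') (fst v)) = 0"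
    using lie_bracket_rep[OF c open_UNIV _ q F F] rep_frame[OF c b v(2)] by simp
  moreover have "D v (frame c \<beta> a) (frame c \<beta> b') - D v (frame c \<beta> b') (frame c \<beta> a)
      = lie_bracket \<A> (frame c \<beta> a) (frame c \<beta> b') (fst v)"
    using tf v F unfolding aniso_torsion_free_def by blast
  ultimately have "tcoord \<A> c (fst v) (D v (frame c \<beta> a) (frame c \<beta> b') - D v (frame c \<beta> b') (frame c \<beta> a)) = 0"
    by simp
  then show ?thesis by (simp add: tcoord_simps[OF c q] chr_frame[OF c b v])
qed

lemma tchart_in_dom: "fst v \<in> cdom c \<Longrightarrow> v \<in> A \<Longrightarrow> tchart \<A> c v \<in> dom_TM c"
  by (cases v) auto

text \<open>The field with constant components in the preferred chart extends \<open>v\<close> and,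
  by openness of \<open>A\<close>, remains in \<open>A\<close> near the base point. So the choice in
  \<open>adm_ext\<close> has a witness.\<close>

lemma adm_ext:
  assumes v: "v \<in> A"
  obtains U where "fst v \<in> U" "admissible \<A> A U (adm_ext \<A> A v)" "adm_ext \<A> A v (fst v) = snd v"
proof -
  let ?c = "chart_at \<A> (fst v)"
  note c = chart_at(1)[of "fst v"] and p = chart_at(2)[of "fst v"]
  define S where "S = (\<lambda>x. (x, snd v)) -` dom_TM ?c"
  have S: "open S" unfolding S_def by (intro open_vimage[OF open_dom_TM[OF c]] continuous_intros)
  define U where "U = {q \<in> cdom ?c. cmap ?c q \<in> S}"
  have "U = cdom ?c \<inter> cmap ?c -` S" by (auto simp: U_def)
  then have U: "open U"
    using continuous_open_preimage[OF homeomorphism_cont1[OF chart_homeo[OF c]] open_cdom[OF c] S] by simp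
  let ?V = "coord_field \<A> ?c (snd v)"
  have Vp: "?V (fst v) = snd v" using coord_field_tcoord[OF c p, of "snd v"] by (simp add: tcoord_chart_at)
  have mem: "(q, ?V q) \<in> A \<longleftrightarrow> q \<in> U" if "q \<in> cdom ?c" for q
    using in_tchart_image[OF c that, of "snd v" A] that by (simp add: U_def S_def)
  have "admissible \<A> A U ?V"
    unfolding admissible_def
    using U mem vector_field_subset[OF vector_field_coord_field[OF c], of U "snd v"]
    by (auto simp: U_def)
  moreover have "fst v \<in> U" using mem[OF p] Vp v by simp
  ultimately have "\<exists>V U. fst v \<in> U \<and> admissible \<A> A U V \<and> V (fst v) = snd v" using Vp by blast
  then have "\<exists>U. fst v \<in> U \<and> admissible \<A> A U (adm_ext \<A> A v) \<and> adm_ext \<A> A v (fst v) = snd v"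
    unfolding adm_ext_def by (rule someI_ex)
  then show ?thesis using that by blast
qed

lemma rep_graph:
  assumes c: "c \<in> \<A>" and U: "admissible \<A> A U V" and q: "q \<in> U" "q \<in> cdom c"
  shows "tchart \<A> c (q, V q) = (cmap c q, rep c V (cmap c q))" "(cmap c q, rep c V (cmap c q)) \<in> dom_TM c"
proof -
  show *: "tchart \<A> c (q, V q) = (cmap c q, rep c V (cmap c q))"
    by (simp add: tchart_def rep_cmap[OF c q(2)])
  show "(cmap c q, rep c V (cmap c q)) \<in> dom_TM c"
    using tchart_in_dom[of "(q, V q)" c] U q unfolding * admissible_def by simp
qed

lemma graph_has_derivative:
  assumes c: "c \<in> \<A>" and U: "vector_field \<A> U V" and q: "q \<in> U" "q \<in> cdom c"
  shows "((\<lambda>x. (x, rep c V x)) has_derivative (\<lambda>u. (u, pd u (rep c V) (cmap c q)))) (at (cmap c q))"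
  by (intro has_derivative_Pair has_derivative_ident pd_has_derivative rep_differentiable[OF U c q])

lemma along_has_derivative:
  fixes H :: "'e \<times> 'e \<Rightarrow> 'b::real_normed_vector"
  assumes c: "c \<in> \<A>" and U: "admissible \<A> A U V" and q: "q \<in> U" "q \<in> cdom c"
    and H: "H differentiable (at (tchart \<A> c (q, V q)))"
    and f: "\<And>p. p \<in> U \<Longrightarrow> p \<in> cdom c \<Longrightarrow> f (cmap c p) = H (tchart \<A> c (p, V p))"
  shows "(f has_derivative (\<lambda>u. pd (u, pd u (rep c V) (cmap c q)) H (tchart \<A> c (q, V q)))) (at (cmap c q))"
proof -
  have V: "vector_field \<A> U V" "open U" using U by (auto simp: admissible_def)
  have "((\<lambda>x. H (x, rep c V x)) has_derivative
      (\<lambda>u. pd (u, pd u (rep c V) (cmap c q)) H (tchart \<A> c (q, V q)))) (at (cmap c q))"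
    using diff_chain_at[OF graph_has_derivative[OF c V(1) q], of H] pd_has_derivative[OF H]
    by (simp add: rep_graph(1)[OF c U q] o_def)
  then show ?thesis
    by (rule has_derivative_transform_within_open[OF _ open_chart_part[OF c V(2)]])
      (use q f rep_graph(1)[OF c U] in auto)
qed

lemma vert_line:
  assumes "c \<in> \<A>" "fst v \<in> cdom c"
  shows "tchart_inv \<A> c (tchart \<A> c v + t *\<^sub>R (0, tcoord \<A> c (fst v) w)) = (fst v, snd v + t *\<^sub>R w)"
  using tchart_inv_tchart[OF assms(1), of "(fst v, snd v + t *\<^sub>R w)"] assms
  by (simp add: tchart_def tcoord_simps)

lemma vert_has_derivative:
  assumes c: "c \<in> \<A>" and v: "fst v \<in> cdom c"
    and H: "(h \<circ> tchart_inv \<A> c) differentiable (at (tchart \<A> c v))"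
  shows "((\<lambda>t. h (fst v, snd v + t *\<^sub>R w)) has_vector_derivative
    pd (0, tcoord \<A> c (fst v) w) (h \<circ> tchart_inv \<A> c) (tchart \<A> c v)) (at 0)"
  using line_derivative_0[OF H, of "(0, tcoord \<A> c (fst v) w)"]
  by (simp only: o_def vert_line[OF c v])

lemma pd_Pair_diff:
  assumes "H differentiable (at z)"
  shows "pd (a, b) H z - pd (0, b + g) H z = pd (a, - g) H z"
  using linear_diff[OF pd_linear[OF assms], of "(a, b)" "(0, b + g)"] by simp

lemma conn_loc_in_chart:
  assumes c: "c \<in> \<A>" and b: "is_bump (cdom c) N \<beta>" and v: "v \<in> A" "fst v \<in> N"
    and U: "admissible \<A> A U V" "fst v \<in> U" "V (fst v) = snd v" and X: "vector_field \<A> W X" "open W" "fst v \<in> W"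
  defines "x \<equiv> cmap c (fst v)"
  shows "tcoord \<A> c (fst v) (conn_loc \<A> D v X V) = pd (rep c X x) (rep c V) x
    + chr c \<beta> (tchart \<A> c v) (rep c X x) (snd (tchart \<A> c v))"
proof -
  have q: "fst v \<in> cdom c" using is_bumpD(5)[OF b] v by auto
  have "vector_field \<A> (W \<inter> U) X" "vector_field \<A> (W \<inter> U) V" "open (W \<inter> U)" "fst v \<in> W \<inter> U"
    using U X by (auto simp: admissible_def intro: vector_field_subset)
  from conn_loc_local[OF c b v this(3,4,1,2)]
  show ?thesis using U(3) by (simp add: x_def rep_cmap[OF c q, of V] tchart_def)
qed

text \<open>
  Both sides are the derivative of \<open>h\<close> along the horizontal lift of \<open>X\<close>, which no longer refers to \<open>V\<close>.
\<close>

lemma horizontal_derivative: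
  assumes c: "c \<in> \<A>" and b: "is_bump (cdom c) N \<beta>" and v: "v \<in> A" "fst v \<in> N"
    and U: "admissible \<A> A U V" "fst v \<in> U" "V (fst v) = snd v" and X: "vector_field \<A> W X" "open W" "fst v \<in> W"
    and H: "(h \<circ> tchart_inv \<A> c) differentiable (at (tchart \<A> c v))"
  defines "z \<equiv> tchart \<A> c v" and "a \<equiv> rep c X (cmap c (fst v))"
  shows "tderiv \<A> (fst v) (X (fst v)) (along h V) - vert_deriv h v (conn_loc \<A> D v X V)
    = pd (a, - chr c \<beta> z a (snd z)) (h \<circ> tchart_inv \<A> c) z"
proof -
  have q: "fst v \<in> cdom c" using is_bumpD(5)[OF b] v by auto
  have v': "v = (fst v, V (fst v))" using U(3) by simp
  have H': "(h \<circ> tchart_inv \<A> c) differentiable (at (tchart \<A> c (fst v, V (fst v))))" using H v' by simp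
  have d: "(along h V \<circ> cinv c has_derivative
      (\<lambda>u. pd (u, pd u (rep c V) (cmap c (fst v))) (h \<circ> tchart_inv \<A> c) z)) (at (cmap c (fst v)))"
    using along_has_derivative[OF c U(1,2) q H', of "along h V \<circ> cinv c"] v'
    by (simp add: along_def cinv_cmap[OF c] tchart_inv_tchart[OF c] z_def o_def)
  have 1: "tderiv \<A> (fst v) (X (fst v)) (along h V)
      = pd (a, pd a (rep c V) (cmap c (fst v))) (h \<circ> tchart_inv \<A> c) z"
    using tderiv_chart[OF c q differentiableI[OF d], of "X (fst v)"] pd_eq[OF d]
    by (simp add: a_def rep_cmap[OF c q])
  have 2: "vert_deriv h v (conn_loc \<A> D v X V)
      = pd (0, pd a (rep c V) (cmap c (fst v)) + chr c \<beta> z a (snd z)) (h \<circ> tchart_inv \<A> c) z"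
    unfolding vert_deriv_def
    using vector_derivative_at[OF vert_has_derivative[OF c q H, of "conn_loc \<A> D v X V"]]
    by (simp add: conn_loc_in_chart[OF c b v U X] z_def a_def)
  show ?thesis unfolding 1 2 by (rule pd_Pair_diff) (use H in \<open>simp add: z_def\<close>)
qed

text \<open>By \<open>horizontal_derivative\<close> the expression formed with any admissible
  extension equals one without an extension. Hence the extension selected by \<open>adm_ext\<close>
  may be exchanged for a given field \<open>V\<close>.\<close>

lemma conn_fun_eq:
  assumes v: "v \<in> A"
    and U: "admissible \<A> A U V" "fst v \<in> U" "V (fst v) = snd v" and X: "vector_field \<A> UNIV X"
    and H: "(h \<circ> tchart_inv \<A> (chart_at \<A> (fst v))) differentiable (at (tchart \<A> (chart_at \<A> (fst v)) v))"
  shows "conn_fun \<A> A D v X h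
    = tderiv \<A> (fst v) (X (fst v)) (along h V) - vert_deriv h v (conn_loc \<A> D v X V)"
proof -
  obtain N \<beta> where b: "is_bump (cdom (chart_at \<A> (fst v))) N \<beta>" "fst v \<in> N" by (rule chart_bump)
  obtain U' where U': "fst v \<in> U'" "admissible \<A> A U' (adm_ext \<A> A v)" "adm_ext \<A> A v (fst v) = snd v"
    using adm_ext[OF v] .
  show ?thesis
    using horizontal_derivative[OF chart_at(1) b(1) v b(2) U X open_UNIV _ H]
      horizontal_derivative[OF chart_at(1) b(1) v b(2) U'(2,1,3) X open_UNIV _ H]
    by (simp add: conn_fun_def Let_def)
qed

section \<open>Anisotropic vector fields and their covariant derivatives in a chart\<close>

definition tfield_rep :: "('m, 'e) chart \<Rightarrow> ('m \<times> 'e \<Rightarrow> 'e) \<Rightarrow> 'e \<times> 'e \<Rightarrow> 'e" where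
  "tfield_rep c Y z = tcoord \<A> c (fst (tchart_inv \<A> c z)) (Y (tchart_inv \<A> c z))"

lemma smooth_tfield_rep: "aniso_field \<A> A Y \<Longrightarrow> c \<in> \<A> \<Longrightarrow> smooth_on (dom_TM c) (tfield_rep c Y)"
  by (simp add: aniso_field_def tfield_rep_def[abs_def] comp_def)

lemma tfield_rep_tchart: "c \<in> \<A> \<Longrightarrow> fst v \<in> cdom c \<Longrightarrow> tfield_rep c Y (tchart \<A> c v) = tcoord \<A> c (fst v) (Y v)"
  by (simp add: tfield_rep_def tchart_inv_tchart)

lemma vector_field_along:
  assumes Y: "aniso_field \<A> A Y" and U: "admissible \<A> A U V"
  shows "vector_field \<A> U (along Y V)"
  unfolding vector_field_rep
proof
  fix c assume c: "c \<in> \<A>"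
  let ?S = "cmap c ` (U \<inter> cdom c)"
  have V: "vector_field \<A> U V" "open U" using U by (auto simp: admissible_def)
  have S: "open ?S" by (rule open_chart_part[OF c V(2)])
  have g: "smooth_on ?S (\<lambda>x. (x, rep c V x))"
    using V c by (intro smooth_on_Pair[OF S smooth_on_ident]) (auto simp: vector_field_rep)
  have graph: "tfield_rep c Y (cmap c q, rep c V (cmap c q)) = rep c (along Y V) (cmap c q)"
    if "q \<in> U" "q \<in> cdom c" for q
    using tfield_rep_tchart[OF c, of "(q, V q)" Y] rep_graph(1)[OF c U that] that(2)
    by (simp add: rep_cmap[OF c] along_def)
  show "smooth_on ?S (rep c (along Y V))"
    by (rule smooth_on_cong[OF S _ smooth_on_compose[OF S smooth_tfield_rep[OF Y c] g]])
      (use rep_graph(2)[OF c U] graph in auto)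
qed

text \<open>The vector-valued counterpart of \<open>horizontal_derivative\<close>: again the
  derivative of the extension cancels between the derivative along \<open>V\<close> and the vertical
  correction. One Christoffel term remains, since the values are themselves tangent vectors.\<close>

lemma conn_field_local:
  assumes c: "c \<in> \<A>" and b: "is_bump (cdom c) N \<beta>" and v: "v \<in> A" "fst v \<in> N"
    and X: "vector_field \<A> UNIV X" and Y: "aniso_field \<A> A Y"
  defines "z \<equiv> tchart \<A> c v" and "a \<equiv> rep c X (cmap c (fst v))"
  shows "tcoord \<A> c (fst v) (conn_field \<A> A D v X Y)
    = pd (a, - chr c \<beta> z a (snd z)) (tfield_rep c Y) z + chr c \<beta> z a (tfield_rep c Y z)"
proof -
  have q: "fst v \<in> cdom c" using is_bumpD(5)[OF b] v by auto
  obtain U where U: "fst v \<in> U" "admissible \<A> A U (adm_ext \<A> A v)" "adm_ext \<A> A v (fst v) = snd v"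
    using adm_ext[OF v(1)] .
  let ?V = "adm_ext \<A> A v" and ?x = "cmap c (fst v)"
  have v': "v = (fst v, ?V (fst v))" using U(3) by simp
  have zin: "z \<in> dom_TM c" unfolding z_def by (rule tchart_in_dom[OF q v(1)])
  have H: "tfield_rep c Y differentiable (at z)"
    by (rule smooth_on_differentiable[OF smooth_tfield_rep[OF Y c] zin])
  have Uo: "open U" using U by (simp add: admissible_def)
  have d: "(rep c (along Y ?V) has_derivative (\<lambda>u. pd (u, pd u (rep c ?V) ?x) (tfield_rep c Y) z)) (at ?x)"
    using along_has_derivative[OF c U(2,1) q, of "tfield_rep c Y" "rep c (along Y ?V)"] H v'
      tfield_rep_tchart[OF c, of "(_, ?V _)" Y]
    by (simp add: rep_cmap[OF c] along_def z_def)
  have 1: "tcoord \<A> c (fst v) (conn_loc \<A> D v X (along Y ?V))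
      = pd (a, pd a (rep c ?V) ?x) (tfield_rep c Y) z + chr c \<beta> z a (tfield_rep c Y z)"
    using conn_loc_local[OF c b v Uo U(1) vector_field_subset[OF X subset_UNIV] vector_field_along[OF Y U(2)]]
      v' tfield_rep_tchart[OF c q, of Y]
    by (simp add: pd_eq[OF d] a_def z_def[symmetric] rep_cmap[OF c q] along_def)
  have 2: "tcoord \<A> c (fst v) (vert_deriv Y v w) = pd (0, tcoord \<A> c (fst v) w) (tfield_rep c Y) z" for w
  proof -
    have "((\<lambda>t. tfield_rep c Y (z + t *\<^sub>R (0, tcoord \<A> c (fst v) w))) has_vector_derivative
        pd (0, tcoord \<A> c (fst v) w) (tfield_rep c Y) z) (at 0)"
      by (rule line_derivative_0[OF H])
    \<comment> \<open>The line stays in one fibre, so \<open>coord_field\<close> acts by a fixed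
      linear map, which carries the derivative of the components to the derivative of the tangent
      vectors.\<close>
    from bounded_linear.has_vector_derivative[OF linear_conv_bounded_linear[THEN iffD1, OF coord_field_linear[OF c q]] this]
    have "((\<lambda>t. Y (fst v, snd v + t *\<^sub>R w)) has_vector_derivative
        coord_field \<A> c (pd (0, tcoord \<A> c (fst v) w) (tfield_rep c Y) z) (fst v)) (at 0)"
      by (simp only: tfield_rep_def z_def vert_line[OF c q] fst_conv coord_field_tcoord[OF c q])
    then show ?thesis
      unfolding vert_deriv_def by (simp add: vector_derivative_at tcoord_coord_field[OF c q])
  qed
  have 3: "tcoord \<A> c (fst v) (conn_loc \<A> D v X ?V) = pd a (rep c ?V) ?x + chr c \<beta> z a (snd z)"
    unfolding a_def z_def by (rule conn_loc_in_chart[OF c b v U(2,1,3) X open_UNIV UNIV_I])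
  show ?thesis
    unfolding conn_field_def Let_def
    using pd_Pair_diff[OF H, of a "pd a (rep c ?V) ?x" "chr c \<beta> z a (snd z)"]
    by (simp add: tcoord_simps[OF c q] 1 2 3)
qed

end

section \<open>Iterated derivatives along lines as partial derivatives\<close>

lemma deriv_line:
  fixes f :: "'a::real_normed_vector \<Rightarrow> real"
  assumes "f differentiable (at z)"
  shows "deriv (\<lambda>s. f (z + s *\<^sub>R u)) 0 = pd u f z"
  using line_derivative_0[OF assms, of u]
  by (intro DERIV_imp_deriv) (simp add: has_real_derivative_iff_has_vector_derivative)

lemma eventually_line:
  fixes z :: "'a::real_normed_vector"
  assumes "open S" "z \<in> S"
  shows "\<forall>\<^sub>F t in nhds 0. z + t *\<^sub>R u \<in> S"
proof -
  have "open ((\<lambda>t. z + t *\<^sub>R u) -` S)"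
    by (intro open_vimage[OF assms(1)] continuous_intros)
  then show ?thesis using assms(2) by (intro eventually_nhds[THEN iffD2] exI[of _ "(\<lambda>t. z + t *\<^sub>R u) -` S"]) auto
qed

text \<open>The inner derivative can be evaluated only while \<open>z + t u\<close> stays in the
  open set. That holds for all \<open>t\<close> near \<open>0\<close>, and the outer derivative at
  \<open>0\<close> depends on this germ alone.\<close>

lemma deriv_line2:
  fixes f :: "'a::real_normed_vector \<Rightarrow> real"
  assumes S: "open S" "z \<in> S" and f: "smooth_on S f"
  shows "deriv (\<lambda>t. deriv (\<lambda>s. f (z + t *\<^sub>R u + s *\<^sub>R w)) 0) 0 = pd u (pd w f) z"
proof -
  have "\<forall>\<^sub>F t in nhds 0. deriv (\<lambda>s. f (z + t *\<^sub>R u + s *\<^sub>R w)) 0 = pd w f (z + t *\<^sub>R u)"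
    using eventually_line[OF S] by eventually_elim (rule deriv_line[OF smooth_on_differentiable[OF f]])
  then have "deriv (\<lambda>t. deriv (\<lambda>s. f (z + t *\<^sub>R u + s *\<^sub>R w)) 0) 0 = deriv (\<lambda>t. pd w f (z + t *\<^sub>R u)) 0"
    by (intro deriv_cong_ev) auto
  then show ?thesis using deriv_line[OF smooth_on_differentiable[OF smooth_on_pd[OF f] S(2)]] by simp
qed

lemma deriv_line3:
  fixes f :: "'a::real_normed_vector \<Rightarrow> real"
  assumes S: "open S" "z \<in> S" and f: "smooth_on S f"
  shows "deriv (\<lambda>s3. deriv (\<lambda>s2. deriv (\<lambda>s1. f (z + s1 *\<^sub>R w1 + s2 *\<^sub>R w2 + s3 *\<^sub>R w3)) 0) 0) 0
    = pd w3 (pd w2 (pd w1 f)) z"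
proof -
  have *: "z + s1 *\<^sub>R w1 + s2 *\<^sub>R w2 + s3 *\<^sub>R w3 = (z + s3 *\<^sub>R w3) + s2 *\<^sub>R w2 + s1 *\<^sub>R w1" for s1 s2 s3
    by simp
  have "\<forall>\<^sub>F t in nhds 0. deriv (\<lambda>s2. deriv (\<lambda>s1. f ((z + t *\<^sub>R w3) + s2 *\<^sub>R w2 + s1 *\<^sub>R w1)) 0) 0
      = pd w2 (pd w1 f) (z + t *\<^sub>R w3)"
    using eventually_line[OF S] by eventually_elim (rule deriv_line2[OF S(1) _ f])
  then have "deriv (\<lambda>t. deriv (\<lambda>s2. deriv (\<lambda>s1. f ((z + t *\<^sub>R w3) + s2 *\<^sub>R w2 + s1 *\<^sub>R w1)) 0) 0) 0
      = deriv (\<lambda>t. pd w2 (pd w1 f) (z + t *\<^sub>R w3)) 0"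
    by (intro deriv_cong_ev) auto
  then show ?thesis
    unfolding * using deriv_line[OF smooth_on_differentiable[OF smooth_on_pd[OF smooth_on_pd[OF f]] S(2)]] by simp
qed

section \<open>Locality of affine and anisotropic connections\<close>

context smooth_manifold
begin

text \<open>The difference of two fields that agree on \<open>M\<close> equals
  \<open>1 - \<beta>\<close> times itself for a bump function \<beta> inside \<open>M\<close>. At
  \<open>p\<close> the factor vanishes, and in the differentiated slot the Leibniz term vanishes
  with the difference of the fields.\<close>

lemma affine_local:
  assumes D: "affine_connection \<A> \<Omega> D" and \<Omega>: "open \<Omega>" "p \<in> \<Omega>" and M: "open M" "p \<in> M"
    and X: "vector_field \<A> \<Omega> X" "vector_field \<A> \<Omega> X'" "\<And>q. q \<in> M \<Longrightarrow> X q = X' q"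
    and Y: "vector_field \<A> \<Omega> Y" "vector_field \<A> \<Omega> Y'" "\<And>q. q \<in> M \<Longrightarrow> Y q = Y' q"
  shows "D X Y p = D X' Y' p"
proof -
  obtain N \<beta> where b: "is_bump M N \<beta>" "p \<in> N" using bump_exists[OF M] .
  note \<beta> = is_bumpD[OF b(1)]
  let ?f = "\<lambda>q. 1 - \<beta> q"
  have f: "smooth_fun \<A> \<Omega> ?f"
    by (intro smooth_fun_diff[OF \<Omega>(1)] smooth_fun_const smooth_fun_subset[OF \<beta>(1)]) simp
  have DX: "vector_field \<A> \<Omega> (\<lambda>q. X q - X' q)" by (rule vector_field_diff[OF \<Omega>(1) X(1,2)])
  have DY: "vector_field \<A> \<Omega> (\<lambda>q. Y q - Y' q)" by (rule vector_field_diff[OF \<Omega>(1) Y(1,2)])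
  have eqX: "X = (\<lambda>q. 1 *\<^sub>R X' q + ?f q *\<^sub>R (X q - X' q))"
  proof
    fix q show "X q = 1 *\<^sub>R X' q + ?f q *\<^sub>R (X q - X' q)" using X(3)[of q] \<beta>(4)[of q] by (cases "q \<in> M") auto
  qed
  have eqY: "Y = (\<lambda>q. Y' q + ?f q *\<^sub>R (Y q - Y' q))"
  proof
    fix q show "Y q = Y' q + ?f q *\<^sub>R (Y q - Y' q)" using Y(3)[of q] \<beta>(4)[of q] by (cases "q \<in> M") auto
  qed
  have "D X Y p = D (\<lambda>q. 1 *\<^sub>R X' q + ?f q *\<^sub>R (X q - X' q)) Y p" using eqX by simp
  also have "\<dots> = 1 *\<^sub>R D X' Y p + ?f p *\<^sub>R D (\<lambda>q. X q - X' q) Y p"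
    using D X(2) DX Y(1) f smooth_fun_const[of \<Omega> 1] \<Omega>(2) unfolding affine_connection_def by blast
  also have "\<dots> = D X' Y p" using \<beta>(3)[OF b(2)] by simp
  also have "D X' Y p = D X' (\<lambda>q. Y' q + ?f q *\<^sub>R (Y q - Y' q)) p" using eqY by simp
  also have "\<dots> = D X' Y' p + D X' (\<lambda>q. ?f q *\<^sub>R (Y q - Y' q)) p"
    using D X(2) Y(2) vector_field_scaleR[OF \<Omega>(1) f DY] \<Omega>(2) unfolding affine_connection_def by blast
  also have "D X' (\<lambda>q. ?f q *\<^sub>R (Y q - Y' q)) p
      = tderiv \<A> p (X' p) ?f *\<^sub>R (Y p - Y' p) + ?f p *\<^sub>R D X' (\<lambda>q. Y q - Y' q) p"
    using D X(2) DY f \<Omega>(2) unfolding affine_connection_def by blast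
  also have "\<dots> = 0" using \<beta>(3)[OF b(2)] Y(3)[OF M(2)] by simp
  finally show ?thesis by simp
qed

lemma affine_zero:
  assumes D: "affine_connection \<A> \<Omega> D" and \<Omega>: "open \<Omega>" "p \<in> \<Omega>" and X: "vector_field \<A> \<Omega> X"
  shows "D X (\<lambda>q. 0) p = 0"
proof -
  have "D X (\<lambda>q. 0 *\<^sub>R 0) p = tderiv \<A> p (X p) (\<lambda>q. 0 :: real) *\<^sub>R 0 + 0 *\<^sub>R D X (\<lambda>q. 0) p"
    using D X vector_field_zero[OF \<Omega>(1)] smooth_fun_const[of \<Omega> 0] \<Omega>(2) unfolding affine_connection_def by blast
  then show ?thesis by simp
qed

end

context aniso_conn
begin

lemma conn_loc_cong:
  assumes v: "v \<in> A" and W: "open W" "fst v \<in> W" "vector_field \<A> W X" "vector_field \<A> W Y"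
    and W': "open W'" "fst v \<in> W'" "vector_field \<A> W' X'" "vector_field \<A> W' Y'"
    and M: "open M" "fst v \<in> M" "\<And>q. q \<in> M \<Longrightarrow> X q = X' q" "\<And>q. q \<in> M \<Longrightarrow> Y q = Y' q"
  shows "conn_loc \<A> D v X Y = conn_loc \<A> D v X' Y'"
proof -
  let ?c = "chart_at \<A> (fst v)"
  note c = chart_at(1)[of "fst v"] and q = chart_at(2)[of "fst v"]
  obtain N \<beta> where b: "is_bump (cdom ?c) N \<beta>" "fst v \<in> N" by (rule chart_bump)
  have "pd u (rep ?c Y) (cmap ?c (fst v)) = pd u (rep ?c Y') (cmap ?c (fst v))" for u
    by (rule pd_cong[OF open_chart_part[OF c M(1)]]) (use M q in \<open>auto simp: rep_cmap[OF c]\<close>)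
  moreover have "rep ?c X (cmap ?c (fst v)) = rep ?c X' (cmap ?c (fst v))"
    "rep ?c Y (cmap ?c (fst v)) = rep ?c Y' (cmap ?c (fst v))"
    using M by (simp_all add: rep_cmap[OF c q])
  ultimately have "tcoord \<A> ?c (fst v) (conn_loc \<A> D v X Y) = tcoord \<A> ?c (fst v) (conn_loc \<A> D v X' Y')"
    using conn_loc_local[OF c b(1) v b(2) W] conn_loc_local[OF c b(1) v b(2) W'] by simp
  then show ?thesis by (simp add: tcoord_chart_at)
qed

end

section \<open>Pseudo-Finsler metrics\<close>

text \<open>The tensor \<open>Q\<close> is a parameter of the locale, so that the same facts can be
  instantiated with \<open>Q = 0\<close> for the Levi-Civita--Chern connection.\<close>

locale finsler_conn = aniso_conn \<A> A D
  for \<A> :: "('m::{t2_space,second_countable_topology}, 'e::euclidean_space) chart set"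
    and A :: "('m \<times> 'e) set" and D :: "('m, 'e) aniso_conn" +
  fixes L :: "'m \<times> 'e \<Rightarrow> real" and Q :: "'m \<times> 'e \<Rightarrow> 'e \<Rightarrow> 'e \<Rightarrow> 'e \<Rightarrow> real"
  assumes finsler: "pseudo_finsler \<A> A L"
    and symQ: "symmetric3 A Q" and Q0: "\<forall>(p, v)\<in>A. \<forall>u w. Q (p, v) v u w = 0"
    and torsion: "aniso_torsion_free \<A> A D" and metric: "has_metric_derivative \<A> A L D Q"
begin

abbreviation Lr :: "('m, 'e) chart \<Rightarrow> 'e \<times> 'e \<Rightarrow> real" where
  "Lr c \<equiv> L \<circ> tchart_inv \<A> c"

lemma smooth_Lr: "c \<in> \<A> \<Longrightarrow> smooth_on (dom_TM c) (Lr c)"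
  using finsler by (simp add: pseudo_finsler_def smooth_fun_TM_def)

lemma L_line:
  assumes "c \<in> \<A>" "fst v \<in> cdom c"
  shows "L (fst v, snd v + w) = Lr c (tchart \<A> c v + (0, tcoord \<A> c (fst v) w))"
  using vert_line[OF assms, of 1 w] by simp

text \<open>An induced chart is linear on each fibre: lines in the fibre are lines in the chart, and
  the iterated derivatives defining the tensor become vertical partial derivatives.\<close>

lemma fund_tensor_chart:
  assumes c: "c \<in> \<A>" and v: "v \<in> A" "fst v \<in> cdom c"
  shows "fund_tensor L v u w
    = 1 / 2 * pd (0, tcoord \<A> c (fst v) u) (pd (0, tcoord \<A> c (fst v) w) (Lr c)) (tchart \<A> c v)"
proof -
  have *: "L (fst v, snd v + t *\<^sub>R u + s *\<^sub>R w) = Lr c (tchart \<A> c v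
      + t *\<^sub>R (0, tcoord \<A> c (fst v) u) + s *\<^sub>R (0, tcoord \<A> c (fst v) w))" for s t
    using L_line[OF c v(2), of "t *\<^sub>R u + s *\<^sub>R w"] by (simp add: tcoord_simps[OF c v(2)] add.assoc)
  show ?thesis
    unfolding fund_tensor_def * deriv_line2[OF open_dom_TM[OF c] tchart_in_dom[OF v(2,1)] smooth_Lr[OF c]] ..
qed

lemma cartan_tensor_chart:
  assumes c: "c \<in> \<A>" and v: "v \<in> A" "fst v \<in> cdom c"
  shows "cartan_tensor L v w1 w2 w3 = 1 / 4 * pd (0, tcoord \<A> c (fst v) w3)
    (pd (0, tcoord \<A> c (fst v) w2) (pd (0, tcoord \<A> c (fst v) w1) (Lr c))) (tchart \<A> c v)"
proof -
  have *: "L (fst v, snd v + s1 *\<^sub>R w1 + s2 *\<^sub>R w2 + s3 *\<^sub>R w3) = Lr c (tchart \<A> c v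
      + s1 *\<^sub>R (0, tcoord \<A> c (fst v) w1) + s2 *\<^sub>R (0, tcoord \<A> c (fst v) w2) + s3 *\<^sub>R (0, tcoord \<A> c (fst v) w3))"
    for s1 s2 s3
    using L_line[OF c v(2), of "s1 *\<^sub>R w1 + s2 *\<^sub>R w2 + s3 *\<^sub>R w3"]
    by (simp add: tcoord_simps[OF c v(2)] add.assoc)
  show ?thesis
    unfolding cartan_tensor_def * deriv_line3[OF open_dom_TM[OF c] tchart_in_dom[OF v(2,1)] smooth_Lr[OF c]] ..
qed

text \<open>Differentiates the homogeneity of \<open>L\<close> at the factor \<open>1\<close>.
  Homogeneity for positive factors gives the identity for \<open>1 + t\<close> with
  \<open>t > -1\<close>, which is a neighbourhood of \<open>0\<close>.\<close>

lemma euler_Lr: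
  assumes c: "c \<in> \<A>" and z: "z \<in> dom_TM c"
  shows "pd (0, snd z) (Lr c) z = 2 * Lr c z"
proof -
  obtain v where v: "v \<in> A" "fst v \<in> cdom c" "z = tchart \<A> c v" using z by auto
  have s: "snd z = tcoord \<A> c (fst v) (snd v)" by (simp add: v(3) tchart_def)
  have Lz: "Lr c z = L v" using v(3) tchart_inv_tchart[OF c v(2)] by simp
  have l: "((\<lambda>t. Lr c (z + t *\<^sub>R (0, snd z))) has_vector_derivative pd (0, snd z) (Lr c) z) (at 0)"
    by (rule line_derivative_0[OF smooth_on_differentiable[OF smooth_Lr[OF c] z]])
  have hom: "\<forall>(p, x)\<in>A. \<forall>l>0. L (p, l *\<^sub>R x) = l\<^sup>2 * L (p, x)"
    using finsler by (simp add: pseudo_finsler_def)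
  have sq: "Lr c (z + t *\<^sub>R (0, snd z)) = (1 + t)\<^sup>2 * L v" if "t > -1" for t
  proof -
    have "Lr c (z + t *\<^sub>R (0, snd z)) = L (fst v, (1 + t) *\<^sub>R snd v)"
      unfolding s unfolding v(3) o_def vert_line[OF c v(2)] by (simp add: scaleR_left_distrib)
    also have "\<dots> = (1 + t)\<^sup>2 * L (fst v, snd v)"
      using hom v(1) that by (cases v) force
    finally show ?thesis by simp
  qed
  have "((\<lambda>t. (1 + t)\<^sup>2 * L v) has_vector_derivative 2 * L v) (at 0)"
    unfolding has_real_derivative_iff_has_vector_derivative[symmetric]
    by (auto intro!: derivative_eq_intros)
  then have "((\<lambda>t. Lr c (z + t *\<^sub>R (0, snd z))) has_vector_derivative 2 * L v) (at 0)"
    by (rule has_vector_derivative_transform_within_open[where S = "{-1<..}"]) (simp_all add: sq del: o_apply scaleR_Pair)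
  from vector_derivative_unique_at[OF l this] show ?thesis using Lz by simp
qed

lemma pd_Lr_linear:
  "c \<in> \<A> \<Longrightarrow> z \<in> dom_TM c \<Longrightarrow> linear (\<lambda>a. pd (0, a) (pd (0, b) (Lr c)) z)"
  using linear_compose[OF _ pd_linear_on[OF smooth_on_pd[OF smooth_Lr]], of "\<lambda>a. (0, a)" c z "(0, b)"]
  by (simp add: o_def linear_iff)

lemma fund_tensor_sym: "v \<in> A \<Longrightarrow> fund_tensor L v u w = fund_tensor L v w u"
  unfolding fund_tensor_chart[OF chart_at(1) _ chart_at(2)]
  by (subst pd_commute[OF open_dom_TM[OF chart_at(1)] tchart_in_dom[OF chart_at(2)] smooth_Lr[OF chart_at(1)]])
    simp_all

lemma linear_fund_tensor: "v \<in> A \<Longrightarrow> linear (\<lambda>u. fund_tensor L v u w)"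
  "v \<in> A \<Longrightarrow> linear (\<lambda>u. fund_tensor L v w u)"
proof -
  assume v: "v \<in> A"
  show 1: "linear (\<lambda>u. fund_tensor L v u w)"
    using linear_compose_scale_right[OF pd_Lr_linear[OF chart_at(1) tchart_in_dom[OF chart_at(2) v], of w], of "1/2"]
    by (simp add: fund_tensor_chart[OF chart_at(1) v chart_at(2)] tcoord_chart_at)
  then show "linear (\<lambda>u. fund_tensor L v w u)" using fund_tensor_sym[OF v] by simp
qed

lemma cartan_tensor_sym:
  assumes v: "v \<in> A"
  shows "cartan_tensor L v a b c = cartan_tensor L v b a c"
    and "cartan_tensor L v a b c = cartan_tensor L v a c b"
proof -
  let ?c = "chart_at \<A> (fst v)"
  note c = chart_at(1)[of "fst v"]
  note O = open_dom_TM[OF c] and z = tchart_in_dom[OF chart_at(2) v] and s = smooth_Lr[OF c]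
  show "cartan_tensor L v a b c = cartan_tensor L v a c b"
    using pd_commute[OF O z smooth_on_pd[OF s]]
    by (simp add: cartan_tensor_chart[OF c v chart_at(2)] tcoord_chart_at)
  have "pd (0, c) (pd (0, b) (pd (0, a) (Lr ?c))) (tchart \<A> ?c v) = pd (0, c) (pd (0, a) (pd (0, b) (Lr ?c))) (tchart \<A> ?c v)"
    by (rule pd_cong[OF O z]) (rule pd_commute[OF O _ s])
  then show "cartan_tensor L v a b c = cartan_tensor L v b a c"
    by (simp add: cartan_tensor_chart[OF c v chart_at(2)] tcoord_chart_at)
qed

text \<open>The vertical Hessian of \<open>L\<close> is homogeneous of degree \<open>0\<close>, so
  its derivative in the direction of the reference vector vanishes; total symmetry moves that vector
  to the other slots.\<close>

lemma cartan_tensor_self: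
  assumes v: "v \<in> A"
  shows "cartan_tensor L v (snd v) a b = 0" "cartan_tensor L v a (snd v) b = 0" "cartan_tensor L v a b (snd v) = 0"
proof -
  let ?c = "chart_at \<A> (fst v)" and ?z = "tchart \<A> (chart_at \<A> (fst v)) v"
  note c = chart_at(1)[of "fst v"]
  note O = open_dom_TM[OF c] and z = tchart_in_dom[OF chart_at(2) v] and s = smooth_Lr[OF c]
  have 1: "pd (0, snd z) (pd (0, a) (Lr ?c)) z = 1 * pd (0, a) (Lr ?c) z" if "z \<in> dom_TM ?c" for z
    using euler_pd[OF O s euler_Lr[OF c] that, of "(0, a)"] by simp
  have "pd (0, snd ?z) (pd (0, b) (pd (0, a) (Lr ?c))) ?z = 0"
    using euler_pd[OF O smooth_on_pd[OF s] 1 z, of "(0, b)"] by simp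
  moreover have "snd ?z = snd v" by (simp add: tchart_def tcoord_chart_at)
  ultimately show 3: "cartan_tensor L v a b (snd v) = 0"
    by (simp add: cartan_tensor_chart[OF c v chart_at(2)] tcoord_chart_at)
  show "cartan_tensor L v a (snd v) b = 0" "cartan_tensor L v (snd v) a b = 0"
    using 3 cartan_tensor_sym[OF v] by metis+
qed

lemma cartan_tensor_zero: "v \<in> A \<Longrightarrow> cartan_tensor L v a b 0 = 0"
proof -
  assume v: "v \<in> A"
  note c = chart_at(1)[of "fst v"]
  have "pd (0, 0) (pd (0, b) (pd (0, a) (Lr (chart_at \<A> (fst v))))) (tchart \<A> (chart_at \<A> (fst v)) v) = 0"
    using linear_0[OF pd_linear_on[OF smooth_on_pd[OF smooth_on_pd[OF smooth_Lr[OF c]]] tchart_in_dom[OF chart_at(2) v]]]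
    by (simp add: zero_prod_def)
  then show ?thesis
    by (simp add: cartan_tensor_chart[OF c v chart_at(2)] tcoord_chart_at)
qed

lemma nondegenerate: "v \<in> A \<Longrightarrow> (\<And>w. fund_tensor L v u w = 0) \<Longrightarrow> u = 0"
  using finsler by (simp add: pseudo_finsler_def)

text \<open>The fields \<open>Y\<close> and \<open>Z\<close> depend on the base point only, so their
  derivatives enter through \<open>fst u\<close>. For a vertical \<open>u\<close> just the third
  derivative of \<open>L\<close> survives.\<close>

lemma fund_tensor_fields_derivative:
  assumes c: "c \<in> \<A>" and v: "v \<in> A" "fst v \<in> cdom c"
    and Y: "vector_field \<A> UNIV Y" and Z: "vector_field \<A> UNIV Z"
  defines "x \<equiv> cmap c (fst v)" and "z \<equiv> tchart \<A> c v"
  shows "((\<lambda>w. fund_tensor L w (Y (fst w)) (Z (fst w))) \<circ> tchart_inv \<A> c has_derivative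
    (\<lambda>u. 1 / 2 * pd u (pd (0, rep c Y x) (pd (0, rep c Z x) (Lr c))) z
       + 1 / 2 * pd (0, pd (fst u) (rep c Y) x) (pd (0, rep c Z x) (Lr c)) z
       + 1 / 2 * pd (0, rep c Y x) (pd (0, pd (fst u) (rep c Z) x) (Lr c)) z)) (at z)"
proof -
  note O = open_dom_TM[OF c] and zin = tchart_in_dom[OF v(2,1)] and s = smooth_Lr[OF c]
  have fz: "fst z = x" by (simp add: z_def x_def tchart_def)
  have rf: "((\<lambda>z. rep c Y (fst z)) has_derivative (\<lambda>u. pd (fst u) (rep c Y) x)) (at z)"
    if "vector_field \<A> UNIV Y" for Y
  proof -
    have "rep c Y differentiable (at (fst z))"
      unfolding fz x_def by (rule rep_differentiable[OF that c _ v(2)]) simp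
    from diff_chain_at[OF bounded_linear_imp_has_derivative[OF bounded_linear_fst] pd_has_derivative[OF this]]
    show ?thesis by (simp add: o_def fz)
  qed
  define G where "G z a b = 1 / 2 * pd (0, a) (pd (0, b) (Lr c)) z" for z a b
  have bil: "bilinear (G z)" if "z \<in> dom_TM c" for z
  proof -
    have "linear (\<lambda>a. G z a b)" for b
      using linear_compose_scale_right[OF pd_Lr_linear[OF c that, of b], of "1/2"] by (simp add: G_def)
    moreover have "G z a b = G z b a" for a b using pd_commute[OF O that s] by (simp add: G_def)
    ultimately show ?thesis by (simp add: bilinear_def)
  qed
  have Gd: "(\<lambda>z. G z a b) differentiable (at z)"
    and Gpd: "pd u (\<lambda>z. G z a b) z = 1 / 2 * pd u (pd (0, a) (pd (0, b) (Lr c))) z" for a b u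
  proof -
    have "((\<lambda>z. G z a b) has_derivative (\<lambda>u. 1 / 2 * pd u (pd (0, a) (pd (0, b) (Lr c))) z)) (at z)"
      unfolding G_def
      by (intro has_derivative_mult_right pd_has_derivative smooth_on_differentiable[OF smooth_on_pd[OF smooth_on_pd[OF s]]])
        (use zin in \<open>simp add: z_def\<close>)
    from differentiableI[OF this] pd_eq[OF this, of u]
    show "(\<lambda>z. G z a b) differentiable (at z)"
      "pd u (\<lambda>z. G z a b) z = 1 / 2 * pd u (pd (0, a) (pd (0, b) (Lr c))) z" .
  qed
  have id: "pd u (\<lambda>z. z) z = u" for u by (simp add: pd_def)
  have "((\<lambda>z. G z (rep c Y (fst z)) (rep c Z (fst z))) has_derivative
      (\<lambda>u. pd u (\<lambda>w. G w (rep c Y x) (rep c Z x)) z + G z (pd (fst u) (rep c Y) x) (rep c Z x)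
        + G z (rep c Y x) (pd (fst u) (rep c Z) x))) (at z)"
    using bilinear_slot_derivative[OF O, of "\<lambda>z. z" z G "\<lambda>z. rep c Y (fst z)" "\<lambda>z. rep c Z (fst z)"]
      zin bil Gd differentiableI[OF rf[OF Y]] differentiableI[OF rf[OF Z]]
    by (simp add: pd_eq[OF rf[OF Y]] pd_eq[OF rf[OF Z]] fz id z_def[symmetric])
  then have "((\<lambda>z. G z (rep c Y (fst z)) (rep c Z (fst z))) has_derivative
      (\<lambda>u. 1 / 2 * pd u (pd (0, rep c Y x) (pd (0, rep c Z x) (Lr c))) z
       + 1 / 2 * pd (0, pd (fst u) (rep c Y) x) (pd (0, rep c Z x) (Lr c)) z
       + 1 / 2 * pd (0, rep c Y x) (pd (0, pd (fst u) (rep c Z) x) (Lr c)) z)) (at z)"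
    unfolding Gpd by (simp add: G_def)
  then show ?thesis
  proof (rule has_derivative_transform_within_open[OF _ O])
    show "z \<in> dom_TM c" using zin by (simp add: z_def)
    fix w assume "w \<in> dom_TM c"
    then obtain v' where v': "v' \<in> A" "fst v' \<in> cdom c" "w = tchart \<A> c v'" by auto
    have "fst w = cmap c (fst v')" by (simp add: v'(3) tchart_def)
    then show "G w (rep c Y (fst w)) (rep c Z (fst w))
        = ((\<lambda>w. fund_tensor L w (Y (fst w)) (Z (fst w))) \<circ> tchart_inv \<A> c) w"
      using fund_tensor_chart[OF c v'(1,2)] tchart_inv_tchart[OF c v'(2)]
      by (simp add: G_def v'(3) rep_cmap[OF c v'(2)])
  qed
qed

text \<open>The factor \<open>2\<close> reflects the normalizations: the metric is half a second
  derivative and the Cartan tensor a quarter of a third one, so the vertical derivative of the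
  metric is twice the Cartan tensor. The vertical correction inside \<open>conn_tensor2\<close>,
  moved to the other side, is the Cartan term.\<close>

lemma metric_along:
  assumes U: "admissible \<A> A U V" "p \<in> U"
    and X: "vector_field \<A> UNIV X" and Y: "vector_field \<A> UNIV Y" and Z: "vector_field \<A> UNIV Z"
  defines "v \<equiv> (p, V p)"
  shows "tderiv \<A> p (X p) (\<lambda>q. fund_tensor L (q, V q) (Y q) (Z q))
    = fund_tensor L v (D v X Y) (Z p) + fund_tensor L v (Y p) (D v X Z)
      + 2 * cartan_tensor L v (conn_loc \<A> D v X V) (Y p) (Z p) + Q v (X p) (Y p) (Z p)"
proof -
  let ?c = "chart_at \<A> p" and ?h = "\<lambda>w. fund_tensor L w (Y (fst w)) (Z (fst w))"
  have v: "v \<in> A" "fst v = p" "V (fst v) = snd v" using U by (auto simp: admissible_def v_def)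
  note c = chart_at(1)[of p] and q = chart_at(2)[of p]
  have der: "((?h \<circ> tchart_inv \<A> ?c) has_derivative
      (\<lambda>u. 1 / 2 * pd u (pd (0, rep ?c Y (cmap ?c p)) (pd (0, rep ?c Z (cmap ?c p)) (Lr ?c))) (tchart \<A> ?c v)
       + 1 / 2 * pd (0, pd (fst u) (rep ?c Y) (cmap ?c p)) (pd (0, rep ?c Z (cmap ?c p)) (Lr ?c)) (tchart \<A> ?c v)
       + 1 / 2 * pd (0, rep ?c Y (cmap ?c p)) (pd (0, pd (fst u) (rep ?c Z) (cmap ?c p)) (Lr ?c)) (tchart \<A> ?c v)))
      (at (tchart \<A> ?c v))"
    using fund_tensor_fields_derivative[OF c v(1) _ Y Z] q v(2) by simp
  have z: "tchart \<A> ?c v \<in> dom_TM ?c" using tchart_in_dom[of v ?c] v q by simp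
  have pd0: "pd 0 (rep ?c Y) (cmap ?c p) = 0" if "vector_field \<A> UNIV Y" for Y
    using linear_0[OF pd_linear[OF rep_differentiable[OF that c _ q]]] by simp
  have pd00: "pd (0, 0) (pd (0, b) (Lr ?c)) (tchart \<A> ?c v) = 0"
    and pd01: "pd (0, b) (pd (0, 0) (Lr ?c)) (tchart \<A> ?c v) = 0" for b
    using linear_0[OF pd_Lr_linear[OF c z, of b]]
      pd_commute[OF open_dom_TM[OF c] z smooth_Lr[OF c], of "(0, 0)" "(0, b)"] by simp_all
  have "tcoord \<A> ?c p x = x" for x by (rule tcoord_chart_at)
  then have "vert_deriv ?h v w = 2 * cartan_tensor L v (Z p) (Y p) w" for w
    unfolding vert_deriv_def
    using vector_derivative_at[OF vert_has_derivative[OF c _ differentiableI[OF der], of w]] v q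
      cartan_tensor_chart[OF c v(1), of "Z p" "Y p" w]
    by (simp add: pd_eq[OF der] pd0[OF Y] pd0[OF Z] pd00 pd01 rep_cmap[OF c q])
  then have vert: "vert_deriv ?h v w = 2 * cartan_tensor L v w (Y p) (Z p)" for w
    using cartan_tensor_sym[OF v(1)] by metis
  have "conn_tensor2 \<A> A D (fund_tensor L) v X Y Z = Q v (X p) (Y p) (Z p)"
    using metric v X Y Z by (auto simp: has_metric_derivative_def)
  moreover have "conn_fun \<A> A D v X ?h = tderiv \<A> p (X p) (along ?h V) - vert_deriv ?h v (conn_loc \<A> D v X V)"
    using conn_fun_eq[OF v(1) U(1) _ v(3) X, of ?h] U(2) differentiableI[OF der] v(2) by simp
  moreover have "along ?h V = (\<lambda>q. fund_tensor L (q, V q) (Y q) (Z q))"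
    by (simp add: along_def fun_eq_iff)
  ultimately show ?thesis
    using vert v(2) by (simp add: conn_tensor2_def)
qed

text \<open>Frame fields have constant components near the base point, so only the Hessian of
  \<open>L\<close> is differentiated. The factor \<open>2\<close> before \<open>Q\<close> comes from
  clearing the \<open>1/2\<close> in the metric.\<close>

lemma chr_metric:
  assumes c: "c \<in> \<A>" and b: "is_bump (cdom c) N \<beta>" and v: "v \<in> A" "fst v \<in> N"
  defines "z \<equiv> tchart \<A> c v"
  shows "pd (a1, - chr c \<beta> z a1 (snd z)) (pd (0, a2) (pd (0, a3) (Lr c))) z
    = pd (0, chr c \<beta> z a1 a2) (pd (0, a3) (Lr c)) z + pd (0, a2) (pd (0, chr c \<beta> z a1 a3) (Lr c)) z
      + 2 * Q v (coord_field \<A> c a1 (fst v)) (coord_field \<A> c a2 (fst v)) (coord_field \<A> c a3 (fst v))"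
proof -
  let ?F = "frame c \<beta>" and ?h = "\<lambda>w. fund_tensor L w (frame c \<beta> a2 (fst w)) (frame c \<beta> a3 (fst w))"
  have q: "fst v \<in> cdom c" using is_bumpD(5)[OF b] v by auto
  note F = vector_field_frame[OF c b] and rF = rep_frame[OF c b v(2)]
  have zin: "z \<in> dom_TM c" unfolding z_def by (rule tchart_in_dom[OF q v(1)])
  have pd00: "pd (0, 0) (pd (0, b) (Lr c)) z = 0"
    and pd01: "pd (0, b) (pd (0, 0) (Lr c)) z = 0" for b
    using linear_0[OF pd_Lr_linear[OF c zin, of b]]
      pd_commute[OF open_dom_TM[OF c] zin smooth_Lr[OF c], of "(0, 0)" "(0, b)"] by simp_all
  have "(?h \<circ> tchart_inv \<A> c has_derivative (\<lambda>u. 1 / 2 * pd u (pd (0, a2) (pd (0, a3) (Lr c))) z)) (at z)"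
    using fund_tensor_fields_derivative[OF c v(1) q F F, of a2 a3]
    by (simp add: rF z_def[symmetric] pd00 pd01)
  note der = this
  obtain U where U: "fst v \<in> U" "admissible \<A> A U (adm_ext \<A> A v)" "adm_ext \<A> A v (fst v) = snd v"
    using adm_ext[OF v(1)] .
  have Fp: "?F a (fst v) = coord_field \<A> c a (fst v)" for a
    using is_bumpD(3)[OF b v(2)] by (simp add: frame_def)
  have "conn_fun \<A> A D v (?F a1) ?h = pd (a1, - chr c \<beta> z a1 (snd z)) (?h \<circ> tchart_inv \<A> c) z"
    unfolding conn_fun_def Let_def
    using horizontal_derivative[OF c b v U(2,1,3) F open_UNIV _ differentiableI[OF der[unfolded z_def]]]
    by (simp add: rF z_def)
  also have "\<dots> = 1 / 2 * pd (a1, - chr c \<beta> z a1 (snd z)) (pd (0, a2) (pd (0, a3) (Lr c))) z"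
    by (rule pd_eq[OF der])
  finally have "conn_fun \<A> A D v (?F a1) ?h = 1 / 2 * pd (a1, - chr c \<beta> z a1 (snd z)) (pd (0, a2) (pd (0, a3) (Lr c))) z" .
  moreover have "conn_tensor2 \<A> A D (fund_tensor L) v (?F a1) (?F a2) (?F a3)
      = Q v (?F a1 (fst v)) (?F a2 (fst v)) (?F a3 (fst v))"
    using metric v F by (auto simp: has_metric_derivative_def)
  moreover have "fund_tensor L v (D v (?F a1) (?F a2)) (?F a3 (fst v))
      = 1 / 2 * pd (0, chr c \<beta> z a1 a2) (pd (0, a3) (Lr c)) z"
    using chr_frame[OF c b v]
    by (simp add: fund_tensor_chart[OF c v(1) q] Fp tcoord_coord_field[OF c q] z_def)
  moreover have "fund_tensor L v (?F a2 (fst v)) (D v (?F a1) (?F a3))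
      = 1 / 2 * pd (0, a2) (pd (0, chr c \<beta> z a1 a3) (Lr c)) z"
    using chr_frame[OF c b v]
    by (simp add: fund_tensor_chart[OF c v(1) q] Fp tcoord_coord_field[OF c q] z_def)
  ultimately show ?thesis by (simp add: conn_tensor2_def Fp)
qed

text \<open>Transfers the spray computation to the connection. The conditions on the symbols are
  checked on the fibre of \<open>v\<close>: a point of the chart domain with the same first
  component comes from a vector at \<open>fst v\<close>, where \<beta> is \<open>1\<close> and the
  torsion and metric equations hold for the symbols.\<close>

lemma vertical_derivative_chr:
  assumes c: "c \<in> \<A>" and b: "is_bump (cdom c) N \<beta>" and v: "v \<in> A" "fst v \<in> N"
  defines "z0 \<equiv> tchart \<A> c v"
  shows "pd (0, u) (\<lambda>z. chr c \<beta> z (snd z0) (snd z0)) z0 = 0"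
proof -
  have q: "fst v \<in> cdom c" using is_bumpD(5)[OF b] v by auto
  have fib: "\<exists>v'. v' \<in> A \<and> fst v' = fst v \<and> z = tchart \<A> c v'" if z: "z \<in> dom_TM c" "fst z = fst z0" for z
  proof -
    obtain v' where v': "v' \<in> A" "fst v' \<in> cdom c" "z = tchart \<A> c v'" using z(1) by auto
    have "cmap c (fst v') = cmap c (fst v)" using z(2) by (simp add: v' z0_def tchart_def)
    then have "fst v' = fst v" using cinv_cmap[OF c q] cinv_cmap[OF c v'(2)] by metis
    then show ?thesis using v' by blast
  qed
  define qq where "qq z a1 a2 a3 = 2 * Q (tchart_inv \<A> c z) (coord_field \<A> c a1 (fst (tchart_inv \<A> c z)))
    (coord_field \<A> c a2 (fst (tchart_inv \<A> c z))) (coord_field \<A> c a3 (fst (tchart_inv \<A> c z)))" for z a1 a2 a3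
  show ?thesis
  proof (rule vertical_derivative_spray[OF open_dom_TM[OF c] smooth_Lr[OF c] _ euler_Lr[OF c] bilinear_chr smooth_on_chr[OF c b]])
    show "z0 \<in> dom_TM c" unfolding z0_def by (rule tchart_in_dom[OF q v(1)])
    show "chr c \<beta> z a b' = chr c \<beta> z b' a" if z: "z \<in> dom_TM c" "fst z = fst z0" for z a b'
      using fib[OF z] chr_symmetric[OF torsion c b] v(2) by metis
    show "pd (a1, - chr c \<beta> z a1 (snd z)) (pd (0, a2) (pd (0, a3) (Lr c))) z
      = pd (0, chr c \<beta> z a1 a2) (pd (0, a3) (Lr c)) z + pd (0, a2) (pd (0, chr c \<beta> z a1 a3) (Lr c)) z
        + qq z a1 a2 a3" if z: "z \<in> dom_TM c" "fst z = fst z0" for z a1 a2 a3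
    proof -
      obtain v' where v': "v' \<in> A" "fst v' = fst v" "z = tchart \<A> c v'" using fib[OF z] by blast
      show ?thesis
        using chr_metric[OF c b v'(1)] v' v(2) q tchart_inv_tchart[OF c, of v'] by (simp add: qq_def)
    qed
    show "qq z (snd z) a b' = 0 \<and> qq z a (snd z) b' = 0" if z: "z \<in> dom_TM c" "fst z = fst z0" for z a b'
    proof -
      obtain v' where v': "v' \<in> A" "fst v' = fst v" "z = tchart \<A> c v'" using fib[OF z] by blast
      have i: "tchart_inv \<A> c z = v'" using tchart_inv_tchart[OF c, of v'] v' q by simp
      have s: "coord_field \<A> c (snd z) (fst v') = snd v'"
        using coord_field_tcoord[OF c, of "fst v'" "snd v'"] v' q by (simp add: tchart_def)
      have "Q v' (snd v') x y = 0" for x y using Q0 v'(1) by (cases v') auto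
      moreover have "Q v' x (snd v') y = Q v' (snd v') x y" for x y
        using symQ v'(1) by (auto simp: symmetric3_def)
      ultimately show ?thesis unfolding qq_def i s by simp
    qed
    show "u = 0" if "\<And>w. pd (0, u) (pd (0, w) (Lr c)) z0 = 0" for u
    proof -
      have "fund_tensor L v (coord_field \<A> c u (fst v)) w = 0" for w
        using that by (simp add: fund_tensor_chart[OF c v(1) q] tcoord_coord_field[OF c q] z0_def)
      then have "coord_field \<A> c u (fst v) = 0" by (rule nondegenerate[OF v(1)])
      then show "u = 0" using tcoord_coord_field[OF c q, of u] by (simp add: tcoord_simps[OF c q])
    qed
  qed
qed

section \<open>Comparison with the Levi-Civita connection of \<open>g\<^sub>V\<close>\<close>

lemma Q_self:
  assumes v: "v \<in> A"
  shows "Q v (snd v) x y = 0" "Q v x (snd v) y = 0" "Q v x y (snd v) = 0"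
proof -
  show 1: "Q v (snd v) x y = 0" for x y using Q0 v by (cases v) auto
  have s: "Q v x y z = Q v y x z" "Q v x y z = Q v x z y" for x y z
    using symQ v by (auto simp: symmetric3_def)
  show 2: "Q v x (snd v) y = 0" for x y using 1 s(1) by simp
  show "Q v x y (snd v) = 0" using 2 s(2) by simp
qed

lemma difference_formula:
  assumes V: "admissible \<A> A \<Omega> V" and lc: "levi_civita \<A> \<Omega> (along (fund_tensor L) V) B"
    and X: "vector_field \<A> \<Omega> X" and Y: "vector_field \<A> \<Omega> Y" and Z: "vector_field \<A> \<Omega> Z" and p: "p \<in> \<Omega>"
  defines "v \<equiv> (p, V p)"
  shows "fund_tensor L v (conn_along \<A> D V X Y p - B X Y p) (Z p)
    = - cartan_tensor L v (Y p) (Z p) (conn_along \<A> D V X V p)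
      - cartan_tensor L v (Z p) (X p) (conn_along \<A> D V Y V p)
      + cartan_tensor L v (X p) (Y p) (conn_along \<A> D V Z V p) - 1 / 2 * Q v (X p) (Y p) (Z p)"
proof -
  have \<Omega>: "open \<Omega>" and vV: "vector_field \<A> \<Omega> V" and v: "v \<in> A" "fst v = p"
    using V p by (auto simp: admissible_def v_def)
  \<comment> \<open>The anisotropic connection and \<open>metric_along\<close> take global fields,
    the affine connection takes fields on \<Omega>. Global fields with the same germs at
    \<open>p\<close> serve both, so all comparisons are made on them.\<close>
  define e where "e W = germ_ext \<A> p W" for W :: "'m \<Rightarrow> 'e"
  have e: "vector_field \<A> UNIV (e W)" "vector_field \<A> \<Omega> (e W)"
    and near: "\<exists>N. open N \<and> p \<in> N \<and> N \<subseteq> \<Omega> \<and> (\<forall>q\<in>N. e W q = W q)" if "vector_field \<A> \<Omega> W" for W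
    using germ_ext[OF \<Omega> p that] vector_field_subset[of UNIV "germ_ext \<A> p W" \<Omega>] by (auto simp: e_def)
  have at_p: "e W p = W p" if "vector_field \<A> \<Omega> W" for W using near[OF that] by auto
  have near2: "\<exists>N. open N \<and> p \<in> N \<and> (\<forall>q\<in>N. e W q = W q \<and> e W' q = W' q)"
    if W: "vector_field \<A> \<Omega> W" "vector_field \<A> \<Omega> W'" for W W'
  proof -
    obtain N where N: "open N" "p \<in> N" "\<forall>q\<in>N. e W q = W q" using near[OF W(1)] by blast
    obtain N' where N': "open N'" "p \<in> N'" "\<forall>q\<in>N'. e W' q = W' q" using near[OF W(2)] by blast
    show ?thesis using N N' by (intro exI[of _ "N \<inter> N'"]) auto
  qed
  have DV: "conn_along \<A> D V W W' p = D v (e W) (e W')" for W W'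
    by (simp add: conn_along_def conn_loc_def e_def v_def)
  have Be: "B W W' p = B (e W) (e W') p" if W: "vector_field \<A> \<Omega> W" "vector_field \<A> \<Omega> W'" for W W'
  proof -
    obtain N where N: "open N" "p \<in> N" "\<forall>q\<in>N. e W q = W q \<and> e W' q = W' q" using near2[OF W] by blast
    show ?thesis
      by (rule affine_local[OF _ \<Omega> p N(1,2) W(1) e(2)[OF W(1)] _ W(2) e(2)[OF W(2)]])
        (use lc N in \<open>auto simp: levi_civita_def\<close>)
  qed
  \<comment> \<open>The Cartan terms still pair an extended field with the original
    \<open>V\<close>; locality brings them to the form used in the statement.\<close>
  have cV: "conn_loc \<A> D v (e W) V = conn_along \<A> D V W V p" if W: "vector_field \<A> \<Omega> W" for W
  proof -
    obtain N where N: "open N" "p \<in> N" "\<forall>q\<in>N. e W q = W q" using near[OF W] by blast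
    show ?thesis
      unfolding conn_along_def v_def[symmetric]
      by (rule conn_loc_cong[OF v(1) \<Omega> _ e(2)[OF W] vV \<Omega> _ W vV N(1)]) (use v p N in auto)
  qed
  define S where "S W W' = D v (e W) (e W') - B (e W) (e W') p" for W W'
  let ?g = "fund_tensor L v" and ?C = "cartan_tensor L v" and ?n = "\<lambda>W. conn_along \<A> D V W V p"
  have comp: "?g (S W1 W2) (W3 p) + ?g (W2 p) (S W1 W3) = - 2 * ?C (?n W1) (W2 p) (W3 p) - Q v (W1 p) (W2 p) (W3 p)"
    if W: "vector_field \<A> \<Omega> W1" "vector_field \<A> \<Omega> W2" "vector_field \<A> \<Omega> W3" for W1 W2 W3
  proof -
    have "tderiv \<A> p (e W1 p) (\<lambda>q. fund_tensor L (q, V q) (e W2 q) (e W3 q))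
      = ?g (D v (e W1) (e W2)) (W3 p) + ?g (W2 p) (D v (e W1) (e W3))
        + 2 * ?C (?n W1) (W2 p) (W3 p) + Q v (W1 p) (W2 p) (W3 p)"
      using metric_along[OF V p e(1)[OF W(1)] e(1)[OF W(2)] e(1)[OF W(3)]] W
      by (simp add: v_def[symmetric] at_p cV)
    moreover have "tderiv \<A> p (e W1 p) (\<lambda>q. along (fund_tensor L) V q (e W2 q) (e W3 q))
      = along (fund_tensor L) V p (B (e W1) (e W2) p) (e W3 p) + along (fund_tensor L) V p (e W2 p) (B (e W1) (e W3) p)"
      using lc e(2)[OF W(1)] e(2)[OF W(2)] e(2)[OF W(3)] p unfolding levi_civita_def by blast
    ultimately show ?thesis
      using linear_diff[OF linear_fund_tensor(1)[OF v(1)]] linear_diff[OF linear_fund_tensor(2)[OF v(1)]] W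
      by (simp add: S_def along_def v_def[symmetric] at_p)
  qed
  have sym: "S W W' = S W' W" if W: "vector_field \<A> \<Omega> W" "vector_field \<A> \<Omega> W'" for W W'
  proof -
    have "D v (e W) (e W') - D v (e W') (e W) = lie_bracket \<A> (e W) (e W') p"
      using torsion v e(1)[OF W(1)] e(1)[OF W(2)] unfolding aniso_torsion_free_def by blast
    moreover have "B (e W) (e W') p - B (e W') (e W) p = lie_bracket \<A> (e W) (e W') p"
      using lc p e(2)[OF W(1)] e(2)[OF W(2)] unfolding levi_civita_def by blast
    ultimately show ?thesis by (simp add: S_def algebra_simps)
  qed
  have Qs: "Q v x y z = Q v y x z" "Q v x y z = Q v x z y" for x y z
    using symQ v by (auto simp: symmetric3_def)
  have Cs: "?C (?n X) (Y p) (Z p) = ?C (Y p) (Z p) (?n X)" "?C (?n Y) (X p) (Z p) = ?C (Z p) (X p) (?n Y)"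
    "?C (?n Z) (X p) (Y p) = ?C (X p) (Y p) (?n Z)"
    using cartan_tensor_sym[OF v(1)] by metis+
  have q: "Q v (Y p) (X p) (Z p) = Q v (X p) (Y p) (Z p)" "Q v (Z p) (X p) (Y p) = Q v (X p) (Y p) (Z p)"
    using Qs(1)[of "X p" "Y p" "Z p"] Qs(1)[of "Z p" "X p" "Y p"] Qs(2)[of "X p" "Z p" "Y p"] by simp_all
  \<comment> \<open>The first equation plus the second minus the third leaves
    \<open>2 g(S X Y, Z)\<close> by symmetry of \<open>S\<close>. Of the three equal terms in
    \<open>Q\<close> one remains, hence the factor \<open>1/2\<close> in the result.\<close>
  have "?g (S X Y) (Z p) + ?g (Y p) (S X Z) = - 2 * ?C (Y p) (Z p) (?n X) - Q v (X p) (Y p) (Z p)"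
    "?g (S Y X) (Z p) + ?g (X p) (S Y Z) = - 2 * ?C (Z p) (X p) (?n Y) - Q v (X p) (Y p) (Z p)"
    "?g (S Z X) (Y p) + ?g (X p) (S Z Y) = - 2 * ?C (X p) (Y p) (?n Z) - Q v (X p) (Y p) (Z p)"
    using comp[OF X Y Z] comp[OF Y X Z] comp[OF Z X Y] unfolding Cs q by simp_all
  then have "?g (S X Y) (Z p) = - ?C (Y p) (Z p) (?n X) - ?C (Z p) (X p) (?n Y) + ?C (X p) (Y p) (?n Z)
      - 1 / 2 * Q v (X p) (Y p) (Z p)"
    unfolding sym[OF Y X] sym[OF Z Y] sym[OF Z X]
    using fund_tensor_sym[OF v(1), of "Y p" "S X Z"] by simp
  then show ?thesis by (simp add: S_def DV Be[OF X Y])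
qed

end

section \<open>Geodesic vector fields\<close>

context smooth_manifold
begin

lemma integral_curve_exists:
  assumes \<Omega>: "open \<Omega>" "p \<in> \<Omega>" and V: "vector_field \<A> \<Omega> V"
  obtains I \<gamma> where "integral_curve \<A> \<Omega> V I \<gamma>" "0 \<in> I" "\<gamma> 0 = p"
proof -
  let ?c = "chart_at \<A> p"
  note c = chart_at(1)[of p] and q = chart_at(2)[of p]
  let ?S = "cmap ?c ` (\<Omega> \<inter> cdom ?c)"
  have S: "open ?S" "cmap ?c p \<in> ?S" using open_chart_part[OF c \<Omega>(1)] \<Omega>(2) q by auto
  have "smooth_on ?S (rep ?c V)" using V c by (simp add: vector_field_rep)
  from ode_local[OF S this] obtain e y where e: "e > 0" and y: "y 0 = cmap ?c p"
    "\<And>t. \<bar>t\<bar> < e \<Longrightarrow> y t \<in> ?S" "\<And>t. \<bar>t\<bar> < e \<Longrightarrow> (y has_vector_derivative rep ?c V (y t)) (at t)"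
    by blast
  let ?I = "{-e<..<e}" and ?\<gamma> = "cinv ?c \<circ> y"
  have yS: "y t \<in> ?S" if "t \<in> ?I" for t using y(2)[of t] that by auto
  have \<gamma>: "?\<gamma> t \<in> \<Omega>" "?\<gamma> t \<in> cdom ?c" "cmap ?c (?\<gamma> t) = y t" if t: "t \<in> ?I" for t
    using yS[OF t] by (auto simp: cinv_cmap[OF c])
  have "continuous_on ?I y"
    by (intro continuous_at_imp_continuous_on ballI, rule has_vector_derivative_continuous[OF y(3)]) auto
  then have "continuous_on ?I ?\<gamma>"
    by (rule continuous_on_compose[OF _ continuous_on_subset[OF homeomorphism_cont2[OF chart_homeo[OF c]]]])
      (use yS in blast)
  moreover have "((cmap d \<circ> ?\<gamma>) has_vector_derivative tcoord \<A> d (?\<gamma> t) (V (?\<gamma> t))) (at t)"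
    if t: "t \<in> ?I" and d: "d \<in> \<A>" "?\<gamma> t \<in> cdom d" for t d
  proof -
    have diff: "(cmap d \<circ> cinv ?c) differentiable (at (y t))"
      using trans_differentiable[OF c d(1) \<gamma>(2)[OF t] d(2)] \<gamma>(3)[OF t] by simp
    have "(y has_vector_derivative rep ?c V (y t)) (at t)" using y(3)[of t] t by auto
    from diff_chain_at[OF this[unfolded has_vector_derivative_def] pd_has_derivative[OF diff]]
    have "((cmap d \<circ> ?\<gamma>) has_vector_derivative pd (rep ?c V (y t)) (cmap d \<circ> cinv ?c) (y t)) (at t)"
      unfolding has_vector_derivative_def
      using linear_cmul[OF pd_linear[OF diff]] by (simp add: o_def)
    moreover have "pd (rep ?c V (y t)) (cmap d \<circ> cinv ?c) (y t) = tcoord \<A> d (?\<gamma> t) (V (?\<gamma> t))"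
      using change_tcoord[OF c d(1) \<gamma>(2)[OF t] d(2), of "V (?\<gamma> t)"] rep_cmap[OF c \<gamma>(2)[OF t], of V]
      by (simp only: change_deriv_pd \<gamma>(3)[OF t])
    ultimately show ?thesis by simp
  qed
  ultimately have "integral_curve \<A> \<Omega> V ?I ?\<gamma>"
    unfolding integral_curve_def using \<gamma>(1) by (auto simp: is_interval_oo)
  then show ?thesis
    by (rule that) (use e y(1) cinv_cmap[OF c q] in auto)
qed

lemma vector_field_lie_bracket:
  assumes U: "open U" and X: "vector_field \<A> U X" and Y: "vector_field \<A> U Y"
  shows "vector_field \<A> U (lie_bracket \<A> X Y)"
  unfolding vector_field_rep
proof
  fix c assume c: "c \<in> \<A>"
  let ?S = "cmap c ` (U \<inter> cdom c)"
  have S: "open ?S" by (rule open_chart_part[OF c U])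
  have s: "smooth_on ?S (rep c X)" "smooth_on ?S (rep c Y)" using X Y c by (auto simp: vector_field_rep)
  show "smooth_on ?S (rep c (lie_bracket \<A> X Y))"
  proof (rule smooth_on_cong[OF S])
    show "smooth_on ?S (\<lambda>x. pd (rep c X x) (rep c Y) x - pd (rep c Y x) (rep c X) x)"
      by (rule smooth_on_diff[OF S smooth_on_pd_along[OF S s(2) smooth_on_ident s(1)]
            smooth_on_pd_along[OF S s(1) smooth_on_ident s(2)]]) auto
    fix x assume "x \<in> ?S"
    then obtain p where p: "p \<in> U" "p \<in> cdom c" "x = cmap c p" by auto
    then show "pd (rep c X x) (rep c Y) x - pd (rep c Y x) (rep c X) x = rep c (lie_bracket \<A> X Y) x"
      using lie_bracket_rep[OF c U p(1,2) X Y] by (simp add: rep_cmap[OF c p(2)])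
  qed
qed

end

context aniso_conn
begin

text \<open>Along an integral curve the velocity components are those of \<open>V\<close>, so the
  second derivative of the curve is the derivative of these components along \<open>V\<close>. The
  constant field \<open>E\<close> supplies the Christoffel term, and the acceleration becomes the
  chart expression of the self-derivative of \<open>V\<close>.\<close>

lemma autoparallel_integral_curve:
  assumes V: "admissible \<A> A \<Omega> V" and \<gamma>: "integral_curve \<A> \<Omega> V I \<gamma>" "t \<in> I"
    and auto: "autoparallel \<A> A D I \<gamma>"
  shows "conn_along \<A> D V V V (\<gamma> t) = 0"
proof -
  let ?p = "\<gamma> t"
  let ?c = "chart_at \<A> ?p"
  note c = chart_at(1)[of ?p] and q = chart_at(2)[of ?p]
  let ?x = "cmap ?c ?p" and ?r = "rep ?c V" and ?y = "cmap ?c \<circ> \<gamma>"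
  have I: "open I" "\<gamma> ` I \<subseteq> \<Omega>" "continuous_on I \<gamma>"
    and der: "\<And>s. s \<in> I \<Longrightarrow> \<gamma> s \<in> cdom ?c \<Longrightarrow> (?y has_vector_derivative tcoord \<A> ?c (\<gamma> s) (V (\<gamma> s))) (at s)"
    using \<gamma>(1) c unfolding integral_curve_def by auto
  have p: "?p \<in> \<Omega>" using I \<gamma>(2) by auto
  have \<Omega>: "open \<Omega>" "vector_field \<A> \<Omega> V" and pA: "(?p, V ?p) \<in> A" using V p by (auto simp: admissible_def)
  define J where "J = I \<inter> \<gamma> -` cdom ?c"
  have J: "open J" "t \<in> J"
    using continuous_open_preimage[OF I(3,1) open_cdom[OF c]] \<gamma>(2) q by (auto simp: J_def)
  have dy: "(?y has_vector_derivative ?r (?y s)) (at s)" if "s \<in> J" for s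
    using der[of s] that by (auto simp: J_def rep_cmap[OF c])
  have r: "?r differentiable (at ?x)" by (rule rep_differentiable[OF \<Omega>(2) c p q])
  let ?a = "?r ?x"
  have a: "?a = V ?p" by (simp add: rep_cmap[OF c q] tcoord_chart_at)
  have "(?y has_vector_derivative ?a) (at t)" using dy[OF J(2)] by simp
  then have vel: "vector_derivative ?y (at t) = ?a" by (rule vector_derivative_at)
  have "(?r has_derivative (\<lambda>u. pd u ?r ?x)) (at (?y t))" using pd_has_derivative[OF r] by simp
  from diff_chain_at[OF dy[OF J(2), unfolded has_vector_derivative_def] this]
  have "((\<lambda>s. ?r (?y s)) has_vector_derivative pd ?a ?r ?x) (at t)"
    unfolding has_vector_derivative_def using linear_cmul[OF pd_linear[OF r]] by (simp add: o_def)
  then have "((\<lambda>s. vector_derivative ?y (at s)) has_vector_derivative pd ?a ?r ?x) (at t)"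
    by (rule has_vector_derivative_transform_within_open[OF _ J]) (rule vector_derivative_at[OF dy, symmetric])
  then have acc: "vector_derivative (\<lambda>s. vector_derivative ?y (at s)) (at t) = pd ?a ?r ?x"
    by (rule vector_derivative_at)
  let ?E = "coord_field \<A> ?c ?a"
  have "acceleration \<A> D ?c \<gamma> t = 0"
    using auto \<gamma>(2) c q unfolding autoparallel_def by blast
  moreover have "velocity \<A> \<gamma> t = (?p, V ?p)" using vel a by (simp add: velocity_def)
  ultimately have 0: "pd ?a ?r ?x + tcoord \<A> ?c ?p (conn_loc \<A> D (?p, V ?p) ?E ?E) = 0"
    by (simp add: acceleration_def Let_def acc vel)
  obtain N \<beta> where b: "is_bump (cdom ?c) N \<beta>" "?p \<in> N" by (rule chart_bump)
  have "pd u (rep ?c ?E) ?x = pd u (\<lambda>x. ?a) ?x" for u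
    by (rule pd_cong[OF open_cran[OF c]]) (use q in \<open>auto simp: rep_cmap[OF c] tcoord_coord_field[OF c]\<close>)
  then have "pd u (rep ?c ?E) ?x = 0" for u by (simp add: pd_def)
  moreover have "rep ?c ?E ?x = ?a" by (rule rep_coord_field[OF c]) (use q in simp)
  ultimately have "tcoord \<A> ?c ?p (conn_loc \<A> D (?p, V ?p) ?E ?E) = chr ?c \<beta> (tchart \<A> ?c (?p, V ?p)) ?a ?a"
    using conn_loc_local[OF c b(1) pA _ open_cdom[OF c] _ vector_field_coord_field[OF c] vector_field_coord_field[OF c]] b(2) q
    by simp
  then have "tcoord \<A> ?c ?p (conn_loc \<A> D (?p, V ?p) V V) = 0"
    using 0 conn_loc_local[OF c b(1) pA _ \<Omega>(1) _ \<Omega>(2) \<Omega>(2)] b(2) p by simp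
  then show ?thesis by (simp add: conn_along_def tcoord_chart_at)
qed

end

context finsler_conn
begin

text \<open>Every tangent vector at \<open>p\<close> is the value of some field, so testing against
  fields is enough to apply nondegeneracy.\<close>

lemma fund_tensor_cancel:
  assumes V: "admissible \<A> A \<Omega> V" and p: "p \<in> \<Omega>"
    and eq: "\<And>Z. vector_field \<A> \<Omega> Z \<Longrightarrow> fund_tensor L (p, V p) (x - y) (Z p) = 0"
  shows "x = y"
proof -
  have "fund_tensor L (p, V p) (x - y) w = 0" for w
    using eq[OF vector_field_subset[OF field_through(1)], of p w] by (simp add: field_through(2))
  then have "x - y = 0" using V p by (intro nondegenerate[of "(p, V p)"]) (auto simp: admissible_def)
  then show ?thesis by simp
qed

lemma
  assumes V: "admissible \<A> A \<Omega> V" and lc: "levi_civita \<A> \<Omega> (along (fund_tensor L) V) B"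
    and X: "vector_field \<A> \<Omega> X" and Y: "vector_field \<A> \<Omega> Y" and p: "p \<in> \<Omega>"
  defines "v \<equiv> (p, V p)"
  shows difference_right: "fund_tensor L v (conn_along \<A> D V X V p - B X V p) (Y p)
      = - cartan_tensor L v (Y p) (X p) (conn_along \<A> D V V V p)"
    and difference_left: "fund_tensor L v (conn_along \<A> D V V X p - B V X p) (Y p)
      = - cartan_tensor L v (X p) (Y p) (conn_along \<A> D V V V p)"
    and difference_normal: "fund_tensor L v (conn_along \<A> D V X Y p - B X Y p) (V p)
      = cartan_tensor L v (X p) (Y p) (conn_along \<A> D V V V p)"
proof -
  have W: "vector_field \<A> \<Omega> V" and v: "v \<in> A" "snd v = V p" using V p by (auto simp: admissible_def v_def)
  note self = cartan_tensor_self[OF v(1), unfolded v(2)] Q_self[OF v(1), unfolded v(2)]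
  show "fund_tensor L v (conn_along \<A> D V X V p - B X V p) (Y p)
      = - cartan_tensor L v (Y p) (X p) (conn_along \<A> D V V V p)"
    using difference_formula[OF V lc X W Y p] by (simp add: v_def[symmetric] self)
  show "fund_tensor L v (conn_along \<A> D V V X p - B V X p) (Y p)
      = - cartan_tensor L v (X p) (Y p) (conn_along \<A> D V V V p)"
    using difference_formula[OF V lc W X Y p] by (simp add: v_def[symmetric] self)
  show "fund_tensor L v (conn_along \<A> D V X Y p - B X Y p) (V p)
      = cartan_tensor L v (X p) (Y p) (conn_along \<A> D V V V p)"
    using difference_formula[OF V lc X Y W p] by (simp add: v_def[symmetric] self)
qed

lemma conn_along_self:
  assumes V: "admissible \<A> A \<Omega> V" and lc: "levi_civita \<A> \<Omega> (along (fund_tensor L) V) B" and p: "p \<in> \<Omega>"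
  shows "conn_along \<A> D V V V p = B V V p"
proof (rule fund_tensor_cancel[OF V p])
  fix Z assume Z: "vector_field \<A> \<Omega> Z"
  have W: "vector_field \<A> \<Omega> V" and v: "(p, V p) \<in> A" using V p by (auto simp: admissible_def)
  show "fund_tensor L (p, V p) (conn_along \<A> D V V V p - B V V p) (Z p) = 0"
    using difference_right[OF V lc W Z p] cartan_tensor_self(2)[OF v] by simp
qed

text \<open>The hypothesis makes integral curves autoparallel for the Levi-Civita--Chern connection
  \<open>D'\<close>, which need not be \<open>D\<close>. By \<open>conn_along_self\<close>, applied
  once to each, both self-derivatives of \<open>V\<close> equal \<open>B V V p\<close>, so the
  vanishing is passed from \<open>D'\<close> to \<open>D\<close>.\<close>

lemma geodesic_field_self:
  assumes geo: "geodesic_field \<A> A L \<Omega> V" and lc: "levi_civita \<A> \<Omega> (along (fund_tensor L) V) B" and p: "p \<in> \<Omega>"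
  shows "conn_along \<A> D V V V p = 0"
proof -
  have V: "admissible \<A> A \<Omega> V" using geo by (simp add: geodesic_field_def)
  obtain I \<gamma> where \<gamma>: "integral_curve \<A> \<Omega> V I \<gamma>" "0 \<in> I" "\<gamma> 0 = p"
    using integral_curve_exists[of \<Omega> p V] V p by (auto simp: admissible_def)
  then obtain D' where D': "levi_civita_chern \<A> A L D'" "autoparallel \<A> A D' I \<gamma>"
    using geo unfolding geodesic_field_def geodesic_def by blast
  interpret C: finsler_conn \<A> A D' L "\<lambda>v x y z. 0"
    by unfold_locales
      (use D'(1) conic finsler in \<open>auto simp: levi_civita_chern_def symmetric3_def\<close>)
  have "conn_along \<A> D' V V V p = 0"
    using C.autoparallel_integral_curve[OF V \<gamma>(1,2) D'(2)] \<gamma>(3) by simp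
  then show ?thesis
    using C.conn_along_self[OF V lc p] conn_along_self[OF V lc p] by simp
qed

end

section \<open>Curvature\<close>

context aniso_conn
begin

lemma tfield_rep_conn_derivative:
  assumes c: "c \<in> \<A>" and b: "is_bump (cdom c) N \<beta>" and v: "v \<in> A" "fst v \<in> N"
    and Y: "vector_field \<A> UNIV Y" and Z: "vector_field \<A> UNIV Z"
  defines "x \<equiv> cmap c (fst v)" and "z \<equiv> tchart \<A> c v"
  shows "pd u (tfield_rep c (\<lambda>w. D w Y Z)) z
    = pd (fst u) (pd (rep c Y x) (rep c Z)) x + pd (pd (fst u) (rep c Y) x) (rep c Z) x
      + pd u (\<lambda>z. chr c \<beta> z (rep c Y x) (rep c Z x)) z
      + chr c \<beta> z (pd (fst u) (rep c Y) x) (rep c Z x) + chr c \<beta> z (rep c Y x) (pd (fst u) (rep c Z) x)"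
proof -
  have q: "fst v \<in> cdom c" using is_bumpD(5)[OF b] v by auto
  note O = open_dom_TM[OF c]
  have zin: "z \<in> dom_TM c" unfolding z_def by (rule tchart_in_dom[OF q v(1)])
  have fz: "fst z = x" by (simp add: z_def x_def tchart_def)
  have fst': "((fst :: 'e \<times> 'e \<Rightarrow> 'e) has_derivative fst) (at z)"
    by (rule bounded_linear_imp_has_derivative[OF bounded_linear_fst])
  have rf: "((\<lambda>z. rep c Y (fst z)) has_derivative (\<lambda>u. pd (fst u) (rep c Y) x)) (at z)"
    if "vector_field \<A> UNIV Y" for Y
  proof -
    have "rep c Y differentiable (at (fst z))"
      unfolding fz x_def by (rule rep_differentiable[OF that c _ q]) simp
    from diff_chain_at[OF fst' pd_has_derivative[OF this]]
    show ?thesis by (simp add: o_def fz)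
  qed
  have sm: "smooth_on (cmap c ` cdom c) (rep c Z)" using Z c by (auto simp: vector_field_rep)
  have xin: "x \<in> cmap c ` cdom c" using q by (simp add: x_def)
  have dY: "rep c Y differentiable (at x)" unfolding x_def by (rule rep_differentiable[OF Y c _ q]) simp
  have "((\<lambda>x. pd (rep c Y x) (rep c Z) x) has_derivative
      (\<lambda>u. pd u (pd (rep c Y x) (rep c Z)) x + pd (pd u (rep c Y) x) (rep c Z) x)) (at (fst z))"
    using pd_along_derivative[OF open_cran[OF c] xin sm dY] by (simp add: fz)
  from diff_chain_at[OF fst' this]
  have d1: "((\<lambda>z. pd (rep c Y (fst z)) (rep c Z) (fst z)) has_derivative
      (\<lambda>u. pd (fst u) (pd (rep c Y x) (rep c Z)) x + pd (pd (fst u) (rep c Y) x) (rep c Z) x)) (at z)"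
    by (simp add: o_def)
  have id: "pd u (\<lambda>z. z) z = u" for u by (simp add: pd_def)
  have d2: "((\<lambda>z. chr c \<beta> z (rep c Y (fst z)) (rep c Z (fst z))) has_derivative
      (\<lambda>u. pd u (\<lambda>z. chr c \<beta> z (rep c Y x) (rep c Z x)) z
      + chr c \<beta> z (pd (fst u) (rep c Y) x) (rep c Z x) + chr c \<beta> z (rep c Y x) (pd (fst u) (rep c Z) x))) (at z)"
    using bilinear_slot_derivative[OF O, of "\<lambda>z. z" z "chr c \<beta>" "\<lambda>z. rep c Y (fst z)" "\<lambda>z. rep c Z (fst z)"]
      zin bilinear_chr smooth_on_differentiable[OF smooth_on_chr[OF c b] zin]
      differentiableI[OF rf[OF Y]] differentiableI[OF rf[OF Z]]
    by (simp add: pd_eq[OF rf[OF Y]] pd_eq[OF rf[OF Z]] fz id)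
  \<comment> \<open>The chart formula for \<open>D\<close> holds over \<open>N\<close> only, so the
    function is replaced on the part of the domain lying over \<open>N\<close>, which is open and
    contains \<open>z\<close>.\<close>
  let ?T = "dom_TM c \<inter> fst -` (cmap c ` N)"
  have T: "open ?T" "z \<in> ?T"
    using O zin open_cmap_image[OF c is_bumpD(2,5)[OF b]] v(2) fz
    by (auto simp: x_def intro!: open_Int open_vimage continuous_on_fst continuous_on_id)
  have "pd u (tfield_rep c (\<lambda>w. D w Y Z)) z
      = pd u (\<lambda>z. pd (rep c Y (fst z)) (rep c Z) (fst z) + chr c \<beta> z (rep c Y (fst z)) (rep c Z (fst z))) z"
  proof (rule pd_cong[OF T])
    fix w assume "w \<in> ?T"
    then obtain v' where v': "v' \<in> A" "fst v' \<in> cdom c" "w = tchart \<A> c v'" "cmap c (fst v') \<in> cmap c ` N"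
      by (auto simp: tchart_def)
    have "fst v' \<in> N" using v'(2,4) cinv_cmap[OF c] is_bumpD(5)[OF b] by (metis imageE subsetD)
    then show "tfield_rep c (\<lambda>w. D w Y Z) w
        = pd (rep c Y (fst w)) (rep c Z) (fst w) + chr c \<beta> w (rep c Y (fst w)) (rep c Z (fst w))"
      using conn_local[OF c b v'(1) _ Y Z] tfield_rep_tchart[OF c v'(2)] by (simp add: v'(3) tchart_def)
  qed
  then show ?thesis by (simp add: pd_eq[OF has_derivative_add[OF d1 d2]])
qed

text \<open>All derivatives of components cancel: the second derivatives of \<open>Z\<close> by
  symmetry, the rest between the two covariant derivatives or against the bracket. Only values of
  the fields at the point remain, which makes the choices in \<open>field_through\<close>
  irrelevant.\<close>

lemma aniso_curvature_chart:
  assumes c: "c \<in> \<A>" and b: "is_bump (cdom c) N \<beta>" and v: "v \<in> A" "fst v \<in> N"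
    and X: "vector_field \<A> UNIV X" and Y: "vector_field \<A> UNIV Y" and Z: "vector_field \<A> UNIV Z"
  defines "x \<equiv> cmap c (fst v)" and "z \<equiv> tchart \<A> c v"
  shows "tcoord \<A> c (fst v) (aniso_curvature \<A> A D v X Y Z)
    = pd (rep c X x, - chr c \<beta> z (rep c X x) (snd z)) (\<lambda>z. chr c \<beta> z (rep c Y x) (rep c Z x)) z
      - pd (rep c Y x, - chr c \<beta> z (rep c Y x) (snd z)) (\<lambda>z. chr c \<beta> z (rep c X x) (rep c Z x)) z
      + chr c \<beta> z (rep c X x) (chr c \<beta> z (rep c Y x) (rep c Z x))
      - chr c \<beta> z (rep c Y x) (chr c \<beta> z (rep c X x) (rep c Z x))"
proof -
  have q: "fst v \<in> cdom c" using is_bumpD(5)[OF b] v by auto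
  let ?a = "rep c X x" and ?b = "rep c Y x" and ?d = "rep c Z x" and ?G = "chr c \<beta> z"
  have sm: "smooth_on (cmap c ` cdom c) (rep c Z)" using Z c by (auto simp: vector_field_rep)
  have xin: "x \<in> cmap c ` cdom c" using q by (simp add: x_def)
  have F: "tfield_rep c (\<lambda>w. D w Y Z) z = pd (rep c Y x) (rep c Z) x + ?G (rep c Y x) ?d"
    if "vector_field \<A> UNIV Y" for Y
    using conn_local[OF c b v that Z] tfield_rep_tchart[OF c q, of "\<lambda>w. D w Y Z"] by (simp add: x_def z_def)
  have br: "rep c (lie_bracket \<A> X Y) x = pd ?a (rep c Y) x - pd ?b (rep c X) x"
    using lie_bracket_rep[OF c open_UNIV _ q X Y] by (simp add: x_def rep_cmap[OF c q])
  have 1: "tcoord \<A> c (fst v) (conn_field \<A> A D v X (\<lambda>w. D w Y Z))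
    = pd (rep c X x, - ?G (rep c X x) (snd z)) (tfield_rep c (\<lambda>w. D w Y Z)) z
      + ?G (rep c X x) (tfield_rep c (\<lambda>w. D w Y Z) z)"
    if "vector_field \<A> UNIV X" "vector_field \<A> UNIV Y" for X Y
    unfolding x_def z_def by (rule conn_field_local[OF c b v that(1) conn_smooth[OF that(2) Z]])
  have 2: "tcoord \<A> c (fst v) (D v (lie_bracket \<A> X Y) Z)
    = pd (pd ?a (rep c Y) x - pd ?b (rep c X) x) (rep c Z) x + ?G (pd ?a (rep c Y) x - pd ?b (rep c X) x) ?d"
    using conn_local[OF c b v vector_field_lie_bracket[OF open_UNIV X Y] Z] br by (simp add: x_def z_def)
  note lin = linear_diff[OF pd_linear_on[OF sm xin]] bilinear_lsub[OF bilinear_chr] bilinear_radd[OF bilinear_chr]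
  show ?thesis
    unfolding aniso_curvature_def tcoord_simps(2)[OF c q] 1[OF X Y] 1[OF Y X] 2 F[OF X] F[OF Y]
      tfield_rep_conn_derivative[OF c b v Y Z, folded x_def z_def]
      tfield_rep_conn_derivative[OF c b v X Z, folded x_def z_def]
    using pd_commute[OF open_cran[OF c] xin sm, of ?a ?b]
    by (simp add: lin)
qed

lemma conn_along_chart:
  assumes c: "c \<in> \<A>" and b: "is_bump (cdom c) N \<beta>" and V: "admissible \<A> A \<Omega> V" and p: "p \<in> \<Omega>" "p \<in> N"
    and X: "vector_field \<A> \<Omega> X" and Y: "vector_field \<A> \<Omega> Y"
  defines "x \<equiv> cmap c p"
  shows "tcoord \<A> c p (conn_along \<A> D V X Y p)
    = pd (rep c X x) (rep c Y) x + chr c \<beta> (x, rep c V x) (rep c X x) (rep c Y x)"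
proof -
  have q: "p \<in> cdom c" using is_bumpD(5)[OF b] p by auto
  have "(p, V p) \<in> A" "open \<Omega>" using V p by (auto simp: admissible_def)
  from conn_loc_local[OF c b this(1) _ this(2) _ X Y] p rep_graph(1)[OF c V p(1) q]
  show ?thesis by (simp add: conn_along_def x_def)
qed

text \<open>The field \<open>W\<close> merely has to agree with the covariant derivative on
  \<Omega>. This allows the zero field when \<open>V\<close> is parallel along itself, and fields
  whose smoothness is known from elsewhere.\<close>

lemma conn_along_derivative:
  assumes c: "c \<in> \<A>" and b: "is_bump (cdom c) N \<beta>" and V: "admissible \<A> A \<Omega> V" and p: "p \<in> \<Omega>" "p \<in> N"
    and X: "vector_field \<A> \<Omega> X" and W: "\<And>q. q \<in> \<Omega> \<Longrightarrow> W q = conn_along \<A> D V X V q"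
  defines "x \<equiv> cmap c p" and "z \<equiv> tchart \<A> c (p, V p)"
  shows "pd u (rep c W) x = pd u (pd (rep c X x) (rep c V)) x + pd (pd u (rep c X) x) (rep c V) x
    + pd (u, pd u (rep c V) x) (\<lambda>z. chr c \<beta> z (rep c X x) (rep c V x)) z
    + chr c \<beta> z (pd u (rep c X) x) (rep c V x) + chr c \<beta> z (rep c X x) (pd u (rep c V) x)"
proof -
  have q: "p \<in> cdom c" using is_bumpD(5)[OF b] p by auto
  have \<Omega>: "open \<Omega>" "vector_field \<A> \<Omega> V" using V by (auto simp: admissible_def)
  note O = open_dom_TM[OF c] and graph = rep_graph[OF c V p(1) q]
  have z: "z = (x, rep c V x)" using graph(1) by (simp add: z_def x_def)
  have zin: "z \<in> dom_TM c" using graph(2) by (simp add: z x_def)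
  let ?S = "cmap c ` (\<Omega> \<inter> cdom c)"
  have S: "open ?S" "x \<in> ?S" using open_chart_part[OF c \<Omega>(1)] p q by (auto simp: x_def)
  have sm: "smooth_on ?S (rep c V)" using \<Omega>(2) c by (simp add: vector_field_rep)
  have dX: "rep c X differentiable (at x)" and dV: "rep c V differentiable (at x)"
    using rep_differentiable[OF X c p(1) q] rep_differentiable[OF \<Omega>(2) c p(1) q] by (simp_all add: x_def)
  have g: "((\<lambda>x. (x, rep c V x)) has_derivative (\<lambda>u. (u, pd u (rep c V) x))) (at x)"
    unfolding x_def by (rule graph_has_derivative[OF c \<Omega>(2) p(1) q])
  have d2: "((\<lambda>x. chr c \<beta> (x, rep c V x) (rep c X x) (rep c V x)) has_derivative
      (\<lambda>u. pd (u, pd u (rep c V) x) (\<lambda>z. chr c \<beta> z (rep c X x) (rep c V x)) z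
      + chr c \<beta> z (pd u (rep c X) x) (rep c V x) + chr c \<beta> z (rep c X x) (pd u (rep c V) x))) (at x)"
    using bilinear_slot_derivative[OF O, of "\<lambda>x. (x, rep c V x)" x "chr c \<beta>" "rep c X" "rep c V"]
      zin bilinear_chr smooth_on_differentiable[OF smooth_on_chr[OF c b] zin] differentiableI[OF g] dX dV
    by (simp add: pd_eq[OF g] z)
  have T: "open (cmap c ` (\<Omega> \<inter> N))" "x \<in> cmap c ` (\<Omega> \<inter> N)"
    using is_bumpD(2,5)[OF b] \<Omega>(1) p by (auto simp: x_def intro!: open_cmap_image[OF c])
  have "pd u (rep c W) x = pd u (\<lambda>x. pd (rep c X x) (rep c V) x + chr c \<beta> (x, rep c V x) (rep c X x) (rep c V x)) x"
  proof (rule pd_cong[OF T])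
    fix y assume "y \<in> cmap c ` (\<Omega> \<inter> N)"
    then obtain p' where p': "p' \<in> \<Omega>" "p' \<in> N" "y = cmap c p'" by auto
    moreover have "p' \<in> cdom c" using p' is_bumpD(5)[OF b] by auto
    ultimately show "rep c W y = pd (rep c X y) (rep c V) y + chr c \<beta> (y, rep c V y) (rep c X y) (rep c V y)"
      using conn_along_chart[OF c b V p'(1,2) X \<Omega>(2)] W by (simp add: rep_cmap[OF c])
  qed
  then show ?thesis
    by (simp add: pd_eq[OF has_derivative_add[OF pd_along_derivative[OF S sm dX] d2]])
qed

end

context finsler_conn
begin

text \<open>The right-hand side is the affine curvature of \<open>conn_along\<close> with the term
  differentiating \<open>conn_along \<A> D V V V\<close> left out, as that field is zero. Passing
  \<open>W\<close> separately lets its smoothness come from the Levi-Civita connection.\<close>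

lemma curvature_self_parallel:
  assumes V: "admissible \<A> A \<Omega> V" and par: "\<And>q. q \<in> \<Omega> \<Longrightarrow> conn_along \<A> D V V V q = 0"
    and X: "vector_field \<A> \<Omega> X" and W: "vector_field \<A> \<Omega> W" "\<And>q. q \<in> \<Omega> \<Longrightarrow> W q = conn_along \<A> D V X V q"
    and p: "p \<in> \<Omega>"
  shows "curvature_tensor \<A> A D (p, V p) (V p) (X p) (V p)
    = conn_along \<A> D V V W p - conn_along \<A> D V (lie_bracket \<A> V X) V p"
proof -
  let ?c = "chart_at \<A> p" and ?v = "(p, V p)"
  note c = chart_at(1)[of p] and q = chart_at(2)[of p]
  have \<Omega>: "open \<Omega>" "vector_field \<A> \<Omega> V" and v: "?v \<in> A" using V p by (auto simp: admissible_def)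
  obtain N \<beta> where b: "is_bump (cdom ?c) N \<beta>" "p \<in> N" by (rule chart_bump)
  let ?x = "cmap ?c p" and ?z = "tchart \<A> (chart_at \<A> p) (p, V p)"
  let ?r = "rep ?c V" and ?rX = "rep ?c X" and ?y = "V p" and ?\<xi> = "X p" and ?G = "chr ?c \<beta> ?z"
  have val: "rep ?c Y ?x = Y p" for Y by (simp add: rep_cmap[OF c q] tcoord_chart_at)
  have z: "?z = (?x, ?y)" by (simp add: tchart_def tcoord_chart_at)
  have zin: "?z \<in> dom_TM ?c" by (rule tchart_in_dom) (use q v in auto)
  let ?S = "cmap ?c ` (\<Omega> \<inter> cdom ?c)"
  have S: "open ?S" "?x \<in> ?S" using open_chart_part[OF c \<Omega>(1)] p q by auto
  have sm: "smooth_on ?S ?r" using \<Omega>(2) c by (simp add: vector_field_rep)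
  note linr = linear_diff[OF pd_linear_on[OF sm S(2)]]
  have sym: "?G a b' = ?G b' a" for a b' using chr_symmetric[OF torsion c b(1) v] b(2) by simp
  \<comment> \<open>Here the vertical derivative of the spray disappears: vertical components of the
    direction have no effect on the symbols evaluated at \<open>?y, ?y\<close>.\<close>
  have vert: "pd (u, w) (\<lambda>z. chr ?c \<beta> z ?y ?y) ?z = pd (u, 0) (\<lambda>z. chr ?c \<beta> z ?y ?y) ?z" for u w
    using linear_add[OF pd_linear_on[OF smooth_on_chr[OF c b(1)] zin], of "(u, 0)" "(0, w)" ?y ?y]
      vertical_derivative_chr[OF c b(1) v, of w] b(2) z by simp
  have l1: "curvature_tensor \<A> A D ?v ?y ?\<xi> ?y
      = pd (?y, - ?G ?y ?y) (\<lambda>z. chr ?c \<beta> z ?\<xi> ?y) ?z - pd (?\<xi>, 0) (\<lambda>z. chr ?c \<beta> z ?y ?y) ?z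
      + ?G ?y (?G ?\<xi> ?y) - ?G ?\<xi> (?G ?y ?y)"
  proof -
    have rv: "rep ?c (field_through \<A> p w) ?x = w" for w by (simp add: val field_through(2))
    have sz: "snd ?z = ?y" by (simp add: tchart_def tcoord_chart_at)
    have N: "fst ?v \<in> N" using b(2) by simp
    note f = field_through(1)
    show ?thesis
      using aniso_curvature_chart[OF c b(1) v N f f f, of p ?y p ?\<xi> p ?y]
      unfolding fst_conv rv sz vert[of ?\<xi> "- ?G ?\<xi> ?y"]
      by (simp only: curvature_tensor_def fst_conv tcoord_chart_at)
  qed
  have chart: "conn_along \<A> D V Y Y' p = pd (Y p) (rep ?c Y') ?x + ?G (Y p) (Y' p)"
    if "vector_field \<A> \<Omega> Y" "vector_field \<A> \<Omega> Y'" for Y Y'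
    using conn_along_chart[OF c b(1) V p b(2) that] by (simp add: tcoord_chart_at val z)
  have br: "lie_bracket \<A> V X p = pd ?y ?rX ?x - pd ?\<xi> ?r ?x"
    using lie_bracket_rep[OF c \<Omega>(1) p q \<Omega>(2) X] by (simp add: tcoord_chart_at val)
  have Wp: "W p = pd ?\<xi> ?r ?x + ?G ?\<xi> ?y" using W(2)[OF p] chart[OF X \<Omega>(2)] by simp
  have r1: "conn_along \<A> D V V W p = pd ?y (rep ?c W) ?x + ?G ?y (pd ?\<xi> ?r ?x + ?G ?\<xi> ?y)"
    using chart[OF \<Omega>(2) W(1)] Wp by simp
  have r2: "conn_along \<A> D V (lie_bracket \<A> V X) V p
      = pd (pd ?y ?rX ?x - pd ?\<xi> ?r ?x) ?r ?x + ?G (pd ?y ?rX ?x - pd ?\<xi> ?r ?x) ?y"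
    using chart[OF vector_field_lie_bracket[OF \<Omega>(1,2) X] \<Omega>(2)] br by simp
  have dW: "pd ?y (rep ?c W) ?x = pd ?y (pd ?\<xi> ?r) ?x + pd (pd ?y ?rX ?x) ?r ?x
    + pd (?y, pd ?y ?r ?x) (\<lambda>z. chr ?c \<beta> z ?\<xi> ?y) ?z + ?G (pd ?y ?rX ?x) ?y + ?G ?\<xi> (pd ?y ?r ?x)"
    using conn_along_derivative[OF c b(1) V p b(2) X W(2), of ?y] by (simp add: val)
  \<comment> \<open>Since \<open>V\<close> is parallel along itself, its derivative along
    \<open>V\<close> is exactly the vertical part of the horizontal lift of \<open>V p\<close>. The
    derivative along \<open>V\<close> therefore coincides with the horizontal one in the
    curvature.\<close>
  have s0: "pd ?y ?r ?x = - ?G ?y ?y"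
    using chart[OF \<Omega>(2) \<Omega>(2)] par[OF p] by (simp add: eq_neg_iff_add_eq_0)
  \<comment> \<open>The parallel equation holds on all of \<Omega> and may be differentiated in the
    direction \<xi>; the zero field plays the role of \<open>W\<close> in
    \<open>conn_along_derivative\<close>.\<close>
  have "pd ?\<xi> (rep ?c (\<lambda>q. 0)) ?x = pd ?\<xi> (\<lambda>x. 0) ?x"
    by (rule pd_cong[OF S]) (auto simp: rep_cmap[OF c] tcoord_simps[OF c])
  then have s1: "pd ?\<xi> (pd ?y ?r) ?x + pd (pd ?\<xi> ?r ?x) ?r ?x + pd (?\<xi>, 0) (\<lambda>z. chr ?c \<beta> z ?y ?y) ?z
      + ?G (pd ?\<xi> ?r ?x) ?y + ?G ?y (pd ?\<xi> ?r ?x) = 0"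
    using conn_along_derivative[OF c b(1) V p b(2) \<Omega>(2), of "\<lambda>q. 0" ?\<xi>] par
    by (simp add: val vert[of ?\<xi> "pd ?\<xi> ?r ?x"] pd_def[of _ "\<lambda>x. 0"])
  \<comment> \<open>The bracket removes the derivative of \<open>X\<close> along \<open>V\<close>.
    The parenthesis collects the terms which the differentiated parallel equation \<open>s1\<close>
    turns into the second Christoffel derivative of the curvature.\<close>
  have "conn_along \<A> D V V W p - conn_along \<A> D V (lie_bracket \<A> V X) V p
      = (pd ?\<xi> (pd ?y ?r) ?x + pd (pd ?\<xi> ?r ?x) ?r ?x + ?G (pd ?\<xi> ?r ?x) ?y + ?G ?y (pd ?\<xi> ?r ?x))
        + pd (?y, - ?G ?y ?y) (\<lambda>z. chr ?c \<beta> z ?\<xi> ?y) ?z - ?G ?\<xi> (?G ?y ?y) + ?G ?y (?G ?\<xi> ?y)"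
    unfolding r1 r2 dW s0
    using pd_commute[OF S sm, of ?y ?\<xi>]
    by (simp add: linr bilinear_lsub[OF bilinear_chr] bilinear_radd[OF bilinear_chr] bilinear_rneg[OF bilinear_chr])
  also have "\<dots> = - pd (?\<xi>, 0) (\<lambda>z. chr ?c \<beta> z ?y ?y) ?z
        + pd (?y, - ?G ?y ?y) (\<lambda>z. chr ?c \<beta> z ?\<xi> ?y) ?z - ?G ?\<xi> (?G ?y ?y) + ?G ?y (?G ?\<xi> ?y)"
    using s1 by (simp add: eq_neg_iff_add_eq_0 add_ac)
  also have "\<dots> = curvature_tensor \<A> A D ?v ?y ?\<xi> ?y" unfolding l1 by simp
  finally show ?thesis by simp
qed

end

theorem proposition3p9:
  fixes \<A> :: "('m::{t2_space,second_countable_topology}, 'e::euclidean_space) chart set"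
    and A :: "('m \<times> 'e) set"
    and L :: "'m \<times> 'e \<Rightarrow> real"
    and \<Omega> :: "'m set"
    and V :: "'m \<Rightarrow> 'e"
    and Q :: "'m \<times> 'e \<Rightarrow> 'e \<Rightarrow> 'e \<Rightarrow> 'e \<Rightarrow> real"
    and hatD :: "('m, 'e) aniso_conn"
    and barD :: "('m, 'e) affine_conn"
  defines "g\<^sub>V \<equiv> along (fund_tensor L) V"
    and "C\<^sub>V \<equiv> along (cartan_tensor L) V"
    and "Q\<^sub>V \<equiv> along Q V"
    and "R\<^sub>V \<equiv> along (curvature_tensor \<A> A hatD) V"
    and "D\<^sub>V \<equiv> conn_along \<A> hatD V"
  assumes "smooth_atlas \<A>"
    and "pseudo_finsler \<A> A L"
    and "admissible \<A> A \<Omega> V"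
    and "levi_civita \<A> \<Omega> g\<^sub>V barD"
    and "aniso_tensor3 \<A> A Q"
    and "symmetric3 A Q"
    and "\<forall>(p, v)\<in>A. \<forall>u w. Q (p, v) v u w = 0"
    and "aniso_connection \<A> A hatD"
    and "aniso_torsion_free \<A> A hatD"
    and "has_metric_derivative \<A> A L hatD Q"
  shows
    "(\<forall>X Y Z. vector_field \<A> \<Omega> X \<and> vector_field \<A> \<Omega> Y \<and> vector_field \<A> \<Omega> Z \<longrightarrow>
       (\<forall>p\<in>\<Omega>.
          g\<^sub>V p (D\<^sub>V X Y p - barD X Y p) (Z p) =
            - C\<^sub>V p (Y p) (Z p) (D\<^sub>V X V p) - C\<^sub>V p (Z p) (X p) (D\<^sub>V Y V p)
            + C\<^sub>V p (X p) (Y p) (D\<^sub>V Z V p) - 1 / 2 * Q\<^sub>V p (X p) (Y p) (Z p) \<and>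
          g\<^sub>V p (D\<^sub>V X V p - barD X V p) (Z p) = - C\<^sub>V p (Z p) (X p) (D\<^sub>V V V p) \<and>
          g\<^sub>V p (D\<^sub>V V X p - barD V X p) (Z p) = - C\<^sub>V p (X p) (Z p) (D\<^sub>V V V p) \<and>
          g\<^sub>V p (D\<^sub>V X Y p - barD X Y p) (V p) = C\<^sub>V p (X p) (Y p) (D\<^sub>V V V p))) \<and>
     (geodesic_field \<A> A L \<Omega> V \<longrightarrow>
       (\<forall>X. vector_field \<A> \<Omega> X \<longrightarrow>
          (\<forall>p\<in>\<Omega>.
             D\<^sub>V X V p = barD X V p \<and>
             D\<^sub>V V X p = barD V X p \<and>
             R\<^sub>V p (V p) (X p) (V p) = affine_curvature \<A> barD V X V p)))"
proof -
  interpret finsler_conn \<A> A hatD L Q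
    using assms(6-) by unfold_locales (auto simp: pseudo_finsler_def)
  note V = \<open>admissible \<A> A \<Omega> V\<close> and lc = \<open>levi_civita \<A> \<Omega> g\<^sub>V barD\<close>[unfolded g\<^sub>V_def]
  have \<Omega>: "open \<Omega>" "vector_field \<A> \<Omega> V" using V by (auto simp: admissible_def)
  have eq: "D\<^sub>V X V p = barD X V p \<and> D\<^sub>V V X p = barD V X p"
    if geo: "geodesic_field \<A> A L \<Omega> V" and X: "vector_field \<A> \<Omega> X" and p: "p \<in> \<Omega>" for X p
  proof -
    have v: "(p, V p) \<in> A" using V p by (auto simp: admissible_def)
    have z: "fund_tensor L (p, V p) (D\<^sub>V X V p - barD X V p) (Z p) = 0"
      "fund_tensor L (p, V p) (D\<^sub>V V X p - barD V X p) (Z p) = 0" if Z: "vector_field \<A> \<Omega> Z" for Z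
      unfolding D\<^sub>V_def difference_right[OF V lc X Z p] difference_left[OF V lc X Z p]
        geodesic_field_self[OF geo lc p] by (simp_all add: cartan_tensor_zero[OF v])
    show ?thesis
      using fund_tensor_cancel[OF V p, of "D\<^sub>V X V p" "barD X V p"]
        fund_tensor_cancel[OF V p, of "D\<^sub>V V X p" "barD V X p"] z by blast
  qed
  have curv: "R\<^sub>V p (V p) (X p) (V p) = affine_curvature \<A> barD V X V p"
    if geo: "geodesic_field \<A> A L \<Omega> V" and X: "vector_field \<A> \<Omega> X" and p: "p \<in> \<Omega>" for X p
  proof -
    have aff: "affine_connection \<A> \<Omega> barD" using lc by (simp add: levi_civita_def)
    have B: "vector_field \<A> \<Omega> (barD X V)" "vector_field \<A> \<Omega> (barD V V)"
      using aff X \<Omega>(2) by (simp_all add: affine_connection_def)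
    have par: "conn_along \<A> hatD V V V q = 0" if "q \<in> \<Omega>" for q
      by (rule geodesic_field_self[OF geo lc that])
    \<comment> \<open>The field \<open>barD V V\<close> is zero on \<Omega> only, while
      \<open>barD\<close> takes total functions; locality justifies replacing it by the zero
      field.\<close>
    have "barD X (barD V V) p = barD X (\<lambda>q. 0) p"
      by (rule affine_local[OF aff \<Omega>(1) p \<Omega>(1) p X X _ B(2) vector_field_zero[OF \<Omega>(1)]])
        (use eq[OF geo \<Omega>(2)] par in \<open>simp_all add: D\<^sub>V_def\<close>)
    then have "barD X (barD V V) p = 0" using affine_zero[OF aff \<Omega>(1) p X] by simp
    \<comment> \<open>Here \<open>W\<close> is \<open>barD X V\<close>, which is smooth because an
      affine connection preserves smooth fields, and which agrees on \<Omega> with the anisotropic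
      derivative of \<open>V\<close> because \<open>V\<close> is geodesic.\<close>
    moreover have "R\<^sub>V p (V p) (X p) (V p) = D\<^sub>V V (barD X V) p - D\<^sub>V (lie_bracket \<A> V X) V p"
      unfolding R\<^sub>V_def along_def D\<^sub>V_def
      by (rule curvature_self_parallel[OF V par X B(1) _ p]) (use eq[OF geo X] in \<open>simp_all add: D\<^sub>V_def\<close>)
    ultimately show ?thesis
      using eq[OF geo B(1) p] eq[OF geo vector_field_lie_bracket[OF \<Omega> X] p]
      by (simp add: affine_curvature_def)
  qed
  have formulas: "g\<^sub>V p (D\<^sub>V X Y p - barD X Y p) (Z p) =
            - C\<^sub>V p (Y p) (Z p) (D\<^sub>V X V p) - C\<^sub>V p (Z p) (X p) (D\<^sub>V Y V p)
            + C\<^sub>V p (X p) (Y p) (D\<^sub>V Z V p) - 1 / 2 * Q\<^sub>V p (X p) (Y p) (Z p) \<and>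
          g\<^sub>V p (D\<^sub>V X V p - barD X V p) (Z p) = - C\<^sub>V p (Z p) (X p) (D\<^sub>V V V p) \<and>
          g\<^sub>V p (D\<^sub>V V X p - barD V X p) (Z p) = - C\<^sub>V p (X p) (Z p) (D\<^sub>V V V p) \<and>
          g\<^sub>V p (D\<^sub>V X Y p - barD X Y p) (V p) = C\<^sub>V p (X p) (Y p) (D\<^sub>V V V p)"
    if "vector_field \<A> \<Omega> X" "vector_field \<A> \<Omega> Y" "vector_field \<A> \<Omega> Z" "p \<in> \<Omega>" for X Y Z p
    unfolding g\<^sub>V_def C\<^sub>V_def Q\<^sub>V_def D\<^sub>V_def along_def
    by (intro conjI difference_formula[OF V lc] difference_right[OF V lc] difference_left[OF V lc]
        difference_normal[OF V lc] that)
  show ?thesis using formulas eq curv by blast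
qed

end
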